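(* Let $d,k$ be integers with $k > d \ge 3$. Then the system $(X,m_X,T)$ has no non-trivial direct Bernoulli factors.
   Context: $\Gamma=\Gamma_{d,k}=\langle s_1,\dots,s_d : s_1^k=\dots=s_d^k=e\rangle$ is the free product of $d$ copies of $\mathbb{Z}_k=\mathbb{Z}/k\mathbb{Z}$. $X\le \mathbb{Z}_2^\Gamma$ is the closed subgroup $$X=\Big\{x\in\mathbb{Z}_2^\Gamma : \sum_{j=0}^{k-1}x_{gs_i^j}=0 \ \ \forall g\in\Gamma,\ i=1,\dots,d\Big\},$$ $m_X$ is its Haar probability measure, and $T$ is the shift action $(T^gx)_h=x_{g^{-1}h}$ of $\Gamma$. A Bernoulli shift over $\Gamma$ with standard probability base space $(\mathtt{K},\kappa)$ is the system $(\mathtt{K}^\Gamma,\kappa^\Gamma,T)$ with the shift action; it is trivial if $\kappa$ is supported on a single point. A factor map $\pi:(X_1,\mu_1,T_1)\to(X_2,\mu_2,T_2)$ of probability-measure-preserving $\Gamma$-systems (an a.e. defined, a.e. equivariant measurable map with $\pi_*\mu_1=\mu_2$) is direct if there is another factor map $\xi:(X_1,\mu_1,T_1)\to(X_3,\mu_3,T_3)$ such that $(\pi,\xi)$ is an isomorphism (measure conjugacy) from $(X_1,\mu_1,T_1)$ onto $(X_2\times X_3,\mu_2\times\mu_3,T_2\times T_3)$. A direct Bernoulli factor is the target of a direct factor map that is a Bernoulli shift. *)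

theory Defs
  imports
    "HOL-Probability.Probability"
    "HOL-Algebra.Product_Groups"
    "HOL-Library.Z2"
begin

section \<open>The free product of \<open>d\<close> copies of \<open>\<int>/k\<int>\<close>\<close>

text \<open>The letter \<open>(i, True)\<close> stands for the generator \<open>s\<^sub>i\<close> and \<open>(i, False)\<close> for its formal
  inverse.  Generators are numbered \<open>0, \<dots>, d - 1\<close>.\<close>

type_synonym gword = "(nat \<times> bool) list"

definition gwords :: "nat \<Rightarrow> gword set" where
  "gwords d = lists ({..<d} \<times> UNIV)"

inductive gword_eq :: "nat \<Rightarrow> nat \<Rightarrow> gword \<Rightarrow> gword \<Rightarrow> bool" for d k where
  refl: "u \<in> gwords d \<Longrightarrow> gword_eq d k u u"
| sym: "gword_eq d k u v \<Longrightarrow> gword_eq d k v u"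
| trans: "gword_eq d k u v \<Longrightarrow> gword_eq d k v w \<Longrightarrow> gword_eq d k u w"
| append: "gword_eq d k u u' \<Longrightarrow> gword_eq d k v v' \<Longrightarrow> gword_eq d k (u @ v) (u' @ v')"
| cancel: "i < d \<Longrightarrow> gword_eq d k [(i, b), (i, \<not> b)] []"
| relator: "i < d \<Longrightarrow> gword_eq d k (replicate k (i, True)) []"

definition gword_rel :: "nat \<Rightarrow> nat \<Rightarrow> (gword \<times> gword) set" where
  "gword_rel d k = {(u, v). gword_eq d k u v}"

definition Gam :: "nat \<Rightarrow> nat \<Rightarrow> gword set monoid" where
  "Gam d k = \<lparr>carrier = gwords d // gword_rel d k,
              monoid.mult = (\<lambda>A B. \<Union>u\<in>A. \<Union>v\<in>B. gword_rel d k `` {u @ v}),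
              one = gword_rel d k `` {[]}\<rparr>"

definition gen :: "nat \<Rightarrow> nat \<Rightarrow> nat \<Rightarrow> gword set" where
  "gen d k i = gword_rel d k `` {[(i, True)]}"

lemma gword_eq_words: "gword_eq d k u v \<Longrightarrow> u \<in> gwords d \<and> v \<in> gwords d"
  by (induction rule: gword_eq.induct) (auto simp: gwords_def)

lemma equiv_gword_rel: "equiv (gwords d) (gword_rel d k)"
proof (rule equivI)
  show "gword_rel d k \<subseteq> gwords d \<times> gwords d"
    using gword_eq_words by (auto simp: gword_rel_def)
  show "refl_on (gwords d) (gword_rel d k)"
    using gword_eq_words by (auto simp: refl_on_def gword_rel_def intro: gword_eq.refl)
  show "sym (gword_rel d k)"
    by (auto simp: sym_def gword_rel_def intro: gword_eq.sym)
  show "trans (gword_rel d k)"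
    by (auto simp: trans_def gword_rel_def intro: gword_eq.trans)
qed

lemma mult_Gam_class:
  assumes "u \<in> gwords d" "v \<in> gwords d"
  shows "gword_rel d k `` {u} \<otimes>\<^bsub>Gam d k\<^esub> gword_rel d k `` {v} = gword_rel d k `` {u @ v}"
proof -
  have "congruent2 (gword_rel d k) (gword_rel d k) (\<lambda>u v. gword_rel d k `` {u @ v})"
  proof (rule congruent2I')
    fix u u' v v'
    assume "(u, u') \<in> gword_rel d k" "(v, v') \<in> gword_rel d k"
    then have "(u @ v, u' @ v') \<in> gword_rel d k"
      unfolding gword_rel_def using gword_eq.append by blast
    then show "gword_rel d k `` {u @ v} = gword_rel d k `` {u' @ v'}"
      by (rule equiv_class_eq[OF equiv_gword_rel])
  qed
  then show ?thesis
    using UN_equiv_class2[OF equiv_gword_rel equiv_gword_rel _ assms] by (simp add: Gam_def)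
qed

lemma gword_inverse_ex:
  assumes "u \<in> gwords d"
  shows "\<exists>v\<in>gwords d. gword_eq d k (v @ u) []"
  using assms
proof (induction u)
  case Nil
  then show ?case by (auto simp: gwords_def intro!: bexI[of _ "[]"] gword_eq.refl)
next
  case (Cons a u)
  obtain i b where a: "a = (i, b)" by force
  have i: "i < d" and u: "u \<in> gwords d" using Cons.prems a by (auto simp: gwords_def)
  obtain v where v: "v \<in> gwords d" "gword_eq d k (v @ u) []" using Cons.IH[OF u] by blast
  have "gword_eq d k ([(i, \<not> b), (i, b)] @ u) ([] @ u)"
    using gword_eq.cancel[OF i, of k "\<not> b"] gword_eq.refl[OF u] by (intro gword_eq.append) auto
  then have "gword_eq d k (v @ ([(i, \<not> b), (i, b)] @ u)) (v @ u)"
    using gword_eq.append[OF gword_eq.refl[OF v(1)]] by force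
  then have "gword_eq d k ((v @ [(i, \<not> b)]) @ a # u) []"
    using gword_eq.trans[OF _ v(2)] a by simp
  moreover have "v @ [(i, \<not> b)] \<in> gwords d" using v(1) i by (auto simp: gwords_def)
  ultimately show ?case by blast
qed

lemma group_Gam: "group (Gam d k)"
proof (rule groupI)
  have carr: "carrier (Gam d k) = (\<lambda>u. gword_rel d k `` {u}) ` gwords d"
    by (auto simp: Gam_def quotient_def)
  have app: "u @ v \<in> gwords d" if "u \<in> gwords d" "v \<in> gwords d" for u v
    using that by (auto simp: gwords_def)
  have nil: "[] \<in> gwords d" by (simp add: gwords_def)
  have one: "\<one>\<^bsub>Gam d k\<^esub> = gword_rel d k `` {[]}" by (simp add: Gam_def)
  show "x \<otimes>\<^bsub>Gam d k\<^esub> y \<in> carrier (Gam d k)"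
    if "x \<in> carrier (Gam d k)" "y \<in> carrier (Gam d k)" for x y
    using that by (auto simp: carr mult_Gam_class app)
  show "\<one>\<^bsub>Gam d k\<^esub> \<in> carrier (Gam d k)"
    using nil by (auto simp: carr one)
  show "x \<otimes>\<^bsub>Gam d k\<^esub> y \<otimes>\<^bsub>Gam d k\<^esub> z = x \<otimes>\<^bsub>Gam d k\<^esub> (y \<otimes>\<^bsub>Gam d k\<^esub> z)"
    if "x \<in> carrier (Gam d k)" "y \<in> carrier (Gam d k)" "z \<in> carrier (Gam d k)" for x y z
    using that by (auto simp: carr mult_Gam_class app)
  show "\<one>\<^bsub>Gam d k\<^esub> \<otimes>\<^bsub>Gam d k\<^esub> x = x" if "x \<in> carrier (Gam d k)" for x
    using that nil by (auto simp: carr one mult_Gam_class)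
  show "\<exists>y\<in>carrier (Gam d k). y \<otimes>\<^bsub>Gam d k\<^esub> x = \<one>\<^bsub>Gam d k\<^esub>"
    if x: "x \<in> carrier (Gam d k)" for x
  proof -
    obtain u where u: "u \<in> gwords d" "x = gword_rel d k `` {u}" using x unfolding carr by blast
    obtain v where v: "v \<in> gwords d" "gword_eq d k (v @ u) []"
      using gword_inverse_ex[OF u(1)] by blast
    have "gword_rel d k `` {v} \<otimes>\<^bsub>Gam d k\<^esub> x = \<one>\<^bsub>Gam d k\<^esub>"
    proof -
      have "(v @ u, []) \<in> gword_rel d k" using v(2) by (simp add: gword_rel_def)
      then show ?thesis
        unfolding u(2) one mult_Gam_class[OF v(1) u(1)] by (rule equiv_class_eq[OF equiv_gword_rel])
    qed
    then show ?thesis using v(1) carr by blast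
  qed
qed

lemma gen_closed: "i < d \<Longrightarrow> gen d k i \<in> carrier (Gam d k)"
  by (auto simp: gen_def Gam_def gwords_def intro: quotientI)

section \<open>Measure-preserving systems\<close>

definition borel_of :: "'a topology \<Rightarrow> 'a measure" where
  "borel_of T = sigma (topspace T) {U. openin T U}"

text \<open>For compact metrizable groups every Borel probability measure is Radon, so no separate
  regularity requirement is needed.\<close>

definition haar_prob_measure :: "('a, 'b) monoid_scheme \<Rightarrow> 'a topology \<Rightarrow> 'a measure \<Rightarrow> bool" where
  "haar_prob_measure G T M \<longleftrightarrow>
     prob_space M \<and> space M = topspace T \<and> sets M = sets (borel_of T) \<and>
     (\<forall>a\<in>carrier G. \<forall>A\<in>sets M. emeasure M ((\<lambda>x. a \<otimes>\<^bsub>G\<^esub> x) ` A) = emeasure M A)"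

definition standard_prob_space :: "'a measure \<Rightarrow> bool" where
  "standard_prob_space M \<longleftrightarrow> prob_space M \<and>
     (\<exists>T. topspace T = space M \<and> completely_metrizable_space T \<and> second_countable T \<and>
          sets M = sets (borel_of T))"

definition pmp_system :: "('g, 'b) monoid_scheme \<Rightarrow> 'x measure \<Rightarrow> ('g \<Rightarrow> 'x \<Rightarrow> 'x) \<Rightarrow> bool" where
  "pmp_system G M T \<longleftrightarrow> prob_space M \<and>
     (\<forall>g\<in>carrier G. T g \<in> measurable M M \<and> distr M M (T g) = M) \<and>
     (\<forall>x\<in>space M. T \<one>\<^bsub>G\<^esub> x = x) \<and>
     (\<forall>g\<in>carrier G. \<forall>h\<in>carrier G. \<forall>x\<in>space M. T (g \<otimes>\<^bsub>G\<^esub> h) x = T g (T h x))"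

text \<open>An almost everywhere defined map is given by a total function whose values matter only on
  some measurable set \<open>X\<^sub>0\<close> of full measure.\<close>

definition factor_map ::
  "('g, 'b) monoid_scheme \<Rightarrow> 'x measure \<Rightarrow> ('g \<Rightarrow> 'x \<Rightarrow> 'x) \<Rightarrow>
   'y measure \<Rightarrow> ('g \<Rightarrow> 'y \<Rightarrow> 'y) \<Rightarrow> ('x \<Rightarrow> 'y) \<Rightarrow> bool" where
  "factor_map G M1 T1 M2 T2 \<pi> \<longleftrightarrow>
     (\<exists>X\<^sub>0\<in>sets M1. (AE x in M1. x \<in> X\<^sub>0) \<and>
        \<pi> \<in> measurable (restrict_space M1 X\<^sub>0) M2 \<and>
        distr (restrict_space M1 X\<^sub>0) M2 \<pi> = M2) \<and>
     (\<forall>g\<in>carrier G. AE x in M1. \<pi> (T1 g x) = T2 g (\<pi> x))"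

definition measure_conjugacy ::
  "('g, 'b) monoid_scheme \<Rightarrow> 'x measure \<Rightarrow> ('g \<Rightarrow> 'x \<Rightarrow> 'x) \<Rightarrow>
   'y measure \<Rightarrow> ('g \<Rightarrow> 'y \<Rightarrow> 'y) \<Rightarrow> ('x \<Rightarrow> 'y) \<Rightarrow> bool" where
  "measure_conjugacy G M1 T1 M2 T2 \<pi> \<longleftrightarrow> factor_map G M1 T1 M2 T2 \<pi> \<and>
     (\<exists>\<theta>. factor_map G M2 T2 M1 T1 \<theta> \<and>
          (AE x in M1. \<theta> (\<pi> x) = x) \<and> (AE y in M2. \<pi> (\<theta> y) = y))"

text \<open>The type argument is the type of the points of the complementary factor; quantifying over
  all complementary factors amounts to leaving this type variable free in a theorem.\<close>

definition direct_factor_map ::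
  "'z itself \<Rightarrow> ('g, 'b) monoid_scheme \<Rightarrow> 'x measure \<Rightarrow> ('g \<Rightarrow> 'x \<Rightarrow> 'x) \<Rightarrow>
   'y measure \<Rightarrow> ('g \<Rightarrow> 'y \<Rightarrow> 'y) \<Rightarrow> ('x \<Rightarrow> 'y) \<Rightarrow> bool" where
  "direct_factor_map _ G M1 T1 M2 T2 \<pi> \<longleftrightarrow> factor_map G M1 T1 M2 T2 \<pi> \<and>
     (\<exists>(M3 :: 'z measure) T3 \<xi>. pmp_system G M3 T3 \<and> factor_map G M1 T1 M3 T3 \<xi> \<and>
        measure_conjugacy G M1 T1 (M2 \<Otimes>\<^sub>M M3) (\<lambda>g (y, z). (T2 g y, T3 g z)) (\<lambda>x. (\<pi> x, \<xi> x)))"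

text \<open>Configurations are functions on the carrier of \<open>G\<close>, extended by \<open>undefined\<close>.\<close>

definition shift_action :: "('g, 'b) monoid_scheme \<Rightarrow> 'g \<Rightarrow> ('g \<Rightarrow> 'a) \<Rightarrow> ('g \<Rightarrow> 'a)" where
  "shift_action G g x = (\<lambda>h\<in>carrier G. x (inv\<^bsub>G\<^esub> g \<otimes>\<^bsub>G\<^esub> h))"

definition bernoulli_measure :: "('g, 'b) monoid_scheme \<Rightarrow> 'k measure \<Rightarrow> ('g \<Rightarrow> 'k) measure" where
  "bernoulli_measure G \<kappa> = PiM (carrier G) (\<lambda>_. \<kappa>)"

definition trivial_base :: "'k measure \<Rightarrow> bool" where
  "trivial_base \<kappa> \<longleftrightarrow> (\<exists>a\<in>space \<kappa>. AE x in \<kappa>. x = a)"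

definition direct_bernoulli_factor ::
  "'z itself \<Rightarrow> ('g, 'b) monoid_scheme \<Rightarrow> 'x measure \<Rightarrow> ('g \<Rightarrow> 'x \<Rightarrow> 'x) \<Rightarrow> 'k measure \<Rightarrow> bool" where
  "direct_bernoulli_factor Z G M T \<kappa> \<longleftrightarrow> standard_prob_space \<kappa> \<and>
     (\<exists>\<pi>. direct_factor_map Z G M T (bernoulli_measure G \<kappa>) (shift_action G) \<pi>)"

section \<open>The compact group \<open>X\<close>\<close>

definition Z2_group :: "bit monoid" where
  "Z2_group = \<lparr>carrier = UNIV, monoid.mult = (+), one = 0\<rparr>"

definition parity_set :: "nat \<Rightarrow> nat \<Rightarrow> (gword set \<Rightarrow> bit) set" where
  "parity_set d k = {x \<in> carrier (Gam d k) \<rightarrow>\<^sub>E UNIV.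
     \<forall>g\<in>carrier (Gam d k). \<forall>i<d.
       (\<Sum>j<k. x (g \<otimes>\<^bsub>Gam d k\<^esub> (gen d k i [^]\<^bsub>Gam d k\<^esub> j))) = 0}"

definition parity_group :: "nat \<Rightarrow> nat \<Rightarrow> (gword set \<Rightarrow> bit) monoid" where
  "parity_group d k = (product_group (carrier (Gam d k)) (\<lambda>_. Z2_group))\<lparr>carrier := parity_set d k\<rparr>"

definition parity_topology :: "nat \<Rightarrow> nat \<Rightarrow> (gword set \<Rightarrow> bit) topology" where
  "parity_topology d k =
     subtopology (product_topology (\<lambda>_. discrete_topology UNIV) (carrier (Gam d k))) (parity_set d k)"

lemma group_Z2_group: "group Z2_group"
proof (rule groupI)
  show "\<exists>y\<in>carrier Z2_group. y \<otimes>\<^bsub>Z2_group\<^esub> x = \<one>\<^bsub>Z2_group\<^esub>" for x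
    by (intro bexI[of _ x]) (simp_all add: Z2_group_def)
qed (auto simp: Z2_group_def intro: add.assoc)

lemma subgroup_parity_set:
  "subgroup (parity_set d k) (product_group (carrier (Gam d k)) (\<lambda>_. Z2_group))"
proof -
  interpret Gam: group "Gam d k" by (rule group_Gam)
  interpret P: group "product_group (carrier (Gam d k)) (\<lambda>_. Z2_group)"
    by (simp add: group_Z2_group)
  have mem: "g \<otimes>\<^bsub>Gam d k\<^esub> (gen d k i [^]\<^bsub>Gam d k\<^esub> j) \<in> carrier (Gam d k)"
    if "g \<in> carrier (Gam d k)" "i < d" for g i and j :: nat
    using that gen_closed by auto
  have invz: "inv\<^bsub>Z2_group\<^esub> b = b" for b
    by (rule group.inv_equality[OF group_Z2_group]) (auto simp: Z2_group_def)
  show ?thesis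
  proof (rule P.subgroupI)
    show "parity_set d k \<subseteq> carrier (product_group (carrier (Gam d k)) (\<lambda>_. Z2_group))"
      by (auto simp: parity_set_def Z2_group_def)
    have "(\<lambda>_\<in>carrier (Gam d k). 0) \<in> parity_set d k"
      by (auto simp: parity_set_def mem)
    then show "parity_set d k \<noteq> {}" by blast
    show "inv\<^bsub>product_group (carrier (Gam d k)) (\<lambda>_. Z2_group)\<^esub> x \<in> parity_set d k"
      if x: "x \<in> parity_set d k" for x
    proof -
      have "x \<in> carrier (Gam d k) \<rightarrow>\<^sub>E carrier Z2_group"
        using x by (auto simp: parity_set_def Z2_group_def)
      then have "inv\<^bsub>product_group (carrier (Gam d k)) (\<lambda>_. Z2_group)\<^esub> x
          = (\<lambda>i\<in>carrier (Gam d k). x i)"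
        using group_Z2_group by (subst inv_product_group) (auto simp: invz)
      also have "\<dots> = x" using x by (auto simp: parity_set_def PiE_def extensional_restrict)
      finally show ?thesis using x by simp
    qed
    show "x \<otimes>\<^bsub>product_group (carrier (Gam d k)) (\<lambda>_. Z2_group)\<^esub> y \<in> parity_set d k"
      if x: "x \<in> parity_set d k" and y: "y \<in> parity_set d k" for x y
    proof -
      let ?z = "\<lambda>h\<in>carrier (Gam d k). x h + y h"
      have "(\<Sum>j<k. ?z (g \<otimes>\<^bsub>Gam d k\<^esub> (gen d k i [^]\<^bsub>Gam d k\<^esub> j))) = 0"
        if g: "g \<in> carrier (Gam d k)" "i < d" for g i
      proof -
        let ?h = "\<lambda>j. g \<otimes>\<^bsub>Gam d k\<^esub> (gen d k i [^]\<^bsub>Gam d k\<^esub> j)"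
        have "(\<Sum>j<k. ?z (?h j)) = (\<Sum>j<k. x (?h j) + y (?h j))"
          using mem[OF g] by (intro sum.cong) simp_all
        also have "\<dots> = (\<Sum>j<k. x (?h j)) + (\<Sum>j<k. y (?h j))"
          by (rule sum.distrib)
        also have "(\<Sum>j<k. x (?h j)) = 0"
          using x g unfolding parity_set_def by blast
        also have "(\<Sum>j<k. y (?h j)) = 0"
          using y g unfolding parity_set_def by blast
        finally show ?thesis by (simp only: add_0)
      qed
      then have "?z \<in> parity_set d k"
        unfolding parity_set_def by (intro CollectI conjI ballI allI impI) simp_all
      then show ?thesis by (simp add: Z2_group_def)
    qed
  qed
qed

end

theory Submission
  imports Defs "HOL-Combinatorics.Permutations" "HOL-Real_Asymp.Real_Asymp"
begin

text \<open>
  Suppose that \<open>X\<close> is conjugate to \<open>K\<^sup>\<Gamma> \<times> Z\<close> with \<open>K\<close> nontrivial.  Resampling the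
  Bernoulli coordinate at a sparse set of sites moves a Haar random point \<open>x\<close> to another point
  \<open>x'\<close> of \<open>X\<close>, and \<open>y = x - x'\<close> is a nonzero equivariant random element of \<open>X\<close> with arbitrarily
  small density \<open>p\<close> of ones.  All the randomness used comes from three independent Haar points of \<open>X\<close>.

  Such a \<open>y\<close> does not exist.  Approximate it by a local function of the three points and evaluate
  this function on uniformly random codewords of the code \<open>X\<^sub>\<rho>\<close> on a random \<open>n\<close>-lift \<open>\<rho>\<close> of a large
  finite quotient of \<open>\<Gamma>\<close>.  Since \<open>d < k\<close>, a first-moment bound shows that \<open>X\<^sub>\<rho>\<close> has no dual
  codewords of small support except the local ones, so random codewords look locally exactly like
  Haar points.  This produces a set of vertices of density about \<open>p\<close> that meets almost every check in
  an even number of vertices.  Such a set touches at most about \<open>d p / 2\<close> checks per vertex, and for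
  \<open>d \<ge> 3\<close> and small \<open>p\<close> another first-moment bound shows that typical lifts admit no such set.
\<close>

section \<open>The free product: actions and residual finiteness\<close>

\<comment> \<open>these would shadow the HOL facts of the same base names\<close>
hide_fact (open) gword_eq.refl gword_eq.sym gword_eq.trans

text \<open>Both numerical hypotheses come from exponents in union bounds. For a family of checks
  let P be the product over the classes of the number of families of the same size. A prescribed
  check sum has probability at most P^(-k/d): at each base vertex the d bounds are averaged
  geometrically, and every class is met by k base vertices. Summing P^(1-k/d) converges because k >
  d. For sets of density p, each base vertex contributes about p^(-p) choices of the set, p^(-dp/2)
  choices of the touched checks and a probability p^(dp), all to the power n; the exponent 1 + d/2 -
  d of 1/p is negative from d = 3 on. A random action has short cycles, and near them codewords
  differ from Haar points. Lifting a finite \<Gamma>-set into which the relevant windows embed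
  excludes them beforehand; the counting is then done fibre by fibre. Of the three Haar points, the
  first places the sites to be resampled, the second supplies the new Bernoulli values and the third
  is the point modified. Since the sites are independent of all values, the modified point is again
  Haar distributed.\<close>

definition letter_step :: "nat \<Rightarrow> (nat \<Rightarrow> 'v \<Rightarrow> 'v) \<Rightarrow> nat \<times> bool \<Rightarrow> 'v \<Rightarrow> 'v" where
  "letter_step k f a = f (fst a) ^^ (if snd a then 1 else k - 1)"

definition run_word :: "nat \<Rightarrow> (nat \<Rightarrow> 'v \<Rightarrow> 'v) \<Rightarrow> gword \<Rightarrow> 'v \<Rightarrow> 'v" where
  "run_word k f w v = foldl (\<lambda>v a. letter_step k f a v) v w"

lemma run_word_Nil [simp]: "run_word k f [] v = v"
  by (simp add: run_word_def)

lemma run_word_append: "run_word k f (u @ w) v = run_word k f w (run_word k f u v)"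
  by (simp add: run_word_def)

lemma run_word_replicate: "run_word k f (replicate j (i, True)) v = (f i ^^ j) v"
  by (induction j arbitrary: v) (auto simp: run_word_def letter_step_def funpow_swap1)

lemma funpow_closed:
  assumes "\<And>x. x \<in> V \<Longrightarrow> f x \<in> V" "x \<in> V"
  shows "(f ^^ j) x \<in> V"
  using assms by (induction j) auto

lemma run_word_closed:
  assumes "\<And>i x. i < d \<Longrightarrow> x \<in> V \<Longrightarrow> f i x \<in> V" "w \<in> gwords d" "v \<in> V"
  shows "run_word k f w v \<in> V"
  using assms(2,3)
proof (induction w arbitrary: v)
  case (Cons a w)
  have "letter_step k f a v \<in> V"
    using Cons.prems assms(1) unfolding letter_step_def gwords_def
    by (intro funpow_closed) auto
  moreover have "w \<in> gwords d" using Cons.prems by (auto simp: gwords_def)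
  ultimately show ?case using Cons.IH by (simp add: run_word_def)
qed simp

text \<open>An inverse letter is run as the (k-1)-st power of its generator, so cancellation and
  relator both reduce to \<open>f i ^^ k\<close> being the identity on \<open>V\<close>.\<close>

lemma run_word_cong:
  assumes "gword_eq d k u w"
    and f: "\<And>i x. i < d \<Longrightarrow> x \<in> V \<Longrightarrow> f i x \<in> V"
    and ord: "\<And>i x. i < d \<Longrightarrow> x \<in> V \<Longrightarrow> (f i ^^ k) x = x"
    and "k > 0" "v \<in> V"
  shows "run_word k f u v = run_word k f w v"
  using assms(1,5)
proof (induction arbitrary: v rule: gword_eq.induct)
  case (append u u' w w')
  have "run_word k f u v \<in> V"
    using run_word_closed[where f = f and d = d and V = V] f gword_eq_words[OF append.hyps(1)] append.prems
    by blast
  then show ?case using append by (simp add: run_word_append)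
next
  case (cancel i b)
  have "(f i ^^ (k - 1)) (f i v) = (f i ^^ k) v" "f i ((f i ^^ (k - 1)) v) = (f i ^^ k) v"
    using \<open>k > 0\<close> by (cases k; simp add: funpow_swap1)+
  then show ?case
    using ord[OF cancel] by (auto simp: run_word_def letter_step_def)
next
  case (relator i)
  then show ?case using ord by (simp add: run_word_replicate)
qed auto

definition gclass :: "nat \<Rightarrow> nat \<Rightarrow> gword \<Rightarrow> gword set" where
  "gclass d k w = gword_rel d k `` {w}"

lemma carrier_Gam: "carrier (Gam d k) = gclass d k ` gwords d"
  by (auto simp: Gam_def quotient_def gclass_def)

lemma one_Gam: "\<one>\<^bsub>Gam d k\<^esub> = gclass d k []"
  by (simp add: Gam_def gclass_def)

lemma mult_gclass:
  "u \<in> gwords d \<Longrightarrow> v \<in> gwords d \<Longrightarrow> gclass d k u \<otimes>\<^bsub>Gam d k\<^esub> gclass d k v = gclass d k (u @ v)"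
  by (simp add: gclass_def mult_Gam_class)

lemma gclass_eqI: "gword_eq d k u v \<Longrightarrow> gclass d k u = gclass d k v"
  unfolding gclass_def by (rule equiv_class_eq[OF equiv_gword_rel]) (simp add: gword_rel_def)

lemma gen_gclass: "gen d k i = gclass d k [(i, True)]"
  by (simp add: gen_def gclass_def)

lemma gen_pow_gclass:
  assumes "i < d"
  shows "gen d k i [^]\<^bsub>Gam d k\<^esub> (j::nat) = gclass d k (replicate j (i, True))"
proof (induction j)
  case 0
  then show ?case by (simp add: one_Gam)
next
  case (Suc j)
  interpret Gam: group "Gam d k" by (rule group_Gam)
  have "gclass d k (replicate j (i, True)) \<otimes>\<^bsub>Gam d k\<^esub> gclass d k [(i, True)]
      = gclass d k (replicate j (i, True) @ [(i, True)])"
    using assms by (intro mult_gclass) (auto simp: gwords_def)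
  then show ?case using Suc by (simp add: gen_gclass replicate_append_same)
qed

lemma gen_pow_k: "i < d \<Longrightarrow> gen d k i [^]\<^bsub>Gam d k\<^esub> k = \<one>\<^bsub>Gam d k\<^esub>"
  by (simp add: gen_pow_gclass one_Gam gclass_eqI gword_eq.relator)

lemma countable_carrier_Gam: "countable (carrier (Gam d k))"
  unfolding carrier_Gam by (rule countable_image, rule countableI_type)

text \<open>The left-to-right reading of words makes this a right action.\<close>

definition right_action :: "('g, 'b) monoid_scheme \<Rightarrow> 'v set \<Rightarrow> ('v \<Rightarrow> 'g \<Rightarrow> 'v) \<Rightarrow> bool" where
  "right_action G V act \<longleftrightarrow>
     (\<forall>x\<in>V. act x \<one>\<^bsub>G\<^esub> = x) \<and> (\<forall>x\<in>V. \<forall>g\<in>carrier G. act x g \<in> V) \<and>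
     (\<forall>x\<in>V. \<forall>g\<in>carrier G. \<forall>h\<in>carrier G. act x (g \<otimes>\<^bsub>G\<^esub> h) = act (act x g) h)"

text \<open>Universal property of the free product: the k-th powers are its only relations, so d
  maps of order dividing k can be prescribed freely. The concrete \<Gamma>-sets below are obtained
  from it.\<close>

lemma right_action_Gam_exists:
  fixes f :: "nat \<Rightarrow> 'v \<Rightarrow> 'v"
  assumes f: "\<And>i x. i < d \<Longrightarrow> x \<in> V \<Longrightarrow> f i x \<in> V"
    and ord: "\<And>i x. i < d \<Longrightarrow> x \<in> V \<Longrightarrow> (f i ^^ k) x = x"
    and k: "k > 0"
  shows "\<exists>act. right_action (Gam d k) V act \<and> (\<forall>i<d. \<forall>x\<in>V. act x (gen d k i) = f i x)"
proof -
  \<comment> \<open>By \<open>run_word_cong\<close> the result does not depend on the representative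
    that \<open>SOME\<close> picks.\<close>
  define act where "act v A = run_word k f (SOME u. u \<in> A) v" for v and A :: "gword set"
  have act: "act v (gclass d k u) = run_word k f u v" if "u \<in> gwords d" "v \<in> V" for u v
  proof -
    have "u \<in> gclass d k u" using that by (auto simp: gclass_def gword_rel_def intro: gword_eq.refl)
    then have "(SOME w. w \<in> gclass d k u) \<in> gclass d k u" by (rule someI)
    then have "gword_eq d k u (SOME w. w \<in> gclass d k u)"
      by (simp add: gclass_def gword_rel_def)
    from run_word_cong[OF this f ord k that(2)] show ?thesis by (simp add: act_def)
  qed
  have nil: "[] \<in> gwords d" by (simp add: gwords_def)
  have app: "u @ v \<in> gwords d" if "u \<in> gwords d" "v \<in> gwords d" for u v
    using that by (auto simp: gwords_def)
  have closed: "run_word k f u v \<in> V" if "u \<in> gwords d" "v \<in> V" for u v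
    using run_word_closed[where f = f and d = d and V = V] f that by blast
  have "right_action (Gam d k) V act"
    unfolding right_action_def
    by (auto simp: carrier_Gam one_Gam act nil mult_gclass app closed run_word_append)
  moreover have "act x (gen d k i) = f i x" if "i < d" "x \<in> V" for i x
  proof -
    have "[(i, True)] \<in> gwords d" using that by (auto simp: gwords_def)
    then show ?thesis using that by (simp add: gen_gclass act run_word_def letter_step_def)
  qed
  ultimately show ?thesis by blast
qed

lemma right_actionD:
  assumes "right_action G V act" "x \<in> V"
  shows "act x \<one>\<^bsub>G\<^esub> = x"
    and "g \<in> carrier G \<Longrightarrow> act x g \<in> V"
    and "g \<in> carrier G \<Longrightarrow> h \<in> carrier G \<Longrightarrow> act x (g \<otimes>\<^bsub>G\<^esub> h) = act (act x g) h"
  using assms by (auto simp: right_action_def)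

lemma gen_pow_closed: "i < d \<Longrightarrow> gen d k i [^]\<^bsub>Gam d k\<^esub> (j::nat) \<in> carrier (Gam d k)"
  using group.is_monoid[OF group_Gam] monoid.nat_pow_closed gen_closed by metis

text \<open>Induction over right multiplication by generators reaches inverses as well, because an
  inverse letter equals a (k-1)-st power.\<close>

lemma Gam_induct [consumes 2, case_names one step]:
  assumes "k > 0" "g \<in> carrier (Gam d k)" and one: "P \<one>\<^bsub>Gam d k\<^esub>"
    and step: "\<And>g i. g \<in> carrier (Gam d k) \<Longrightarrow> i < d \<Longrightarrow> P g \<Longrightarrow> P (g \<otimes>\<^bsub>Gam d k\<^esub> gen d k i)"
  shows "P g"
proof -
  interpret Gam: group "Gam d k" by (rule group_Gam)
  have pow: "P (g \<otimes>\<^bsub>Gam d k\<^esub> (gen d k i [^]\<^bsub>Gam d k\<^esub> (j::nat)))"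
    if "g \<in> carrier (Gam d k)" "i < d" "P g" for g i j
  proof (induction j)
    case (Suc j)
    then show ?case
      using step[of "g \<otimes>\<^bsub>Gam d k\<^esub> (gen d k i [^]\<^bsub>Gam d k\<^esub> j)" i] that
      by (simp add: gen_closed gen_pow_closed Gam.m_assoc)
  qed (use that in simp)
  have "P (gclass d k w)" if "w \<in> gwords d" for w
    using that
  proof (induction w rule: rev_induct)
    case Nil
    then show ?case using one by (simp add: one_Gam)
  next
    case (snoc a w)
    obtain i b where a: "a = (i, b)" by force
    have i: "i < d" and w: "w \<in> gwords d" using snoc.prems a by (auto simp: gwords_def)
    have IH: "P (gclass d k w)" using snoc.IH w by blast
    have in1: "gclass d k w \<in> carrier (Gam d k)" using w by (auto simp: carrier_Gam)
    define j where "j = (if b then 1 else k - 1)"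
    have "gclass d k [a] = gen d k i [^]\<^bsub>Gam d k\<^esub> j"
    proof (cases b)
      case True
      then show ?thesis using a i by (simp add: j_def gen_gclass[symmetric] gen_closed)
    next
      case False
      have ab: "[(i, False)] \<in> gwords d" "replicate (k - 1) (i, True) \<in> gwords d" "[(i, True)] \<in> gwords d"
        using i by (auto simp: gwords_def)
      \<comment> \<open>The word consisting of the inverse letter and k copies of the letter is
        reduced in two ways.\<close>
      have "gword_eq d k ([(i, False)] @ replicate k (i, True)) ([(i, False)] @ [])"
        by (intro gword_eq.append gword_eq.refl gword_eq.relator ab i)
      moreover have "gword_eq d k (([(i, False)] @ [(i, True)]) @ replicate (k - 1) (i, True))
         ([] @ replicate (k - 1) (i, True))"
        using gword_eq.cancel[OF i, of k False]
        by (intro gword_eq.append gword_eq.refl ab) auto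
      moreover have "replicate k (i, True) = (i, True) # replicate (k - 1) (i, True)"
        using \<open>k > 0\<close> by (cases k) auto
      ultimately have "gword_eq d k [(i, False)] (replicate (k - 1) (i, True))"
        by (auto intro: gword_eq.trans gword_eq.sym)
      then show ?thesis using False a i by (simp add: j_def gen_pow_gclass gclass_eqI)
    qed
    moreover have "gclass d k (w @ [a]) = gclass d k w \<otimes>\<^bsub>Gam d k\<^esub> gclass d k [a]"
      using w snoc.prems by (subst mult_gclass) (auto simp: gwords_def)
    ultimately show ?case using pow[OF in1 i IH] by simp
  qed
  then show ?thesis using assms(2) by (auto simp: carrier_Gam)
qed

lemma right_action_gen_pow:
  assumes "right_action (Gam d k) V act" "x \<in> V" "i < d"
    and "\<And>x. x \<in> V \<Longrightarrow> act x (gen d k i) = f x"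
  shows "act x (gen d k i [^]\<^bsub>Gam d k\<^esub> (j::nat)) = (f ^^ j) x"
proof (induction j)
  case 0
  then show ?case using right_actionD(1)[OF assms(1,2)] by simp
next
  case (Suc j)
  interpret Gam: group "Gam d k" by (rule group_Gam)
  have "act x (gen d k i [^]\<^bsub>Gam d k\<^esub> j) \<in> V"
    using right_actionD(2)[OF assms(1,2)] gen_pow_closed assms(3) by blast
  then show ?case
    using Suc right_actionD(3)[OF assms(1,2)] gen_pow_closed gen_closed assms(3,4) by simp
qed

text \<open>Let every generator rotate k points cyclically: the power moves 0 to j.\<close>

lemma gen_pow_neq_one:
  assumes "i < d" "0 < j" "j < k"
  shows "gen d k i [^]\<^bsub>Gam d k\<^esub> j \<noteq> \<one>\<^bsub>Gam d k\<^esub>"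
proof
  assume eq: "gen d k i [^]\<^bsub>Gam d k\<^esub> j = \<one>\<^bsub>Gam d k\<^esub>"
  define f where "f = (\<lambda>x. Suc x mod k)"
  have f: "(f ^^ m) x = (x + m) mod k" if "x < k" for m x
    using that by (induction m) (auto simp: f_def mod_Suc_eq)
  have "\<exists>act. right_action (Gam d k) {..<k} act \<and> (\<forall>i<d. \<forall>x\<in>{..<k}. act x (gen d k i) = f x)"
    using assms f by (intro right_action_Gam_exists) (auto simp: f_def)
  then obtain act where act: "right_action (Gam d k) {..<k} act"
    "\<And>i x. i < d \<Longrightarrow> x \<in> {..<k} \<Longrightarrow> act x (gen d k i) = f x" by blast
  have "act 0 (gen d k i [^]\<^bsub>Gam d k\<^esub> j) = j mod k"
    using right_action_gen_pow[OF act(1) _ assms(1), of 0 f j] act(2)[OF assms(1)] f[of 0 j] assms by auto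
  moreover have "act 0 \<one>\<^bsub>Gam d k\<^esub> = 0" using right_actionD(1)[OF act(1)] assms by auto
  ultimately show False using eq assms by simp
qed

section \<open>Neighbourhoods along cosets of the cyclic factors, and finite sets into which balls
  embed\<close>

definition gam_nbhd :: "nat \<Rightarrow> nat \<Rightarrow> gword set set \<Rightarrow> gword set set" where
  "gam_nbhd d k F = (\<lambda>(g, i, j). g \<otimes>\<^bsub>Gam d k\<^esub> (gen d k i [^]\<^bsub>Gam d k\<^esub> j)) ` (F \<times> {..<d} \<times> {..<k}) \<union> F"

lemma gam_nbhd_mono: "F \<subseteq> gam_nbhd d k F"
  by (auto simp: gam_nbhd_def)

lemma finite_gam_nbhd: "finite F \<Longrightarrow> finite (gam_nbhd d k F)"
  by (auto simp: gam_nbhd_def)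

lemma gam_nbhd_closed: "F \<subseteq> carrier (Gam d k) \<Longrightarrow> gam_nbhd d k F \<subseteq> carrier (Gam d k)"
proof -
  interpret Gam: group "Gam d k" by (rule group_Gam)
  show "F \<subseteq> carrier (Gam d k) \<Longrightarrow> gam_nbhd d k F \<subseteq> carrier (Gam d k)"
    by (auto simp: gam_nbhd_def gen_pow_closed)
qed

lemma gam_nbhdI: "g \<in> F \<Longrightarrow> i < d \<Longrightarrow> j < k \<Longrightarrow> g \<otimes>\<^bsub>Gam d k\<^esub> (gen d k i [^]\<^bsub>Gam d k\<^esub> j) \<in> gam_nbhd d k F"
  unfolding gam_nbhd_def by (rule UnI1, rule image_eqI[of _ _ "(g, i, j)"]) auto

lemma gam_nbhdE:
  assumes "h \<in> gam_nbhd d k F" "h \<notin> F"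
  obtains g i j where "g \<in> F" "i < d" "j < k" "h = g \<otimes>\<^bsub>Gam d k\<^esub> (gen d k i [^]\<^bsub>Gam d k\<^esub> j)"
  using assms by (auto simp: gam_nbhd_def)

lemma gam_nbhd_iter:
  assumes "F \<subseteq> carrier (Gam d k)" "finite F"
  shows "(gam_nbhd d k ^^ r) F \<subseteq> carrier (Gam d k)" "finite ((gam_nbhd d k ^^ r) F)"
  by (induction r) (use assms gam_nbhd_closed finite_gam_nbhd in auto)

lemma gam_nbhd_iter_mono: "r \<le> r' \<Longrightarrow> (gam_nbhd d k ^^ r) F \<subseteq> (gam_nbhd d k ^^ r') F"
  by (rule lift_Suc_mono_le[of "\<lambda>r. (gam_nbhd d k ^^ r) F"]) (auto simp: gam_nbhd_mono)

text \<open>One application of \<open>gam_nbhd\<close> adds every coset of a cyclic factor through a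
  point already reached, that is, every check through it. Iterating it from the identity exhausts
  \<Gamma>.\<close>

lemma finite_subset_ball:
  assumes "k > 1" "finite F" "F \<subseteq> carrier (Gam d k)"
  shows "\<exists>L. F \<subseteq> (gam_nbhd d k ^^ L) {\<one>\<^bsub>Gam d k\<^esub>}"
proof -
  interpret Gam: group "Gam d k" by (rule group_Gam)
  have one: "\<exists>L. g \<in> (gam_nbhd d k ^^ L) {\<one>\<^bsub>Gam d k\<^esub>}" if "g \<in> carrier (Gam d k)" for g
  proof -
    have "k > 0" using assms(1) by simp
    then show ?thesis using that
    proof (induction rule: Gam_induct)
      case one
      show ?case by (intro exI[of _ 0]) simp
    next
      case (step g i)
      then obtain L where "g \<in> (gam_nbhd d k ^^ L) {\<one>\<^bsub>Gam d k\<^esub>}" by blast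
      then have "g \<otimes>\<^bsub>Gam d k\<^esub> (gen d k i [^]\<^bsub>Gam d k\<^esub> (1::nat)) \<in> (gam_nbhd d k ^^ Suc L) {\<one>\<^bsub>Gam d k\<^esub>}"
        unfolding funpow.simps o_def using step(2) assms(1) by (rule gam_nbhdI)
      then show ?case using gen_closed[OF step(2)] by (intro exI[of _ "Suc L"]) simp
    qed
  qed
  show ?thesis using assms(2,3)
  proof (induction rule: finite_induct)
    case (insert g F)
    obtain L where L: "F \<subseteq> (gam_nbhd d k ^^ L) {\<one>\<^bsub>Gam d k\<^esub>}" using insert by auto
    obtain L' where L': "g \<in> (gam_nbhd d k ^^ L') {\<one>\<^bsub>Gam d k\<^esub>}" using one insert by blast
    show ?case
      using L L' gam_nbhd_iter_mono[of L "max L L'"] gam_nbhd_iter_mono[of L' "max L L'"]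
      by (intro exI[of _ "max L L'"]) fastforce
  qed simp
qed

text \<open>Residual finiteness: let \<open>s\<^sub>i\<close> act on a large ball by right multiplication on the cosets
  of \<open>\<langle>s\<^sub>i\<rangle>\<close> contained in the ball, and trivially elsewhere.\<close>

lemma Gam_residually_finite:
  assumes k: "k > 1" and "finite F" "F \<subseteq> carrier (Gam d k)"
  shows "\<exists>(Q :: (gword set \<Rightarrow> gword set) set) qact. finite Q \<and> Q \<noteq> {} \<and>
    right_action (Gam d k) Q qact \<and> (\<forall>q\<in>Q. inj_on (qact q) F)"
proof -
  interpret Gam: group "Gam d k" by (rule group_Gam)
  let ?G = "Gam d k"
  let ?B = "\<lambda>r. (gam_nbhd d k ^^ r) {\<one>\<^bsub>?G\<^esub>}"
  obtain L where L: "F \<subseteq> ?B L" using finite_subset_ball assms by blast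
  define \<Omega> where "\<Omega> = ?B L"
  have \<Omega>: "finite \<Omega>" "\<Omega> \<subseteq> carrier ?G" unfolding \<Omega>_def by (intro gam_nbhd_iter; simp)+
  \<comment> \<open>Fullness is a property of the coset, not of the point, so \<open>f i\<close>
    preserves it and has order dividing k on a full coset.\<close>
  define full where "full i x \<longleftrightarrow> (\<forall>j. x \<otimes>\<^bsub>?G\<^esub> (gen d k i [^]\<^bsub>?G\<^esub> (j::nat)) \<in> \<Omega>)" for i x
  define f where "f i x = (if full i x then x \<otimes>\<^bsub>?G\<^esub> gen d k i else x)" for i x
  have full_pow: "(f i ^^ j) x = x \<otimes>\<^bsub>?G\<^esub> (gen d k i [^]\<^bsub>?G\<^esub> j) \<and> full i ((f i ^^ j) x)"
    if "full i x" "x \<in> \<Omega>" "i < d" for i x j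
  proof (induction j)
    case 0
    then show ?case using that \<Omega> by auto
  next
    case (Suc j)
    have x: "x \<in> carrier ?G" using that \<Omega> by auto
    have "(f i ^^ Suc j) x = x \<otimes>\<^bsub>?G\<^esub> (gen d k i [^]\<^bsub>?G\<^esub> Suc j)"
    proof -
      have "(f i ^^ Suc j) x = (f i ^^ j) x \<otimes>\<^bsub>?G\<^esub> gen d k i"
        using conjunct2[OF Suc] unfolding funpow.simps o_def by (subst f_def) (rule if_P)
      also have "\<dots> = x \<otimes>\<^bsub>?G\<^esub> (gen d k i [^]\<^bsub>?G\<^esub> j) \<otimes>\<^bsub>?G\<^esub> gen d k i"
        using Suc by simp
      finally show ?thesis
        using x that by (simp add: Gam.m_assoc gen_closed gen_pow_closed)
    qed
    moreover have "full i (x \<otimes>\<^bsub>?G\<^esub> (gen d k i [^]\<^bsub>?G\<^esub> Suc j))"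
      unfolding full_def
    proof
      fix l :: nat
      have "x \<otimes>\<^bsub>?G\<^esub> (gen d k i [^]\<^bsub>?G\<^esub> Suc j) \<otimes>\<^bsub>?G\<^esub> (gen d k i [^]\<^bsub>?G\<^esub> l)
        = x \<otimes>\<^bsub>?G\<^esub> (gen d k i [^]\<^bsub>?G\<^esub> (Suc j + l))"
        unfolding Gam.nat_pow_mult[OF gen_closed[OF that(3)], of "Suc j" l, symmetric]
        by (intro Gam.m_assoc x gen_pow_closed that)
      then show "x \<otimes>\<^bsub>?G\<^esub> (gen d k i [^]\<^bsub>?G\<^esub> Suc j) \<otimes>\<^bsub>?G\<^esub> (gen d k i [^]\<^bsub>?G\<^esub> l) \<in> \<Omega>"
        using that(1) unfolding full_def by (simp only:)
    qed
    ultimately show ?case by (simp only: simp_thms)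
  qed
  have nfull: "(f i ^^ j) x = x" if "\<not> full i x" for i j x
  proof (induction j)
    case (Suc j)
    have "f i x = x" unfolding f_def using that by (rule if_not_P)
    then show ?case using Suc by simp
  qed simp
  have "\<exists>act. right_action ?G \<Omega> act \<and> (\<forall>i<d. \<forall>x\<in>\<Omega>. act x (gen d k i) = f i x)"
  proof (rule right_action_Gam_exists)
    show "f i x \<in> \<Omega>" if "i < d" "x \<in> \<Omega>" for i x
    proof (cases "full i x")
      case True
      then have "x \<otimes>\<^bsub>?G\<^esub> (gen d k i [^]\<^bsub>?G\<^esub> (1::nat)) \<in> \<Omega>" unfolding full_def by blast
      moreover have "f i x = x \<otimes>\<^bsub>?G\<^esub> gen d k i" unfolding f_def using True by (rule if_P)
      ultimately show ?thesis using that by (simp add: gen_closed)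
    next
      case False
      then show ?thesis unfolding f_def using that by (simp only: if_False)
    qed
    show "(f i ^^ k) x = x" if "i < d" "x \<in> \<Omega>" for i x
    proof (cases "full i x")
      case True
      have "x \<in> carrier ?G" using that \<Omega> by auto
      then show ?thesis using full_pow[OF True that(2,1), of k] gen_pow_k[OF that(1), of k] by simp
    qed (rule nfull)
    show "k > 0" using k by simp
  qed
  then obtain act where act: "right_action ?G \<Omega> act"
      "\<And>i x. i < d \<Longrightarrow> x \<in> \<Omega> \<Longrightarrow> act x (gen d k i) = f i x" by blast
  note A = right_actionD[OF act(1)]
  have one_\<Omega>: "\<one>\<^bsub>?G\<^esub> \<in> \<Omega>" using gam_nbhd_iter_mono[of 0 L d k] by (auto simp: \<Omega>_def)
  \<comment> \<open>Started at the identity, the action agrees with multiplication in \<Gamma> as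
    long as it stays in the ball: a coset through a point of an earlier ball is full.\<close>
  have orbit: "h \<in> ?B r \<Longrightarrow> act \<one>\<^bsub>?G\<^esub> h = h" if "r \<le> L" for r h
    using that
  proof (induction r arbitrary: h)
    case 0
    then show ?case using A(1)[OF one_\<Omega>] by simp
  next
    case (Suc r)
    show ?case
    proof (cases "h \<in> ?B r")
      case True
      then show ?thesis using Suc by auto
    next
      case False
      then obtain g i j where g: "g \<in> ?B r" "i < d" "j < k" "h = g \<otimes>\<^bsub>?G\<^esub> (gen d k i [^]\<^bsub>?G\<^esub> j)"
        using Suc.prems(1) gam_nbhdE[of h d k "?B r"] by auto
      have gO: "g \<in> \<Omega>" using g(1) gam_nbhd_iter_mono[of r L] Suc.prems by (auto simp: \<Omega>_def)
      have gc: "g \<in> carrier ?G" using gO \<Omega> by auto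
      have "g \<otimes>\<^bsub>?G\<^esub> (gen d k i [^]\<^bsub>?G\<^esub> l) \<in> \<Omega>" for l :: nat
      proof -
        have "gen d k i [^]\<^bsub>?G\<^esub> l = gen d k i [^]\<^bsub>?G\<^esub> (k * (l div k) + l mod k)" by simp
        also have "\<dots> = gen d k i [^]\<^bsub>?G\<^esub> (l mod k)"
        proof -
          have "gen d k i [^]\<^bsub>?G\<^esub> (k * (l div k)) = \<one>\<^bsub>?G\<^esub>"
            using Gam.nat_pow_pow[OF gen_closed[OF g(2)], of k "l div k"] gen_pow_k[OF g(2)] by simp
          then show ?thesis
              unfolding Gam.nat_pow_mult[OF gen_closed[OF g(2)], of "k * (l div k)" "l mod k", symmetric]
            by (simp only: Gam.l_one[OF gen_pow_closed[OF g(2)]])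
        qed
        finally have "g \<otimes>\<^bsub>?G\<^esub> (gen d k i [^]\<^bsub>?G\<^esub> l) \<in> ?B (Suc r)"
          unfolding funpow.simps o_def using g(1,2) k by (simp only:) (intro gam_nbhdI; simp)
        then show ?thesis using gam_nbhd_iter_mono[of "Suc r" L d k] Suc.prems(2) unfolding \<Omega>_def by blast
      qed
      then have full: "full i g" by (simp add: full_def)
      have "act \<one>\<^bsub>?G\<^esub> h = act (act \<one>\<^bsub>?G\<^esub> g) (gen d k i [^]\<^bsub>?G\<^esub> j)"
        unfolding g(4) using A(3)[OF one_\<Omega>] gc g gen_pow_closed by blast
      also have "act \<one>\<^bsub>?G\<^esub> g = g" using Suc g by auto
      also have "act g (gen d k i [^]\<^bsub>?G\<^esub> j) = (f i ^^ j) g"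
        using right_action_gen_pow[OF act(1) gO g(2)] act(2) g(2) by blast
      also have "\<dots> = h" using full_pow[OF full gO g(2)] g(4) by simp
      finally show ?thesis .
    qed
  qed
  \<comment> \<open>So far only the orbit map at the identity is known to be injective on
    \<open>F\<close>. Letting \<Gamma> act on the transformations that it induces on \<Omega> makes
    this true at every point.\<close>
  define Q where "Q = (\<lambda>g. \<lambda>x\<in>\<Omega>. act x g) ` carrier ?G"
  define qact where "qact q g = (\<lambda>x\<in>\<Omega>. act (q x) g)" for q g
  have Qin: "q x \<in> \<Omega>" if "q \<in> Q" "x \<in> \<Omega>" for q x
    using that A(2) by (auto simp: Q_def)
  have "Q \<subseteq> \<Omega> \<rightarrow>\<^sub>E \<Omega>" using A(2) by (auto simp: Q_def)
  then have "finite Q" using \<Omega>(1) finite_PiE finite_subset by meson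
  moreover have "Q \<noteq> {}" by (auto simp: Q_def)
  moreover have "right_action ?G Q qact"
    unfolding right_action_def
  proof (intro conjI ballI)
    fix q assume q: "q \<in> Q"
    then obtain g where g: "g \<in> carrier ?G" "q = (\<lambda>x\<in>\<Omega>. act x g)" by (auto simp: Q_def)
    show "qact q \<one>\<^bsub>?G\<^esub> = q"
      unfolding qact_def g(2) using A(1,2) g by (intro restrict_ext) auto
    fix h assume h: "h \<in> carrier ?G"
    have "qact q h = (\<lambda>x\<in>\<Omega>. act x (g \<otimes>\<^bsub>?G\<^esub> h))"
      unfolding qact_def g(2) using A(3) g h by (intro restrict_ext) auto
    then show "qact q h \<in> Q" using g h by (auto simp: Q_def)
    fix h' assume h': "h' \<in> carrier ?G"
    show "qact q (h \<otimes>\<^bsub>?G\<^esub> h') = qact (qact q h) h'"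
      unfolding qact_def using A(3) Qin[OF q] h h' by (intro restrict_ext) auto
  qed
  moreover have "inj_on (qact q) F" if q: "q \<in> Q" for q
  proof (rule inj_onI)
    fix h h' assume h: "h \<in> F" "h' \<in> F" "qact q h = qact q h'"
    obtain g where g: "g \<in> carrier ?G" "q = (\<lambda>x\<in>\<Omega>. act x g)" using q by (auto simp: Q_def)
    \<comment> \<open>The argument at which the transformation \<open>q\<close> takes the value 1,
      so that evaluation there reduces to the orbit map at the identity.\<close>
    define x where "x = act \<one>\<^bsub>?G\<^esub> (inv\<^bsub>?G\<^esub> g)"
    have x: "x \<in> \<Omega>" unfolding x_def using A(2)[OF one_\<Omega>] g by auto
    have "act x g = \<one>\<^bsub>?G\<^esub>"
      unfolding x_def using A(3)[OF one_\<Omega>, of "inv\<^bsub>?G\<^esub> g" g] A(1)[OF one_\<Omega>] g by simp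
    then have "q x = \<one>\<^bsub>?G\<^esub>" using g x by simp
    then have "act \<one>\<^bsub>?G\<^esub> h = act \<one>\<^bsub>?G\<^esub> h'"
      using fun_cong[OF h(3), of x] x by (simp add: qact_def)
    then show "h = h'" using orbit[of L h] orbit[of L h'] L h by auto
  qed
  ultimately show ?thesis by (intro exI[of _ Q] exI[of _ qact] conjI ballI)
qed

section \<open>Counting permutations and random lifts\<close>

lemma permutes_image_exists:
  assumes "finite I" "A \<subseteq> I" "B \<subseteq> I" "card A = card B"
  shows "\<exists>p. p permutes I \<and> p ` A = B"
proof -
  have fin: "finite A" "finite B" using assms finite_subset by auto
  obtain f where f: "bij_betw f A B" using finite_same_card_bij[OF fin assms(4)] by blast
  have "card (I - A) = card (I - B)" using assms fin by (simp add: card_Diff_subset)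
  then obtain g where g: "bij_betw g (I - A) (I - B)"
    using finite_same_card_bij[of "I - A" "I - B"] assms(1) by auto
  define p where "p x = (if x \<in> A then f x else if x \<in> I then g x else x)" for x
  have "bij_betw p A B" using f by (rule bij_betw_cong[THEN iffD1, rotated]) (simp add: p_def)
  moreover have "bij_betw p (I - A) (I - B)"
    using g by (rule bij_betw_cong[THEN iffD1, rotated]) (auto simp: p_def)
  ultimately have "bij_betw p (A \<union> (I - A)) (B \<union> (I - B))" by (rule bij_betw_combine) auto
  then have "bij_betw p I I" using assms by (simp add: Un_absorb1)
  moreover have "p x = x" if "x \<notin> I" for x using that assms by (auto simp: p_def)
  ultimately have "p permutes I" by (intro bij_imp_permutes) auto
  moreover have "p ` A = B" using \<open>bij_betw p A B\<close> by (simp add: bij_betw_def)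
  ultimately show ?thesis by blast
qed

text \<open>Composing with a permutation that carries \<open>T\<close> to another set of the same
  size embeds the solutions for \<open>T\<close> into those for the other set. All targets of one
  size are therefore equally frequent, and their solution sets are disjoint.\<close>

lemma card_permutes_image_le:
  assumes "finite I" "T \<subseteq> I"
  shows "card {p. p permutes I \<and> p ` B = T} * (card I choose card T) \<le> fact (card I)"
proof -
  let ?N = "\<lambda>T. {p. p permutes I \<and> p ` B = T}"
  let ?\<T> = "{T'. T' \<subseteq> I \<and> card T' = card T}"
  have fin: "finite (?N T')" for T' by (rule finite_subset[OF _ finite_permutations[OF assms(1)]]) auto
  have fT: "finite ?\<T>" using assms(1) by auto
  have le: "card (?N T) \<le> card (?N T')" if "T' \<in> ?\<T>" for T'
  proof -
    have "T' \<subseteq> I" "card T = card T'" using that by auto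
    then obtain s where s: "s permutes I" "s ` T = T'"
      using permutes_image_exists[OF assms] by blast
    have "(\<lambda>p. s \<circ> p) ` ?N T \<subseteq> ?N T'" using s by (auto simp: image_comp[symmetric] intro: permutes_compose)
    moreover have "inj_on (\<lambda>p. s \<circ> p) (?N T)"
    proof (intro inj_onI ext)
      fix p q x assume "s \<circ> p = s \<circ> q"
      then have "s (p x) = s (q x)" by (metis comp_apply)
      then show "p x = q x" using permutes_inj[OF s(1)] by (rule injD[rotated])
    qed
    ultimately show ?thesis using fin by (intro card_inj_on_le)
  qed
  have "card (?N T) * card ?\<T> = (\<Sum>T'\<in>?\<T>. card (?N T))" by simp
  also have "\<dots> \<le> (\<Sum>T'\<in>?\<T>. card (?N T'))" by (rule sum_mono) (rule le)
  also have "\<dots> = card (\<Union>T'\<in>?\<T>. ?N T')"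
    using fT fin by (subst card_UN_disjoint) auto
  also have "\<dots> \<le> card {p. p permutes I}"
    by (intro card_mono finite_permutations assms) auto
  also have "\<dots> = fact (card I)" by (rule card_permutations) (use assms in auto)
  finally show ?thesis using n_subsets[OF assms(1)] by simp
qed

text \<open>The quotient of the two binomials is at most (u/n)^s, with denominators cleared: each
  induction step contributes a factor (u-s)/(n-s), which is at most u/n.\<close>

lemma binomial_mult_power_le:
  assumes "u \<le> n"
  shows "(u choose s) * n ^ s \<le> (n choose s) * u ^ s"
proof (induction s)
  case (Suc s)
  have *: "Suc s * (m choose Suc s) = (m - s) * (m choose s)" for m
    by (metis Suc_times_binomial_eq binomial_absorb_comp mult.commute binomial_absorption)
  have "(u - s) * n \<le> (n - s) * u"
    unfolding diff_mult_distrib mult.commute[of n u] using mult_le_mono2[OF assms] by (rule diff_le_mono2)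
  then have "((u choose s) * n ^ s) * ((u - s) * n) \<le> ((n choose s) * u ^ s) * ((n - s) * u)"
    by (rule mult_mono[OF Suc]) auto
  then have "Suc s * ((u choose Suc s) * n ^ Suc s) \<le> Suc s * ((n choose Suc s) * u ^ Suc s)"
  proof -
    have "((m choose s) * x ^ s) * ((m - s) * y) = Suc s * (m choose Suc s) * (x ^ s * y)" for m x y :: nat
      unfolding * by (simp only: mult_ac)
    from this[of u n n] this[of n u u] show ?thesis
      using \<open>_ \<le> _ * ((n - s) * u)\<close> by (simp only: power_Suc mult_ac)
  qed
  then show ?case by (simp only: mult_le_cancel1)
qed simp

text \<open>Sampling without replacement hits \<open>U\<close> throughout no more often than
  sampling with replacement does.\<close>

lemma card_permutes_subset_le:
  assumes "U \<subseteq> {..<n}" "S \<subseteq> {..<n}" "n > 0"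
  shows "real (card {p. p permutes {..<n} \<and> p ` S \<subseteq> U}) \<le> fact n * (real (card U) / real n) ^ card S"
proof -
  let ?I = "{..<n}" and ?s = "card S" and ?u = "card U"
  let ?\<T> = "{T. T \<subseteq> U \<and> card T = ?s}"
  have fU: "finite U" using assms finite_subset by blast
  have un: "?u \<le> n" using card_mono[OF _ assms(1)] by simp
  have sn: "?s \<le> n" using card_mono[OF _ assms(2)] by simp
  have "{p. p permutes ?I \<and> p ` S \<subseteq> U} \<subseteq> (\<Union>T\<in>?\<T>. {p. p permutes ?I \<and> p ` S = T})"
    by (auto simp: card_image[OF permutes_inj_on])
  then have "card {p. p permutes ?I \<and> p ` S \<subseteq> U} \<le> card (\<Union>T\<in>?\<T>. {p. p permutes ?I \<and> p ` S = T})"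
    by (intro card_mono finite_UN_I) (use fU in \<open>auto intro: finite_subset[OF _ finite_permutations[of ?I]]\<close>)
  also have "\<dots> \<le> (\<Sum>T\<in>?\<T>. card {p. p permutes ?I \<and> p ` S = T})"
    by (rule card_UN_le) (use fU in auto)
  finally have "card {p. p permutes ?I \<and> p ` S \<subseteq> U} * (n choose ?s)
    \<le> (\<Sum>T\<in>?\<T>. card {p. p permutes ?I \<and> p ` S = T} * (n choose ?s))"
    by (simp add: sum_distrib_right[symmetric])
  also have "\<dots> \<le> (\<Sum>T\<in>?\<T>. fact n)"
  proof (rule sum_mono)
    fix T assume T: "T \<in> ?\<T>"
    then show "card {p. p permutes ?I \<and> p ` S = T} * (n choose ?s) \<le> fact n"
      using card_permutes_image_le[of ?I T S] assms(1) by auto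
  qed
  also have "\<dots> = (?u choose ?s) * fact n" using n_subsets[OF fU] by simp
  finally have "real (card {p. p permutes ?I \<and> p ` S \<subseteq> U}) * real (n choose ?s) \<le> real (?u choose ?s) * fact n"
    by (drule_tac of_nat_mono[where 'a = real]) simp
  also have "real (?u choose ?s) \<le> real (n choose ?s) * (real ?u / real n) ^ ?s"
  proof -
    have "real (?u choose ?s) * real n ^ ?s \<le> real (n choose ?s) * real ?u ^ ?s"
      using of_nat_mono[OF binomial_mult_power_le[OF un, of ?s], where 'a = real] by simp
    then show ?thesis using assms(3) by (simp add: power_divide field_simps)
  qed
  finally have "real (n choose ?s) * real (card {p. p permutes ?I \<and> p ` S \<subseteq> U})
     \<le> real (n choose ?s) * (fact n * (real ?u / real n) ^ ?s)"
    by (simp add: mult_ac mult_right_mono)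
  moreover have "real (n choose ?s) > 0" using sn by simp
  ultimately show ?thesis by (simp only: mult_le_cancel_left_pos)
qed

section \<open>Sums over subsets and estimates for binomial coefficients\<close>

lemma sum_Pow_power:
  fixes x :: "'a :: comm_semiring_1"
  assumes "finite A"
  shows "(\<Sum>B\<in>Pow A. x ^ card B) = (1 + x) ^ card A"
  using prod_add[OF assms, of "\<lambda>_. x" "\<lambda>_. 1"] by (simp add: add.commute)

lemma sum_Pow_card:
  fixes f :: "nat \<Rightarrow> 'a :: comm_semiring_1"
  shows "(\<Sum>B\<in>Pow {..<n}. f (card B)) = (\<Sum>t\<le>n. of_nat (n choose t) * f t)"
proof -
  have "(\<Sum>B\<in>Pow {..<n}. f (card B)) = (\<Sum>t\<le>n. \<Sum>B\<in>{B\<in>Pow {..<n}. card B = t}. f (card B))"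
  proof (rule sum.group[symmetric])
    show "card ` Pow {..<n} \<subseteq> {..n}" using card_mono[of "{..<n}"] by auto
  qed auto
  also have "\<dots> = (\<Sum>t\<le>n. of_nat (n choose t) * f t)"
  proof (rule sum.cong)
    fix t
    have "(\<Sum>B\<in>{B\<in>Pow {..<n}. card B = t}. f (card B)) = (\<Sum>B\<in>{B\<in>Pow {..<n}. card B = t}. f t)"
      by (rule sum.cong) auto
    also have "\<dots> = of_nat (n choose t) * f t"
      using n_subsets[of "{..<n}" t] by (simp add: Pow_def)
    finally show "(\<Sum>B\<in>{B\<in>Pow {..<n}. card B = t}. f (card B)) = of_nat (n choose t) * f t" .
  qed simp
  finally show ?thesis .
qed

lemma binomial_ge_pow2:
  assumes "t \<le> n"
  shows "2 ^ min t (n - t) \<le> (n choose t)"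
proof -
  have *: "2 ^ t \<le> (n choose t)" if "2 * t \<le> n" for t n :: nat
  proof (cases "t = 0")
    case False
    have "(2::real) ^ t \<le> (real n / real t) ^ t"
      using that False by (intro power_mono) (simp_all add: field_simps)
    also have "\<dots> \<le> real (n choose t)"
      using that by (intro binomial_ge_n_over_k_pow_k) auto
    finally have "real (2 ^ t) \<le> real (n choose t)" by simp
    then show ?thesis by (simp only: of_nat_le_iff)
  qed simp
  show ?thesis
  proof (cases "2 * t \<le> n")
    case True
    then have "min t (n - t) = t" by simp
    then show ?thesis using *[OF True] by simp
  next
    case False
    then have "min t (n - t) = n - t" by simp
    then show ?thesis using False *[of "n - t" n] binomial_symmetric[OF assms] by simp
  qed
qed

text \<open>By \<open>binomial_ge_pow2\<close> the terms decay geometrically from both ends. The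
  bound is uniform in n, so that in the union bound each class of checks costs only a
  constant.\<close>

lemma sum_binomial_powr_le:
  assumes "g > 0"
  shows "(\<Sum>t\<le>n. real (n choose t) powr (- g)) \<le> 2 / (1 - 2 powr (- g))"
proof -
  define x :: real where "x = 2 powr (- g)"
  have x: "0 < x" "x < 1" using assms powr_less_cancel_iff[of 2 "-g" 0] by (auto simp: x_def)
  have "(\<Sum>t\<le>n. real (n choose t) powr (- g)) \<le> (\<Sum>t\<le>n. x ^ t + x ^ (n - t))"
  proof (rule sum_mono)
    fix t assume "t \<in> {..n}"
    then have t: "t \<le> n" by simp
    have "real (2 ^ min t (n - t)) \<le> real (n choose t)"
      using binomial_ge_pow2[OF t] of_nat_le_iff by blast
    then have "real (n choose t) powr (- g) \<le> real (2 ^ min t (n - t)) powr (- g)"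
      using assms by (intro powr_mono2') auto
    also have "\<dots> = x ^ min t (n - t)"
      by (simp add: x_def powr_power[symmetric] powr_powr powr_realpow[symmetric] mult.commute)
    also have "\<dots> \<le> x ^ t + x ^ (n - t)" using x by (simp add: min_def)
    finally show "real (n choose t) powr (- g) \<le> x ^ t + x ^ (n - t)" .
  qed
  also have "\<dots> = (\<Sum>t\<le>n. x ^ t) + (\<Sum>t\<le>n. x ^ (n - t))" by (rule sum.distrib)
  also have "(\<Sum>t\<le>n. x ^ (n - t)) = (\<Sum>t\<le>n. x ^ t)"
    by (rule sum.reindex_bij_witness[of _ "\<lambda>t. n - t" "\<lambda>t. n - t"]) auto
  also have "(\<Sum>t\<le>n. x ^ t) \<le> 1 / (1 - x)"
    using x by (simp add: sum_gp0 divide_right_mono)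
  finally show ?thesis by (simp add: x_def)
qed

lemma card_small_subsets_le:
  assumes "finite A"
  shows "card {s. s \<subseteq> A \<and> card s \<le> N} \<le> (card A + 1) ^ N"
proof -
  have "{s. s \<subseteq> A \<and> card s \<le> N} = (\<Union>j\<le>N. {s. s \<subseteq> A \<and> card s = j})" by auto
  then have "card {s. s \<subseteq> A \<and> card s \<le> N} \<le> (\<Sum>j\<le>N. card {s. s \<subseteq> A \<and> card s = j})"
    using card_UN_le[of "{..N}" "\<lambda>j. {s. s \<subseteq> A \<and> card s = j}"] by simp
  also have "\<dots> \<le> (\<Sum>j\<le>N. (N choose j) * card A ^ j)"
  proof (rule sum_mono)
    fix j assume j: "j \<in> {..N}"
    have "card {s. s \<subseteq> A \<and> card s = j} = card A choose j" using n_subsets[OF assms] .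
    also have "\<dots> \<le> card A ^ j"
      by (cases "j \<le> card A") (auto simp: binomial_le_pow binomial_eq_0)
    also have "\<dots> \<le> (N choose j) * card A ^ j" using j by (simp add: Suc_le_eq)
    finally show "card {s. s \<subseteq> A \<and> card s = j} \<le> (N choose j) * card A ^ j" .
  qed
  also have "\<dots> = (card A + 1) ^ N"
    using binomial_ring[of "card A" 1 N] by simp
  finally show ?thesis .
qed

text \<open>A bootstrap. The crude bound 2^m on binomials shows that the sum of the minima is at
  most K log n, hence at most sqrt n. Then (n/m)^m is at least (sqrt n)^m for each class, and
  comparing powers of sqrt n gives 2 K, a bound free of n.\<close>

lemma sum_min_card_le:
  assumes "finite C" "\<And>c. c \<in> C \<Longrightarrow> t c \<le> n" "(\<Prod>c\<in>C. n choose t c) \<le> n ^ K"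
    and n: "real K * log 2 n \<le> sqrt n" "n > 1"
  shows "(\<Sum>c\<in>C. min (t c) (n - t c)) \<le> 2 * K"
proof -
  define m where "m c = min (t c) (n - t c)" for c
  have mt: "n choose t c = n choose m c" "m c \<le> n" if "c \<in> C" for c
    using assms(2)[OF that] binomial_symmetric[of "t c" n] by (auto simp: m_def min_def)
  have "(\<Prod>c\<in>C. 2 ^ m c) \<le> (\<Prod>c\<in>C. n choose t c)"
    using binomial_ge_pow2 assms(2) by (intro prod_mono) (auto simp: m_def)
  then have "2 ^ sum m C \<le> n ^ K" using assms(3) by (simp add: power_sum)
  then have "(2::real) powr real (sum m C) \<le> real n powr real K"
    using n(2) of_nat_mono[where 'a = real, of "2 ^ sum m C" "n ^ K"]
    by (simp add: powr_realpow del: of_nat_sum)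
  then have "real (sum m C) \<le> real K * log 2 n"
    using n(2) by (subst (asm) le_log_iff[symmetric]) (simp_all add: log_powr)
  then have msq: "real (sum m C) \<le> sqrt n" using n(1) by simp
  have each: "sqrt n ^ m c \<le> real (n choose t c)" if c: "c \<in> C" for c
  proof (cases "m c = 0")
    case False
    have "real (m c) \<le> real (sum m C)"
      using member_le_sum[OF c, of m] assms(1) by (simp del: of_nat_sum)
    then have "real (m c) \<le> sqrt n" using msq by simp
    then have "sqrt n * real (m c) \<le> sqrt n * sqrt n" by (intro mult_left_mono) auto
    then have "sqrt n \<le> real n / real (m c)" using False by (simp add: field_simps)
    then have "sqrt n ^ m c \<le> (real n / real (m c)) ^ m c" by (intro power_mono) auto
    also have "\<dots> \<le> real (n choose m c)" using mt[OF c] by (intro binomial_ge_n_over_k_pow_k)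
    finally show ?thesis using mt[OF c] by simp
  qed (use mt[OF c] in simp)
  have "sqrt n ^ sum m C = (\<Prod>c\<in>C. sqrt n ^ m c)" by (simp add: power_sum)
  also have "\<dots> \<le> (\<Prod>c\<in>C. real (n choose t c))" using each by (intro prod_mono) auto
  also have "\<dots> \<le> real n ^ K"
    using of_nat_mono[OF assms(3), where 'a = real] by simp
  also have "\<dots> = sqrt n ^ (2 * K)" by (simp add: power_mult)
  finally have "sum m C \<le> 2 * K"
    using n(2) by (subst (asm) power_increasing_iff) auto
  then show ?thesis by (simp add: m_def)
qed

section \<open>Random lifts of a finite system of orbits\<close>

locale orbit_system =
  fixes d k :: nat and Q :: "'q set" and orb :: "nat \<Rightarrow> 'q \<Rightarrow> 'q set"
  assumes finQ: "finite Q" and Qne: "Q \<noteq> {}" and kpos: "k > 0" and dpos: "d > 0"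
    and orb_self: "\<And>i q. i < d \<Longrightarrow> q \<in> Q \<Longrightarrow> q \<in> orb i q"
    and orb_sub: "\<And>i q. i < d \<Longrightarrow> q \<in> Q \<Longrightarrow> orb i q \<subseteq> Q"
    and orb_eq: "\<And>i q q'. i < d \<Longrightarrow> q \<in> Q \<Longrightarrow> q' \<in> orb i q \<Longrightarrow> orb i q' = orb i q"
    and orb_card: "\<And>i q. i < d \<Longrightarrow> q \<in> Q \<Longrightarrow> card (orb i q) = k"
begin

text \<open>The classes of checks of the base. The index of the generator is kept because two
  generators may share an orbit as a set.\<close>

definition orbits :: "(nat \<times> 'q set) set" where
  "orbits = (SIGMA i:{..<d}. orb i ` Q)"

text \<open>The number \<open>\<rho> q i v\<close> labels the check of class
  \<open>(i, orb i q)\<close> through the vertex \<open>(q, v)\<close>. Naming the checks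
  parametrizes a lift redundantly, but it makes all these permutations independent and
  uniform.\<close>

definition lifts :: "nat \<Rightarrow> ('q \<Rightarrow> nat \<Rightarrow> nat \<Rightarrow> nat) set" where
  "lifts n = PiE Q (\<lambda>_. PiE {..<d} (\<lambda>_. {p. p permutes {..<n}}))"

lemma finite_orbits: "finite orbits"
  unfolding orbits_def using finQ by auto

lemma orbits_I: "i < d \<Longrightarrow> q \<in> Q \<Longrightarrow> (i, orb i q) \<in> orbits"
  by (auto simp: orbits_def)

lemma orbit_fibre: "i < d \<Longrightarrow> c \<in> orb i ` Q \<Longrightarrow> {q \<in> Q. orb i q = c} = c"
  using orb_self orb_sub orb_eq by blast

lemma prod_orbits:
  fixes g :: "nat \<times> 'q set \<Rightarrow> 'c :: comm_monoid_mult"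
  shows "(\<Prod>q\<in>Q. \<Prod>i<d. g (i, orb i q)) = (\<Prod>c\<in>orbits. g c ^ k)"
proof -
  have "(\<Prod>q\<in>Q. g (i, orb i q)) = (\<Prod>c\<in>orb i ` Q. g (i, c) ^ k)" if i: "i < d" for i
  proof -
    have "(\<Prod>q\<in>Q. g (i, orb i q)) = (\<Prod>c\<in>orb i ` Q. \<Prod>q\<in>{q \<in> Q. orb i q = c}. g (i, orb i q))"
      by (rule prod.group[symmetric]) (use finQ in auto)
    also have "\<dots> = (\<Prod>c\<in>orb i ` Q. \<Prod>q\<in>{q \<in> Q. orb i q = c}. g (i, c))"
      by (intro prod.cong) auto
    also have "\<dots> = (\<Prod>c\<in>orb i ` Q. g (i, c) ^ k)"
      by (intro prod.cong refl) (use orbit_fibre[OF i] orb_card[OF i] in auto)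
    finally show ?thesis .
  qed
  then have "(\<Prod>i<d. \<Prod>q\<in>Q. g (i, orb i q)) = (\<Prod>i<d. \<Prod>c\<in>orb i ` Q. g (i, c) ^ k)"
    by (intro prod.cong) auto
  also have "\<dots> = (\<Prod>c\<in>orbits. g c ^ k)"
    unfolding orbits_def by (subst prod.Sigma) (use finQ in auto)
  finally show ?thesis by (subst prod.swap)
qed

text \<open>Incidences counted in two ways, read off from the exponents in
  \<open>prod_orbits\<close> for the constant 2.\<close>

lemma card_orbits: "card orbits * k = card Q * d"
proof -
  have "(2::nat) ^ (card Q * d) = (\<Prod>q\<in>Q. \<Prod>i<d. 2)" by (simp add: power_mult[symmetric] mult.commute)
  also have "\<dots> = (\<Prod>c\<in>orbits. 2 ^ k)" by (rule prod_orbits)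
  also have "\<dots> = 2 ^ (card orbits * k)" by (simp add: power_mult[symmetric] mult.commute)
  finally show ?thesis by simp
qed

lemma finite_lifts: "finite (lifts n)"
  unfolding lifts_def by (intro finite_PiE finQ finite_permutations) auto

lemma card_lifts: "card (lifts n) = (fact n ^ d) ^ card Q"
proof -
  have "card {p. p permutes {..<n}} = fact n" by (rule card_permutations) auto
  then show ?thesis unfolding lifts_def using finQ by (simp add: card_PiE)
qed

lemma card_lifts_pos: "card (lifts n) > 0"
  by (simp add: card_lifts)

lemma card_lifts_PiE:
  "card {\<rho>\<in>lifts n. \<forall>q\<in>Q. P q (\<rho> q)}
    = (\<Prod>q\<in>Q. card {r\<in>PiE {..<d} (\<lambda>_. {p. p permutes {..<n}}). P q r})"
proof -
  have "{\<rho>\<in>lifts n. \<forall>q\<in>Q. P q (\<rho> q)} = PiE Q (\<lambda>q. {r\<in>PiE {..<d} (\<lambda>_. {p. p permutes {..<n}}). P q r})"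
    unfolding lifts_def by (auto simp: PiE_iff extensional_def)
  then show ?thesis by (simp add: card_PiE[OF finQ])
qed

text \<open>The permutations are independent, so the bounds of
  \<open>card_permutes_subset_le\<close> multiply; at \<open>q\<close> the same set
  \<open>S q\<close> is constrained once for each of the d generators.\<close>

lemma card_lifts_subset_le:
  assumes S: "\<And>q. q \<in> Q \<Longrightarrow> S q \<subseteq> {..<n}" and U: "\<And>c. c \<in> orbits \<Longrightarrow> U c \<subseteq> {..<n} \<and> card (U c) = u"
    and n: "n > 0"
  shows "real (card {\<rho>\<in>lifts n. \<forall>q\<in>Q. \<forall>i<d. \<rho> q i ` S q \<subseteq> U (i, orb i q)})
     \<le> card (lifts n) * (\<Prod>q\<in>Q. (real u / n) ^ (d * card (S q)))"
proof -
  have "real (card {r\<in>PiE {..<d} (\<lambda>_. {p. p permutes {..<n}}). \<forall>i<d. r i ` S q \<subseteq> U (i, orb i q)})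
    \<le> fact n ^ d * (real u / n) ^ (d * card (S q))" if q: "q \<in> Q" for q
  proof -
    have "{r\<in>PiE {..<d} (\<lambda>_. {p. p permutes {..<n}}). \<forall>i<d. r i ` S q \<subseteq> U (i, orb i q)}
      = PiE {..<d} (\<lambda>i. {p. p permutes {..<n} \<and> p ` S q \<subseteq> U (i, orb i q)})"
      by (auto simp: PiE_iff extensional_def image_subset_iff)
    then have "real (card {r\<in>PiE {..<d} (\<lambda>_. {p. p permutes {..<n}}). \<forall>i<d. r i ` S q \<subseteq> U (i, orb i q)})
      = (\<Prod>i<d. real (card {p. p permutes {..<n} \<and> p ` S q \<subseteq> U (i, orb i q)}))"
      by (simp add: card_PiE)
    also have "\<dots> \<le> (\<Prod>i<d. fact n * (real u / n) ^ card (S q))"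
    proof (intro prod_mono conjI)
      fix i assume "i \<in> {..<d}"
      then have "U (i, orb i q) \<subseteq> {..<n}" "card (U (i, orb i q)) = u"
        using U[OF orbits_I[OF _ q]] by auto
      then show "real (card {p. p permutes {..<n} \<and> p ` S q \<subseteq> U (i, orb i q)}) \<le> fact n * (real u / n) ^ card (S q)"
        using card_permutes_subset_le[OF _ S[OF q] n, of "U (i, orb i q)"] by simp
    qed simp
    also have "\<dots> = fact n ^ d * (real u / n) ^ (d * card (S q))"
      by (simp add: power_mult_distrib power_mult[symmetric] mult.commute)
    finally show ?thesis .
  qed
  then have "(\<Prod>q\<in>Q. real (card {r\<in>PiE {..<d} (\<lambda>_. {p. p permutes {..<n}}). \<forall>i<d. r i ` S q \<subseteq> U (i, orb i q)}))
     \<le> (\<Prod>q\<in>Q. fact n ^ d * (real u / n) ^ (d * card (S q)))"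
    by (intro prod_mono) auto
  also have "\<dots> = card (lifts n) * (\<Prod>q\<in>Q. (real u / n) ^ (d * card (S q)))"
    by (simp add: prod.distrib card_lifts)
  finally show ?thesis using card_lifts_PiE[of n "\<lambda>q r. \<forall>i<d. r i ` S q \<subseteq> U (i, orb i q)"] by simp
qed

end

section \<open>First moment for sparse near-codewords\<close>

lemma binomial_exp_bound:
  fixes y :: real and n :: nat
  assumes "0 < y" "y \<le> 1" "u = nat \<lfloor>y * n\<rfloor>"
  shows "real (n choose u) \<le> exp (y * n - y * n * ln y)"
proof -
  have un: "real u \<le> y * n" using assms by (simp add: of_nat_floor)
  also have "\<dots> \<le> n" using assms by (simp add: mult_left_le_one_le)
  finally have "u \<le> n" by simp
  \<comment> \<open>One term of the binomial expansion of (1 + y)^n, which is at most exp (y n).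
    Afterwards \<open>y ^ u\<close> is replaced by the smaller y^(y n).\<close>
  have "real (n choose u) * y ^ u = real (n choose u) * y ^ u * 1 ^ (n - u)" by simp
  also have "\<dots> \<le> (\<Sum>j\<le>n. real (n choose j) * y ^ j * 1 ^ (n - j))"
    using \<open>u \<le> n\<close> assms by (intro member_le_sum[of u "{..n}" "\<lambda>j. real (n choose j) * y ^ j * 1 ^ (n - j)"]) auto
  also have "\<dots> = (y + 1) ^ n" by (rule binomial_ring[symmetric])
  also have "\<dots> \<le> exp y ^ n"
    using assms exp_ge_add_one_self[of y] by (intro power_mono) (auto simp: add.commute)
  also have "\<dots> = exp (y * n)" by (simp add: exp_of_nat_mult[symmetric] mult.commute)
  finally have *: "real (n choose u) * y ^ u \<le> exp (y * n)" .
  have "exp (y * n * ln y) \<le> exp (u * ln y)"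
    using un assms by (simp add: mult_right_mono_neg)
  also have "\<dots> = y ^ u" using assms(1) by (simp add: exp_of_nat_mult)
  finally have "real (n choose u) * exp (y * n * ln y) \<le> exp (y * n)"
    using * by (meson mult_left_mono of_nat_0_le_iff order_trans)
  then show ?thesis by (simp add: exp_diff field_simps)
qed

text \<open>The weights \<open>p ^ |A|\<close> and \<open>1\<close> split the sum: the former sums to \<open>(1 + p) ^ n\<close>, the
  remaining factor is bounded by its value at the smallest admissible size.\<close>

lemma sum_large_subsets_bound:
  fixes p y a :: real and n d :: nat
  assumes "0 < p" "0 < y" "y ^ d \<le> p"
  shows "(\<Sum>A\<in>{A\<in>Pow {..<n}. a \<le> card A}. y ^ (d * card A)) \<le> exp (p * n + a * (d * ln y - ln p))"
proof -
  define x where "x = y ^ d / p"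
  have x: "0 < x" "x \<le> 1" using assms by (auto simp: x_def)
  have lnx: "ln x = d * ln y - ln p" using assms by (simp add: x_def ln_div ln_realpow)
  have "(\<Sum>A\<in>{A\<in>Pow {..<n}. a \<le> card A}. y ^ (d * card A))
      \<le> (\<Sum>A\<in>{A\<in>Pow {..<n}. a \<le> card A}. p ^ card A * exp (a * ln x))"
  proof (rule sum_mono)
    fix A assume "A \<in> {A \<in> Pow {..<n}. a \<le> real (card A)}"
    then have A: "a \<le> card A" by simp
    have "x ^ card A = exp (card A * ln x)" using x by (simp add: exp_of_nat_mult)
    also have "\<dots> \<le> exp (a * ln x)" using A x by (simp add: mult_right_mono_neg)
    finally have "p ^ card A * x ^ card A \<le> p ^ card A * exp (a * ln x)"
      using assms by (intro mult_left_mono) auto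
    moreover have "p ^ card A * x ^ card A = y ^ (d * card A)"
      using assms by (simp add: x_def power_divide power_mult)
    ultimately show "y ^ (d * card A) \<le> p ^ card A * exp (a * ln x)" by simp
  qed
  also have "\<dots> \<le> (\<Sum>A\<in>Pow {..<n}. p ^ card A * exp (a * ln x))"
    using assms by (intro sum_mono2) auto
  also have "\<dots> = (1 + p) ^ n * exp (a * ln x)"
    using sum_Pow_power[of "{..<n}" p] by (simp add: sum_distrib_right[symmetric] del: Pow_iff)
  also have "\<dots> \<le> exp p ^ n * exp (a * ln x)"
    using assms exp_ge_add_one_self[of p] by (intro mult_right_mono power_mono) auto
  also have "\<dots> = exp (p * n + a * ln x)" by (simp add: exp_add exp_of_nat_mult[symmetric] mult.commute)
  finally show ?thesis by (simp add: lnx)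
qed

context orbit_system
begin

text \<open>The tolerance is relative to the density p. Defects are compared with k p n, roughly the
  number of incidences between the set and one class of checks.\<close>

definition sparse_near_codeword :: "real \<Rightarrow> real \<Rightarrow> nat \<Rightarrow> ('q \<Rightarrow> nat \<Rightarrow> nat \<Rightarrow> nat) \<Rightarrow> ('q \<Rightarrow> nat set) \<Rightarrow> bool" where
  "sparse_near_codeword \<tau> p n \<rho> S \<longleftrightarrow>
     (\<forall>q\<in>Q. S q \<subseteq> {..<n} \<and> (1 - \<tau>) * p * real n \<le> real (card (S q)) \<and>
        real (card (S q)) \<le> (1 + \<tau>) * p * real n) \<and>
     (\<forall>i<d. \<forall>c\<in>orb i ` Q. real (card {m\<in>{..<n}. odd (card {q\<in>c. m \<in> \<rho> q i ` S q})}) \<le> \<tau> * real k * p * real n)"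

text \<open>A touched check that is even contains at least two points of the set, and odd ones are
  few. Hence twice the number of touched checks is at most the number of incidences plus the number
  of odd checks.\<close>

lemma touched_checks_le:
  fixes \<tau> p :: real
  assumes \<rho>: "\<rho> \<in> lifts n" and S: "sparse_near_codeword \<tau> p n \<rho> S" and c: "i < d" "c \<in> orb i ` Q"
  shows "real (card (\<Union>q\<in>c. \<rho> q i ` S q)) \<le> real k * p * (1 + 2 * \<tau>) / 2 * real n"
proof -
  let ?cnt = "\<lambda>m. card {q\<in>c. m \<in> \<rho> q i ` S q}"
  let ?U = "\<Union>q\<in>c. \<rho> q i ` S q"
  obtain q0 where q0: "q0 \<in> Q" "c = orb i q0" using c by blast
  have cQ: "c \<subseteq> Q" "card c = k" "finite c"
    using orb_sub[OF c(1) q0(1)] orb_card[OF c(1) q0(1)] finite_subset[OF _ finQ] q0(2) by auto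
  have perm: "\<rho> q i permutes {..<n}" if "q \<in> c" for q
    using \<rho> that cQ c by (auto simp: lifts_def PiE_iff)
  have sub: "\<rho> q i ` S q \<subseteq> {..<n}" if "q \<in> c" for q
    using permutes_image[OF perm[OF that]] S that cQ unfolding sparse_near_codeword_def by blast
  then have U: "?U \<subseteq> {..<n}" by blast
  have finU: "finite ?U" using U finite_subset by blast
  have fin: "finite {q\<in>c. m \<in> \<rho> q i ` S q}" for m using cQ by auto
  have ge: "2 \<le> ?cnt m + (if odd (?cnt m) then 1 else 0)" if m: "m \<in> ?U" for m
  proof -
    have "?cnt m > 0" using m fin[of m] by (subst card_gt_0_iff) auto
    then show ?thesis by (cases "?cnt m = 1") auto
  qed
  have "2 * card ?U = (\<Sum>m\<in>?U. 2)" by simp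
  also have "\<dots> \<le> (\<Sum>m\<in>?U. ?cnt m + (if odd (?cnt m) then 1 else 0))" by (rule sum_mono) (rule ge)
  also have "\<dots> \<le> (\<Sum>m<n. ?cnt m + (if odd (?cnt m) then 1 else 0))"
    using U by (intro sum_mono2) auto
  also have "\<dots> = (\<Sum>m<n. ?cnt m) + (\<Sum>m<n. if odd (?cnt m) then 1 else 0)" by (rule sum.distrib)
  also have "(\<Sum>m<n. if odd (?cnt m) then 1 else 0) = card {m\<in>{..<n}. odd (?cnt m)}"
    by (simp add: sum.If_cases Int_def)
  also have "(\<Sum>m<n. ?cnt m) = (\<Sum>m<n. \<Sum>q\<in>c. if m \<in> \<rho> q i ` S q then 1 else 0)"
    using cQ(3) by (simp add: sum.If_cases Int_def)
  also have "\<dots> = (\<Sum>q\<in>c. \<Sum>m<n. if m \<in> \<rho> q i ` S q then 1 else 0)" by (rule sum.swap)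
  also have "\<dots> = (\<Sum>q\<in>c. card (S q))"
  proof (rule sum.cong)
    fix q assume q: "q \<in> c"
    have "{..<n} \<inter> {m. m \<in> \<rho> q i ` S q} = \<rho> q i ` S q" using sub[OF q] by blast
    then show "(\<Sum>m<n. if m \<in> \<rho> q i ` S q then 1 else 0) = card (S q)"
      by (simp add: sum.If_cases card_image[OF permutes_inj_on[OF perm[OF q]]])
  qed simp
  finally have "2 * real (card ?U) \<le> (\<Sum>q\<in>c. real (card (S q))) + card {m\<in>{..<n}. odd (?cnt m)}"
    by (drule_tac of_nat_mono[where 'a = real]) simp
  also have "(\<Sum>q\<in>c. real (card (S q))) \<le> (\<Sum>q\<in>c. (1 + \<tau>) * p * n)"
    using S cQ(1) unfolding sparse_near_codeword_def by (intro sum_mono) blast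
  also have "real (card {m\<in>{..<n}. odd (?cnt m)}) \<le> \<tau> * k * p * n"
    using S c unfolding sparse_near_codeword_def by blast
  also have "(\<Sum>q\<in>c. (1 + \<tau>) * p * n) + \<tau> * k * p * n = 2 * (real k * p * (1 + 2 * \<tau>) / 2 * real n)"
    unfolding sum_constant cQ(2) by (simp add: algebra_simps)
  finally show ?thesis by simp
qed

text \<open>Union bound over the set \<open>S\<close> and over a set \<open>U\<close> of checks
  containing all touched ones. In \<open>main\<close>, the logarithmic terms weigh the choices of
  \<open>S\<close> and the probability against the choices of \<open>U\<close>, where 1/k per check
  class becomes d/k per vertex. The constant 2 is one more than the entropy term of \<open>S\<close>
  requires, and this surplus is the factor exp (- p n).\<close>

lemma few_lifts_with_sparse_near_codeword:
  fixes p \<tau> y :: real and n :: nat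
  assumes p: "0 < p" and y: "y = k * p * (1 + 2 * \<tau>) / 2" "0 < y" "y \<le> 1" "y ^ d \<le> p" and n: "n > 0"
    and main: "2 + (1 - \<tau>) * (d * ln y - ln p) + d * (1 + 2 * \<tau>) / 2 * (1 - ln y) \<le> 0"
  shows "real (card {\<rho>\<in>lifts n. \<exists>S. sparse_near_codeword \<tau> p n \<rho> S}) \<le> card (lifts n) * exp (- p * n)"
proof -
  \<comment> \<open>Touched sets are padded to one common size, so that only sets of exactly this
    size have to be enumerated.\<close>
  define u where "u = nat \<lfloor>y * n\<rfloor>"
  define a where "a = (1 - \<tau>) * p * n"
  have uy: "real u \<le> y * n" using y by (simp add: u_def of_nat_floor)
  also have "\<dots> \<le> n" using y by (simp add: mult_left_le_one_le)
  finally have un: "u \<le> n" by simp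
  define \<S> where "\<S> = PiE Q (\<lambda>_. {A\<in>Pow {..<n}. a \<le> card A})"
  define \<U> where "\<U> = PiE orbits (\<lambda>_. {A. A \<subseteq> {..<n} \<and> card A = u})"
  define R where "R S U = {\<rho>\<in>lifts n. \<forall>q\<in>Q. \<forall>i<d. \<rho> q i ` S q \<subseteq> U (i, orb i q)}" for S and U :: "nat \<times> 'q set \<Rightarrow> nat set"
  have fin: "finite \<S>" "finite \<U>" unfolding \<S>_def \<U>_def by (intro finite_PiE finQ finite_orbits; auto)+
  have "{\<rho>\<in>lifts n. \<exists>S. sparse_near_codeword \<tau> p n \<rho> S} \<subseteq> (\<Union>S\<in>\<S>. \<Union>U\<in>\<U>. R S U)"
  proof
    fix \<rho> assume "\<rho> \<in> {\<rho>\<in>lifts n. \<exists>S. sparse_near_codeword \<tau> p n \<rho> S}"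
    then obtain S0 where \<rho>: "\<rho> \<in> lifts n" and S0: "sparse_near_codeword \<tau> p n \<rho> S0" by blast
    define S where "S = restrict S0 Q"
    have S: "S \<in> \<S>" using S0 by (auto simp: \<S>_def S_def sparse_near_codeword_def a_def)
    have "\<exists>U. U \<subseteq> {..<n} \<and> card U = u \<and> (\<Union>q\<in>snd c. \<rho> q (fst c) ` S0 q) \<subseteq> U" if c: "c \<in> orbits" for c
    proof -
      obtain i c' where ic: "c = (i, c')" "i < d" "c' \<in> orb i ` Q" using c by (auto simp: orbits_def)
      let ?U = "\<Union>q\<in>c'. \<rho> q i ` S0 q"
      have "real (card ?U) \<le> y * n" using touched_checks_le[OF \<rho> S0 ic(2,3)] by (simp only: y(1))
      then have "card ?U \<le> u" by (simp add: u_def le_nat_floor)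
      moreover have "?U \<subseteq> {..<n}"
      proof -
        have "c' \<subseteq> Q" using ic orb_sub by blast
        moreover have "\<rho> q i permutes {..<n}" if "q \<in> Q" for q
          using \<rho> that ic by (auto simp: lifts_def PiE_iff)
        ultimately show ?thesis using S0 unfolding sparse_near_codeword_def
          by (auto dest!: permutes_in_image)
      qed
      ultimately obtain U where "?U \<subseteq> U" "U \<subseteq> {..<n}" "card U = u"
        using exists_subset_between[of ?U u "{..<n}"] un by auto
      then show ?thesis using ic by auto
    qed
    then obtain U0 where U0: "\<And>c. c \<in> orbits \<Longrightarrow> U0 c \<subseteq> {..<n} \<and> card (U0 c) = u \<and> (\<Union>q\<in>snd c. \<rho> q (fst c) ` S0 q) \<subseteq> U0 c"
      by metis
    define U where "U = restrict U0 orbits"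
    have U: "U \<in> \<U>" using U0 by (auto simp: U_def \<U>_def)
    have "\<rho> q i ` S q \<subseteq> U (i, orb i q)" if "q \<in> Q" "i < d" for q i
      using U0[OF orbits_I[OF that(2,1)]] orb_self[OF that(2,1)] orbits_I[OF that(2,1)] that
      by (auto simp: U_def S_def)
    then have "\<rho> \<in> R S U" using \<rho> by (auto simp: R_def)
    then show "\<rho> \<in> (\<Union>S\<in>\<S>. \<Union>U\<in>\<U>. R S U)" using S U by blast
  qed
  then have "card {\<rho>\<in>lifts n. \<exists>S. sparse_near_codeword \<tau> p n \<rho> S} \<le> card (\<Union>S\<in>\<S>. \<Union>U\<in>\<U>. R S U)"
    using fin finite_lifts by (intro card_mono) (auto simp: R_def)
  also have "\<dots> \<le> (\<Sum>S\<in>\<S>. card (\<Union>U\<in>\<U>. R S U))" by (rule card_UN_le[OF fin(1)])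
  also have "\<dots> \<le> (\<Sum>S\<in>\<S>. \<Sum>U\<in>\<U>. card (R S U))" by (intro sum_mono card_UN_le[OF fin(2)])
  finally have "real (card {\<rho>\<in>lifts n. \<exists>S. sparse_near_codeword \<tau> p n \<rho> S})
     \<le> real (\<Sum>S\<in>\<S>. \<Sum>U\<in>\<U>. card (R S U))" by (simp only: of_nat_le_iff)
  also have "\<dots> = (\<Sum>S\<in>\<S>. \<Sum>U\<in>\<U>. real (card (R S U)))" by simp
  also have "\<dots> \<le> (\<Sum>S\<in>\<S>. \<Sum>U\<in>\<U>. card (lifts n) * (\<Prod>q\<in>Q. y ^ (d * card (S q))))"
  proof (intro sum_mono)
    fix S U assume S: "S \<in> \<S>" and U: "U \<in> \<U>"
    have "real (card (R S U)) \<le> card (lifts n) * (\<Prod>q\<in>Q. (real u / n) ^ (d * card (S q)))"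
      unfolding R_def
    proof (rule card_lifts_subset_le)
      show "S q \<subseteq> {..<n}" if "q \<in> Q" for q using S that by (auto simp: \<S>_def PiE_iff)
      show "U c \<subseteq> {..<n} \<and> card (U c) = u" if "c \<in> orbits" for c using U that by (auto simp: \<U>_def PiE_iff)
    qed (rule n)
    also have "\<dots> \<le> card (lifts n) * (\<Prod>q\<in>Q. y ^ (d * card (S q)))"
    proof -
      have "real u / n \<le> y" using uy n by (simp add: divide_le_eq)
      then show ?thesis by (intro mult_left_mono prod_mono conjI power_mono) auto
    qed
    finally show "real (card (R S U)) \<le> card (lifts n) * (\<Prod>q\<in>Q. y ^ (d * card (S q)))" .
  qed
  also have "\<dots> = real (card (lifts n)) * real (card \<U>) * (\<Sum>S\<in>\<S>. \<Prod>q\<in>Q. y ^ (d * card (S q)))"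
    by (simp add: sum_distrib_left mult_ac)
  also have "\<dots> \<le> real (card (lifts n)) * exp (y * n - y * n * ln y) ^ card orbits
      * exp (p * n + a * (d * ln y - ln p)) ^ card Q"
  proof (intro mult_mono mult_left_mono)
    have "(\<Sum>S\<in>\<S>. \<Prod>q\<in>Q. y ^ (d * card (S q))) = (\<Prod>q\<in>Q. \<Sum>A\<in>{A\<in>Pow {..<n}. a \<le> card A}. y ^ (d * card A))"
      unfolding \<S>_def by (rule prod_sum_PiE[symmetric]) (use finQ in auto)
    also have "\<dots> = (\<Sum>A\<in>{A\<in>Pow {..<n}. a \<le> card A}. y ^ (d * card A)) ^ card Q" by simp
    also have "\<dots> \<le> exp (p * n + a * (d * ln y - ln p)) ^ card Q"
      by (intro power_mono sum_nonneg sum_large_subsets_bound p y(2,4)) (use y(2) in auto)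
    finally show "(\<Sum>S\<in>\<S>. \<Prod>q\<in>Q. y ^ (d * card (S q))) \<le> exp (p * n + a * (d * ln y - ln p)) ^ card Q" .
    have "real (card \<U>) = real (n choose u) ^ card orbits"
      unfolding \<U>_def using finite_orbits n_subsets[of "{..<n}" u] by (simp add: card_PiE)
    also have "\<dots> \<le> exp (y * n - y * n * ln y) ^ card orbits"
      using binomial_exp_bound[OF y(2,3) u_def] by (intro power_mono) auto
    finally show "real (card \<U>) \<le> exp (y * n - y * n * ln y) ^ card orbits" .
  qed (use y(2) in \<open>auto intro!: sum_nonneg prod_nonneg\<close>)
  also have "\<dots> = card (lifts n) * exp (card orbits * (y * n - y * n * ln y) + card Q * (p * n + a * (d * ln y - ln p)))"
    by (simp add: exp_add exp_of_nat_mult)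
  also have "\<dots> \<le> card (lifts n) * exp (- p * n)"
  proof -
    \<comment> \<open>This turns exponents counted per class of checks into exponents counted per
      base vertex.\<close>
    have orb: "real (card orbits) * k = card Q * d" using card_orbits by (metis of_nat_mult)
    have "real (card orbits) * (y * n - y * n * ln y) = (real (card orbits) * k) * (p * n * (1 + 2 * \<tau>) / 2 * (1 - ln y))"
      unfolding y(1) by (simp add: algebra_simps)
    also have "\<dots> = card Q * (p * n * (d * (1 + 2 * \<tau>) / 2 * (1 - ln y)))"
      unfolding orb by simp
    finally have E: "card orbits * (y * n - y * n * ln y) = card Q * (p * n * (d * (1 + 2 * \<tau>) / 2 * (1 - ln y)))" .
    have "card orbits * (y * n - y * n * ln y) + card Q * (p * n + a * (d * ln y - ln p))
      = card Q * (p * n * (1 + (1 - \<tau>) * (d * ln y - ln p) + d * (1 + 2 * \<tau>) / 2 * (1 - ln y)))"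
      unfolding E a_def by (simp add: algebra_simps)
    also have "\<dots> \<le> card Q * (p * n * (- 1))"
      using main p by (intro mult_left_mono) auto
    also have "\<dots> \<le> 1 * (p * n * (- 1))"
    proof (rule mult_right_mono_neg)
      show "(1::real) \<le> card Q" using finQ Qne by (simp add: Suc_le_eq card_gt_0_iff)
    qed (use p in simp)
    finally show ?thesis by (intro mult_left_mono) auto
  qed
  finally show ?thesis .
qed

end

section \<open>First moment for families of checks with a small sum\<close>

lemma card_perm_tuples_parity_le:
  assumes i0: "i0 < d" and T: "\<And>i. i < d \<Longrightarrow> T i \<subseteq> {..<n}"
  shows "card {r\<in>PiE {..<d} (\<lambda>_. {p. p permutes {..<n}}). {v\<in>{..<n}. odd (card {i\<in>{..<d}. r i v \<in> T i})} = B}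
    * (n choose card (T i0)) \<le> fact n ^ d"
proof -
  let ?P = "{p. p permutes {..<n}}" and ?I = "{..<d} - {i0}"
  let ?X = "{r\<in>PiE {..<d} (\<lambda>_. ?P). {v\<in>{..<n}. odd (card {i\<in>{..<d}. r i v \<in> T i})} = B}"
  \<comment> \<open>Once all permutations except \<open>r i0\<close> are fixed, the parity set
    \<open>B\<close> forces the preimage of \<open>T i0\<close> under \<open>r i0\<close>; this is
    that preimage. The remaining permutation is then bounded by
    \<open>card_permutes_image_le\<close>.\<close>
  define B' where "B' r = {v\<in>{..<n}. (v \<in> B) \<noteq> odd (card {i\<in>?I. r i v \<in> T i})}" for r :: "nat \<Rightarrow> nat \<Rightarrow> nat"
  define N where "N r = {p. p permutes {..<n} \<and> p ` B' r = T i0}" for r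
  have fP: "finite ?P" by (rule finite_permutations) simp
  have fN: "finite (N r)" for r by (rule finite_subset[OF _ fP]) (auto simp: N_def)
  have fR: "finite (PiE ?I (\<lambda>_. ?P))" by (intro finite_PiE fP) auto
  have "?X \<subseteq> (\<Union>r\<in>PiE ?I (\<lambda>_. ?P). (\<lambda>p. r(i0 := p)) ` N r)"
  proof
    fix r assume r: "r \<in> ?X"
    define r' where "r' = restrict r ?I"
    have r'P: "r' \<in> PiE ?I (\<lambda>_. ?P)" using r by (auto simp: r'_def)
    have perm: "r i0 permutes {..<n}" using r i0 by auto
    have iff: "r i0 v \<in> T i0 \<longleftrightarrow> v \<in> B' r'" if v: "v < n" for v
    proof -
      have "{i\<in>{..<d}. r i v \<in> T i} = (if r i0 v \<in> T i0 then insert i0 {i\<in>?I. r' i v \<in> T i} else {i\<in>?I. r' i v \<in> T i})"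
        using i0 by (auto simp: r'_def)
      then have "odd (card {i\<in>{..<d}. r i v \<in> T i}) \<longleftrightarrow> (r i0 v \<in> T i0) \<noteq> odd (card {i\<in>?I. r' i v \<in> T i})"
        by simp
      moreover have "v \<in> B \<longleftrightarrow> odd (card {i\<in>{..<d}. r i v \<in> T i})" using r v by auto
      ultimately show ?thesis using v by (auto simp: B'_def)
    qed
    have "r i0 ` B' r' = T i0"
    proof (intro equalityI subsetI)
      fix m assume "m \<in> r i0 ` B' r'"
      then show "m \<in> T i0" using iff by (auto simp: B'_def)
    next
      fix m assume m: "m \<in> T i0"
      then have "m \<in> r i0 ` {..<n}" using T[OF i0] permutes_image[OF perm] by auto
      then show "m \<in> r i0 ` B' r'" using iff m by auto
    qed
    then have "r i0 \<in> N r'" using perm by (simp add: N_def)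
    moreover have "r = r'(i0 := r i0)"
    proof
      fix i show "r i = (r'(i0 := r i0)) i"
        using r by (cases "i < d") (auto simp: r'_def PiE_iff extensional_def)
    qed
    ultimately show "r \<in> (\<Union>r\<in>PiE ?I (\<lambda>_. ?P). (\<lambda>p. r(i0 := p)) ` N r)" using r'P by blast
  qed
  then have "card ?X \<le> card (\<Union>r\<in>PiE ?I (\<lambda>_. ?P). (\<lambda>p. r(i0 := p)) ` N r)"
    by (intro card_mono finite_UN_I fR finite_imageI fN)
  also have "\<dots> \<le> (\<Sum>r\<in>PiE ?I (\<lambda>_. ?P). card ((\<lambda>p. r(i0 := p)) ` N r))" by (rule card_UN_le[OF fR])
  also have "\<dots> \<le> (\<Sum>r\<in>PiE ?I (\<lambda>_. ?P). card (N r))" by (intro sum_mono card_image_le fN)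
  finally have "card ?X * (n choose card (T i0)) \<le> (\<Sum>r\<in>PiE ?I (\<lambda>_. ?P). card (N r)) * (n choose card (T i0))"
    by (rule mult_le_mono1)
  also have "\<dots> = (\<Sum>r\<in>PiE ?I (\<lambda>_. ?P). card (N r) * (n choose card (T i0)))"
    by (rule sum_distrib_right)
  also have "\<dots> \<le> (\<Sum>r\<in>PiE ?I (\<lambda>_. ?P). fact n)"
    using card_permutes_image_le[of "{..<n}" "T i0"] T[OF i0] by (intro sum_mono) (auto simp: N_def)
  also have "\<dots> = fact n ^ (d - 1) * fact n"
    using i0 card_permutations[of "{..<n}" n] by (simp add: card_PiE)
  also have "\<dots> = fact n ^ d" using i0 by (cases d) auto
  finally show ?thesis .
qed

context orbit_system
begin

text \<open>The sum modulo 2 of the checks selected by \<open>T\<close>, as a set of vertices: the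
  dual codeword that \<open>T\<close> represents.\<close>

definition check_sum :: "nat \<Rightarrow> ('q \<Rightarrow> nat \<Rightarrow> nat \<Rightarrow> nat) \<Rightarrow> (nat \<times> 'q set \<Rightarrow> nat set) \<Rightarrow> ('q \<times> nat) set" where
  "check_sum n \<rho> T = {(q, v). q \<in> Q \<and> v < n \<and> odd (card {i\<in>{..<d}. \<rho> q i v \<in> T (i, orb i q)})}"

text \<open>At a base vertex each of the d classes through it gives a bound by an inverse binomial.
  Their geometric mean puts 1/d in the exponent, and a class is met from k base vertices, whence
  k/d.\<close>

lemma card_lifts_check_sum_le:
  assumes T: "T \<in> PiE orbits (\<lambda>_. Pow {..<n})"
  shows "real (card {\<rho>\<in>lifts n. check_sum n \<rho> T = s})
    \<le> card (lifts n) * real (\<Prod>c\<in>orbits. n choose card (T c)) powr (- (k / d))"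
proof -
  let ?a = "\<lambda>c. real (n choose card (T c))"
  have apos: "?a c > 0" if "c \<in> orbits" for c
  proof -
    have "T c \<subseteq> {..<n}" using T that by auto
    then have "card (T c) \<le> n" using card_mono[of "{..<n}"] by auto
    then show ?thesis by simp
  qed
  let ?X = "\<lambda>q. {r\<in>PiE {..<d} (\<lambda>_. {p. p permutes {..<n}}).
      {v\<in>{..<n}. odd (card {i\<in>{..<d}. r i v \<in> T (i, orb i q)})} = {v. (q, v) \<in> s}}"
  have X: "real (card (?X q)) \<le> fact n ^ d * (\<Prod>i<d. ?a (i, orb i q)) powr (- (1 / d))" if q: "q \<in> Q" for q
  proof -
    have Tq: "T (i, orb i q) \<subseteq> {..<n}" if "i < d" for i
      using T orbits_I[OF that q] by auto
    have "real (card (?X q)) * ?a (i, orb i q) \<le> fact n ^ d" if "i < d" for i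
    proof -
      have "card (?X q) * (n choose card (T (i, orb i q))) \<le> fact n ^ d"
        by (rule card_perm_tuples_parity_le[OF that, of "\<lambda>i. T (i, orb i q)"]) (rule Tq)
      then show ?thesis using of_nat_mono[where 'a = real] by fastforce
    qed
    then have "(\<Prod>i<d. real (card (?X q)) * ?a (i, orb i q)) \<le> (\<Prod>i<d. fact n ^ d)"
      by (intro prod_mono) auto
    then have "real (card (?X q)) ^ d * (\<Prod>i<d. ?a (i, orb i q)) \<le> (fact n ^ d) ^ d"
      by (simp add: prod.distrib)
    moreover define A where "A = (\<Prod>i<d. ?a (i, orb i q))"
    moreover have A: "A > 0" unfolding A_def using orbits_I[OF _ q] apos by (intro prod_pos) auto
    ultimately have "real (card (?X q)) ^ d \<le> (fact n ^ d) ^ d / A" by (simp add: field_simps)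
    also have "\<dots> = (fact n ^ d * A powr (- (1 / d))) ^ d"
    proof -
      have "(A powr (- (1 / d))) ^ d = A powr (- 1)"
        using dpos A by (simp add: powr_powr powr_realpow[symmetric])
      then show ?thesis using A by (simp add: power_mult_distrib powr_minus divide_inverse)
    qed
    finally show ?thesis unfolding A_def[symmetric]
      by (subst (asm) power_mono_iff) (use dpos A in auto)
  qed
  have "{\<rho>\<in>lifts n. check_sum n \<rho> T = s} \<subseteq> {\<rho>\<in>lifts n. \<forall>q\<in>Q. \<rho> q \<in> ?X q}"
    by (auto simp: check_sum_def lifts_def PiE_iff)
  then have "card {\<rho>\<in>lifts n. check_sum n \<rho> T = s} \<le> card {\<rho>\<in>lifts n. \<forall>q\<in>Q. \<rho> q \<in> ?X q}"
    by (intro card_mono) (use finite_lifts in auto)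
  also have "\<dots> = (\<Prod>q\<in>Q. card {r\<in>PiE {..<d} (\<lambda>_. {p. p permutes {..<n}}). r \<in> ?X q})"
    by (rule card_lifts_PiE)
  also have "\<dots> = (\<Prod>q\<in>Q. card (?X q))"
    by (intro prod.cong arg_cong[where f = card]) auto
  finally have "real (card {\<rho>\<in>lifts n. check_sum n \<rho> T = s}) \<le> (\<Prod>q\<in>Q. real (card (?X q)))"
    unfolding of_nat_prod[symmetric] of_nat_le_iff .
  also have "\<dots> \<le> (\<Prod>q\<in>Q. fact n ^ d * (\<Prod>i<d. ?a (i, orb i q)) powr (- (1 / d)))"
    using X by (intro prod_mono) auto
  also have "\<dots> = card (lifts n) * (\<Prod>q\<in>Q. \<Prod>i<d. ?a (i, orb i q)) powr (- (1 / d))"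
    by (simp add: prod.distrib card_lifts prod_powr_distrib prod_nonneg)
  also have "(\<Prod>q\<in>Q. \<Prod>i<d. ?a (i, orb i q)) = (\<Prod>c\<in>orbits. ?a c ^ k)" by (rule prod_orbits)
  also have "\<dots> = (\<Prod>c\<in>orbits. ?a c) powr k"
  proof -
    have "(\<Prod>c\<in>orbits. ?a c) > 0" using apos by (rule prod_pos)
    then show ?thesis by (simp add: prod_power_distrib powr_realpow)
  qed
  finally show ?thesis by (simp add: powr_powr)
qed

text \<open>Union bound over the possible sums \<open>s\<close> and the families \<open>T\<close>.
  As many families share given sizes as the product of binomials says, so the sum over
  \<open>T\<close> factors over the classes into the sums of \<open>sum_binomial_powr_le\<close>.
  The factor n^(-K g) is there to beat the polynomial number of sums \<open>s\<close>.\<close>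

lemma few_lifts_with_heavy_checks:
  fixes g :: real
  assumes g: "g = (real k - real d) / real d / 2" "g > 0" and n: "n > 0"
  shows "real (card {\<rho>\<in>lifts n. \<exists>T\<in>PiE orbits (\<lambda>_. Pow {..<n}).
        n ^ K < (\<Prod>c\<in>orbits. n choose card (T c)) \<and> card (check_sum n \<rho> T) \<le> N})
    \<le> card (lifts n) * ((card Q * n + 1) ^ N * real n powr (- (K * g)) * (2 / (1 - 2 powr (- g))) ^ card orbits)"
proof -
  let ?P = "\<lambda>T. \<Prod>c\<in>orbits. n choose card (T c)"
  define \<T> where "\<T> = {T\<in>PiE orbits (\<lambda>_. Pow {..<n}). n ^ K < ?P T}"
  define \<S> where "\<S> = {s. s \<subseteq> Q \<times> {..<n} \<and> card s \<le> N}"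
  have fT0: "finite (PiE orbits (\<lambda>_. Pow {..<n}))" by (intro finite_PiE finite_orbits) auto
  then have fT: "finite \<T>" by (auto simp: \<T>_def)
  have fS: "finite \<S>" unfolding \<S>_def by (rule finite_subset[of _ "Pow (Q \<times> {..<n})"]) (use finQ in auto)
  have cS: "card \<S> \<le> (card Q * n + 1) ^ N"
    using card_small_subsets_le[of "Q \<times> {..<n}" N] finQ by (simp add: \<S>_def)
  let ?R = "\<lambda>s T. {\<rho>\<in>lifts n. check_sum n \<rho> T = s}"
  have "{\<rho>\<in>lifts n. \<exists>T\<in>PiE orbits (\<lambda>_. Pow {..<n}). n ^ K < ?P T \<and> card (check_sum n \<rho> T) \<le> N}
     \<subseteq> (\<Union>s\<in>\<S>. \<Union>T\<in>\<T>. ?R s T)"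
  proof
    fix \<rho> assume "\<rho> \<in> {\<rho>\<in>lifts n. \<exists>T\<in>PiE orbits (\<lambda>_. Pow {..<n}). n ^ K < ?P T \<and> card (check_sum n \<rho> T) \<le> N}"
    then obtain T where T: "\<rho> \<in> lifts n" "T \<in> \<T>" "card (check_sum n \<rho> T) \<le> N"
      unfolding \<T>_def by blast
    moreover have "check_sum n \<rho> T \<subseteq> Q \<times> {..<n}" by (auto simp: check_sum_def)
    ultimately have "check_sum n \<rho> T \<in> \<S>" by (simp add: \<S>_def)
    then show "\<rho> \<in> (\<Union>s\<in>\<S>. \<Union>T\<in>\<T>. ?R s T)" using T by blast
  qed
  then have "card {\<rho>\<in>lifts n. \<exists>T\<in>PiE orbits (\<lambda>_. Pow {..<n}). n ^ K < ?P T \<and> card (check_sum n \<rho> T) \<le> N}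
    \<le> card (\<Union>s\<in>\<S>. \<Union>T\<in>\<T>. ?R s T)"
    using finite_lifts fS fT by (intro card_mono) auto
  also have "\<dots> \<le> (\<Sum>s\<in>\<S>. card (\<Union>T\<in>\<T>. ?R s T))" by (rule card_UN_le[OF fS])
  also have "\<dots> \<le> (\<Sum>s\<in>\<S>. \<Sum>T\<in>\<T>. card (?R s T))" by (intro sum_mono card_UN_le[OF fT])
  finally have "real (card {\<rho>\<in>lifts n. \<exists>T\<in>PiE orbits (\<lambda>_. Pow {..<n}). n ^ K < ?P T \<and> card (check_sum n \<rho> T) \<le> N})
    \<le> (\<Sum>s\<in>\<S>. \<Sum>T\<in>\<T>. real (card (?R s T)))"
    unfolding of_nat_sum[symmetric] of_nat_le_iff .
  also have "\<dots> \<le> (\<Sum>s\<in>\<S>. \<Sum>T\<in>\<T>. card (lifts n) * (real n powr (- (K * g)) * (\<Prod>c\<in>orbits. real (n choose card (T c)) powr (- (1 + g)))))"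
  proof (intro sum_mono)
    fix s T assume T: "T \<in> \<T>"
    define A where "A = real (?P T)"
    have T': "T \<in> PiE orbits (\<lambda>_. Pow {..<n})" "real (n ^ K) < A"
      using T unfolding \<T>_def A_def of_nat_less_iff by auto
    have A: "A > 0" "real n ^ K \<le> A" using T'(2) by (auto intro: le_less_trans[of 0 "real (n ^ K)"])
    \<comment> \<open>Here k/d = 1 + 2 g: the first g makes the sum over the families converge, the
      second exploits that the product of binomials exceeds n^K.\<close>
    have "- (k / d) = - (1 + g) + - g" using g dpos by (simp add: field_simps)
    then have "A powr (- (k / d)) = A powr (- (1 + g)) * A powr (- g)"
      using A by (simp only: powr_add[of A "- (1 + g)" "- g"])
    also have "\<dots> \<le> A powr (- (1 + g)) * (real n ^ K) powr (- g)"
      using g n A by (intro mult_left_mono powr_mono2') auto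
    also have "(real n ^ K) powr (- g) = real n powr (- (K * g))"
      using n by (simp add: powr_realpow[symmetric] powr_powr)
    also have "A powr (- (1 + g)) = (\<Prod>c\<in>orbits. real (n choose card (T c)) powr (- (1 + g)))"
      unfolding A_def of_nat_prod by (rule prod_powr_distrib)
    finally have "A powr (- (k / d)) \<le> real n powr (- (K * g)) * (\<Prod>c\<in>orbits. real (n choose card (T c)) powr (- (1 + g)))"
      by (simp only: mult.commute)
    then have "card (lifts n) * A powr (- (k / d)) \<le> card (lifts n) * (real n powr (- (K * g)) * (\<Prod>c\<in>orbits. real (n choose card (T c)) powr (- (1 + g))))"
      by (rule mult_left_mono) simp
    then show "real (card (?R s T)) \<le> card (lifts n) * (real n powr (- (K * g)) * (\<Prod>c\<in>orbits. real (n choose card (T c)) powr (- (1 + g))))"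
      using card_lifts_check_sum_le[OF T'(1), of s] unfolding A_def by linarith
  qed
  also have "\<dots> = card (lifts n) * (real (card \<S>) * real n powr (- (K * g)) *
      (\<Sum>T\<in>\<T>. \<Prod>c\<in>orbits. real (n choose card (T c)) powr (- (1 + g))))"
    by (simp add: sum_distrib_left mult_ac)
  also have "\<dots> \<le> card (lifts n) * ((card Q * n + 1) ^ N * real n powr (- (K * g)) * (2 / (1 - 2 powr (- g))) ^ card orbits)"
  proof (intro mult_left_mono mult_mono)
    have "(\<Sum>T\<in>\<T>. \<Prod>c\<in>orbits. real (n choose card (T c)) powr (- (1 + g)))
      \<le> (\<Sum>T\<in>PiE orbits (\<lambda>_. Pow {..<n}). \<Prod>c\<in>orbits. real (n choose card (T c)) powr (- (1 + g)))"
      using fT0 by (intro sum_mono2) (auto simp: \<T>_def intro!: prod_nonneg)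
    also have "\<dots> = (\<Prod>c\<in>orbits. \<Sum>B\<in>Pow {..<n}. real (n choose card B) powr (- (1 + g)))"
      by (rule prod_sum_PiE[symmetric]) (use finite_orbits in auto)
    also have "(\<Sum>B\<in>Pow {..<n}. real (n choose card B) powr (- (1 + g)))
      = (\<Sum>t\<le>n. real (n choose t) * real (n choose t) powr (- (1 + g)))"
      by (rule sum_Pow_card[of "\<lambda>t. real (n choose t) powr (- (1 + g))"])
    also have "\<dots> = (\<Sum>t\<le>n. real (n choose t) powr (- g))"
    proof (rule sum.cong)
      fix t assume "t \<in> {..n}"
      then have "real (n choose t) > 0" by simp
      then have "real (n choose t) powr 1 * real (n choose t) powr (- (1 + g)) = real (n choose t) powr (- g)"
        by (subst powr_add[symmetric]) simp
      then show "real (n choose t) * real (n choose t) powr (- (1 + g)) = real (n choose t) powr (- g)"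
        by simp
    qed simp
    also have "(\<Prod>c\<in>orbits. \<Sum>t\<le>n. real (n choose t) powr (- g)) \<le> (\<Prod>c\<in>orbits. 2 / (1 - 2 powr (- g)))"
      using sum_binomial_powr_le[OF g(2), of n] by (intro prod_mono) (auto intro!: sum_nonneg)
    finally show "(\<Sum>T\<in>\<T>. \<Prod>c\<in>orbits. real (n choose card (T c)) powr (- (1 + g))) \<le> (2 / (1 - 2 powr (- g))) ^ card orbits"
      by simp
    show "real (card \<S>) \<le> (card Q * n + 1) ^ N" using of_nat_mono[OF cS, where 'a = real] by simp
  qed (auto intro!: sum_nonneg prod_nonneg)
  finally show ?thesis .
qed

end

text \<open>As p tends to 0 the sign of the exponent is that of its coefficient of
  \<open>ln p\<close>, reversed. The tolerance 1/20 is small enough to keep this coefficient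
  positive at d = 3.\<close>

lemma sparse_near_codeword_parameters:
  fixes d k :: nat
  assumes d: "d \<ge> 3" and k: "k > 0"
  shows "\<exists>\<delta>>(0::real). \<forall>(p::real) (y::real). 0 < p \<longrightarrow> p < \<delta> \<longrightarrow> y = k * p * (1 + 2 * (1 / 20)) / 2 \<longrightarrow>
    0 < y \<and> y \<le> 1 \<and> y ^ d \<le> p \<and>
    2 + (1 - 1 / 20) * (d * ln y - ln p) + d * (1 + 2 * (1 / 20)) / 2 * (1 - ln y) \<le> 0"
proof -
  define K :: real where "K = k * 11 / 20"
  \<comment> \<open>The coefficient of \<open>ln p\<close>: 19/20 (d - 1) - 11/20 d. At d = 3 it
    equals 1/4.\<close>
  define c :: real where "c = (8 * real d - 19) / 20"
  define C :: real where "C = 2 + 2 * d / 5 * ln K + 11 * d / 20"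
  have K: "K > 0" using k by (simp add: K_def)
  have c: "c > 0" using d by (simp add: c_def)
  \<comment> \<open>The three bounds on p give, in this order, a negative exponent, \<open>y\<close>
    at most 1, and \<open>y\<^sup>2\<close> at most \<open>p\<close>.\<close>
  define \<delta> where "\<delta> = min (exp (- C / c)) (min (1 / K) (1 / K\<^sup>2))"
  have "\<delta> > 0" using K by (simp add: \<delta>_def)
  moreover have "0 < y \<and> y \<le> 1 \<and> y ^ d \<le> p \<and>
    2 + (1 - 1 / 20) * (d * ln y - ln p) + d * (1 + 2 * (1 / 20)) / 2 * (1 - ln y) \<le> 0"
    if p: "0 < p" "p < \<delta>" and y: "y = k * p * (1 + 2 * (1 / 20)) / 2" for p y :: real
  proof -
    have yK: "y = K * p" by (simp add: y K_def)
    have p': "p < 1 / K" "p < 1 / K\<^sup>2" "p < exp (- C / c)" using p by (auto simp: \<delta>_def)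
    have y1: "0 < y" "y \<le> 1" using p' p K by (simp_all add: yK field_simps)
    have "y ^ d \<le> y ^ 2" using y1 d by (intro power_decreasing) auto
    also have "\<dots> = (K\<^sup>2 * p) * p" by (simp add: yK power2_eq_square)
    also have "\<dots> \<le> 1 * p" using p' p K by (intro mult_right_mono) (simp_all add: field_simps)
    finally have yd: "y ^ d \<le> p" by simp
    have "ln p < - C / c" using p'(3) p(1) by (metis exp_gt_zero ln_exp ln_less_cancel_iff)
    then have "c * ln p + C < 0" using c by (simp add: field_simps)
    moreover have "ln y = ln K + ln p" using K p by (simp add: yK ln_mult)
    then have "2 + (1 - 1 / 20) * (d * ln y - ln p) + d * (1 + 2 * (1 / 20)) / 2 * (1 - ln y) = c * ln p + C"
      by (simp add: c_def C_def field_simps)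
    ultimately show ?thesis using y1 yd by simp
  qed
  ultimately show ?thesis by blast
qed

section \<open>Linear algebra over the field with two elements\<close>

declare add_bit_eq_xor [simp del] mult_bit_eq_and [simp del]

lemma bit_add_self [simp]: "(a::bit) + a = 0"
  by (cases a) simp_all

lemma finite_UNIV_bit: "finite (UNIV :: bit set)"
  by (rule finite_subset[of _ "{0, 1}"]) auto

lemma of_nat_bit: "(of_nat n :: bit) = of_bool (odd n)"
  by (induction n) auto

lemma sum_bit_of_bool:
  assumes "finite S"
  shows "(\<Sum>x\<in>S. of_bool (P x)) = (of_bool (odd (card {x\<in>S. P x})) :: bit)"
  using assms by (simp add: of_nat_bit Int_def)

lemma sum_bit_sym_diff:
  fixes x :: "'v \<Rightarrow> bit"
  assumes "finite A" "finite B"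
  shows "sum x (sym_diff A B) = sum x A + sum x B"
proof -
  have "sum x A = sum x (A - B) + sum x (A \<inter> B)"
    using assms by (subst sum.union_disjoint[symmetric]) (auto simp: Un_Diff_Int intro!: arg_cong[where f = "sum x"])
  moreover have "sum x B = sum x (B - A) + sum x (A \<inter> B)"
    using assms by (subst sum.union_disjoint[symmetric]) (auto intro!: arg_cong[where f = "sum x"])
  moreover have "sum x (sym_diff A B) = sum x (A - B) + sum x (B - A)"
    using assms by (subst sum.union_disjoint[symmetric]) auto
  ultimately show ?thesis by (simp add: add_ac)
qed

text \<open>Double annihilator over the field with two elements: a functional that vanishes on all
  solutions is a sum of checks. The induction decides for each check whether it has to occur in the
  sum.\<close>

lemma parity_check_duality:
  assumes "finite C" "finite V" "\<And>c. c \<in> C \<Longrightarrow> chk c \<subseteq> V" "A \<subseteq> V"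
    and "\<And>x :: 'v \<Rightarrow> bit. (\<And>c. c \<in> C \<Longrightarrow> sum x (chk c) = 0) \<Longrightarrow> sum x A = 0"
  shows "\<exists>T\<subseteq>C. \<forall>v. v \<in> A \<longleftrightarrow> odd (card {c\<in>T. v \<in> chk c})"
  using assms(1,3,4,5)
proof (induction C arbitrary: A rule: finite_induct)
  case empty
  have "v \<notin> A" for v
  proof
    assume v: "v \<in> A"
    have "finite A" using empty assms(2) finite_subset by blast
    then have "sum (\<lambda>u. of_bool (u = v)) A = (1::bit)" using v by (simp add: if_distrib of_bool_def)
    moreover have "sum (\<lambda>u. of_bool (u = v)) A = (0::bit)" by (rule empty) simp
    ultimately show False by simp
  qed
  then show ?case by auto
next
  case (insert c C)
  have fin: "finite A" "finite (chk c)" "finite C"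
    using insert.prems(1)[of c] insert.prems(2) assms(2) insert.hyps finite_subset by auto
  show ?case
  proof (cases "\<forall>x :: 'v \<Rightarrow> bit. (\<forall>c\<in>C. sum x (chk c) = 0) \<longrightarrow> sum x A = 0")
    case True
    have "\<exists>T\<subseteq>C. \<forall>v. v \<in> A \<longleftrightarrow> odd (card {c\<in>T. v \<in> chk c})"
    proof (rule insert.IH)
      show "sum x A = 0" if "\<And>c. c \<in> C \<Longrightarrow> sum x (chk c) = 0" for x :: "'v \<Rightarrow> bit"
        using True that by blast
      show "chk c' \<subseteq> V" if "c' \<in> C" for c' using that insert.prems(1)[of c'] by simp
      show "A \<subseteq> V" by (rule insert.prems(2))
    qed
    then obtain T where "T \<subseteq> C" "\<forall>v. v \<in> A \<longleftrightarrow> odd (card {c\<in>T. v \<in> chk c})" by blast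
    then show ?thesis by (intro exI[of _ T]) auto
  next
    case False
    then obtain x0 :: "'v \<Rightarrow> bit" where "\<forall>c\<in>C. sum x0 (chk c) = 0" "sum x0 A \<noteq> 0" by blast
    then have x0: "\<And>c. c \<in> C \<Longrightarrow> sum x0 (chk c) = 0" "sum x0 A = 1" by auto
    \<comment> \<open>The earlier checks do not force \<open>sum x A = 0\<close>, so the new check
      must occur; it is split off from \<open>A\<close>.\<close>
    let ?A = "sym_diff A (chk c)"
    have x0c: "sum x0 (chk c) = 1"
      using insert.prems(3)[of x0] x0 by (cases "sum x0 (chk c)") auto
    have "sum x ?A = 0" if x: "\<And>c. c \<in> C \<Longrightarrow> sum x (chk c) = 0" for x :: "'v \<Rightarrow> bit"
    proof (cases "sum x (chk c) = 0")
      case True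
      then have "sum x A = 0" using insert.prems(3)[of x] x by auto
      then show ?thesis using True by (simp add: sum_bit_sym_diff fin)
    next
      case False
      \<comment> \<open>Both \<open>x\<close> and \<open>x0\<close> violate the new check, hence
        their sum satisfies every check.\<close>
      have "sum (\<lambda>v. x v + x0 v) A = 0"
        by (rule insert.prems(3)) (use False in \<open>auto simp: sum.distrib x x0 x0c\<close>)
      then have "sum x A = 1" using x0 by (cases "sum x A") (auto simp: sum.distrib)
      then show ?thesis using False by (simp add: sum_bit_sym_diff fin)
    qed
    note A0 = this
    have "\<exists>T\<subseteq>C. \<forall>v. v \<in> ?A \<longleftrightarrow> odd (card {c\<in>T. v \<in> chk c})"
    proof (rule insert.IH)
      show "sum x ?A = 0" if "\<And>c. c \<in> C \<Longrightarrow> sum x (chk c) = 0" for x :: "'v \<Rightarrow> bit"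
        by (rule A0) (rule that)
      show "chk c' \<subseteq> V" if "c' \<in> C" for c' using that insert.prems(1)[of c'] by simp
      show "?A \<subseteq> V" using insert.prems(1)[of c] insert.prems(2) by auto
    qed
    then obtain T where T: "T \<subseteq> C" "\<forall>v. v \<in> ?A \<longleftrightarrow> odd (card {c\<in>T. v \<in> chk c})"
      by blast
    have "v \<in> A \<longleftrightarrow> odd (card {c'\<in>insert c T. v \<in> chk c'})" for v
    proof -
      have "{c'\<in>insert c T. v \<in> chk c'} = (if v \<in> chk c then insert c {c'\<in>T. v \<in> chk c'} else {c'\<in>T. v \<in> chk c'})"
        by auto
      moreover have "finite {c'\<in>T. v \<in> chk c'}" "c \<notin> {c'\<in>T. v \<in> chk c'}"
        using finite_subset[OF T(1) fin(3)] T(1) insert.hyps by auto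
      ultimately have "odd (card {c'\<in>insert c T. v \<in> chk c'}) \<longleftrightarrow> (v \<in> chk c) \<noteq> odd (card {c'\<in>T. v \<in> chk c'})"
        by auto
      then show ?thesis using T(2)[rule_format, of v] by auto
    qed
    then show ?thesis using T(1) by (intro exI[of _ "insert c T"]) auto
  qed
qed

section \<open>Characters and the Fourier expansion of a pattern\<close>

definition bit_sgn :: "bit \<Rightarrow> real" where
  "bit_sgn b = (if b = 0 then 1 else - 1)"

lemma bit_sgn_0 [simp]: "bit_sgn 0 = 1" and bit_sgn_1 [simp]: "bit_sgn 1 = - 1"
  by (simp_all add: bit_sgn_def)

lemma bit_sgn_add: "bit_sgn (a + b) = bit_sgn a * bit_sgn b"
  by (cases a; cases b) auto

lemma bit_sgn_sum: "bit_sgn (sum x A) = (\<Prod>a\<in>A. bit_sgn (x a))"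
  by (induction A rule: infinite_finite_induct) (auto simp: bit_sgn_add)

text \<open>Each factor of the indicator is half of 1 plus a product of signs; multiplying out
  produces one character for every subset of \<open>I\<close>.\<close>

lemma pattern_indicator:
  assumes "finite I"
  shows "of_bool (\<forall>i\<in>I. z i = p i) = (\<Sum>A\<in>Pow I. bit_sgn (sum z A) * bit_sgn (sum p A)) / 2 ^ card I"
proof -
  have "of_bool (\<forall>i\<in>I. z i = p i) = (\<Prod>i\<in>I. of_bool (z i = p i) :: real)"
    using assms by (induction I rule: finite_induct) (auto simp: of_bool_def)
  also have "\<dots> = (\<Prod>i\<in>I. (bit_sgn (z i) * bit_sgn (p i) + 1) / 2)"
  proof (rule prod.cong)
    fix i show "of_bool (z i = p i) = (bit_sgn (z i) * bit_sgn (p i) + 1) / 2"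
      by (cases "z i"; cases "p i") auto
  qed simp
  also have "\<dots> = (\<Prod>i\<in>I. bit_sgn (z i) * bit_sgn (p i) + 1) / 2 ^ card I"
    by (simp add: prod_dividef)
  also have "(\<Prod>i\<in>I. bit_sgn (z i) * bit_sgn (p i) + 1) = (\<Sum>A\<in>Pow I. bit_sgn (sum z A) * bit_sgn (sum p A))"
    unfolding prod_add[OF assms] by (simp add: bit_sgn_sum prod.distrib)
  finally show ?thesis .
qed

text \<open>A finite set \<open>A\<close> stands for the character with frequencies
  \<open>A\<close>; the null sets form the annihilator of X.\<close>

definition null_set_of :: "nat \<Rightarrow> nat \<Rightarrow> gword set set \<Rightarrow> bool" where
  "null_set_of d k A \<longleftrightarrow> (\<forall>a\<in>parity_set d k. sum a A = 0)"

text \<open>The Haar probability of the cylinder with pattern \<open>p\<close> on \<open>F\<close>, as a Fourier sum over the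
  characters that are trivial on \<open>X\<close>.\<close>

definition pattern_prob :: "nat \<Rightarrow> nat \<Rightarrow> gword set set \<Rightarrow> (gword set \<Rightarrow> bit) \<Rightarrow> real" where
  "pattern_prob d k F p = (\<Sum>A\<in>Pow F. of_bool (null_set_of d k A) * bit_sgn (sum p A)) / 2 ^ card F"

section \<open>Codes on lifts of a finite \<open>\<Gamma>\<close>-set\<close>

text \<open>Freeness along each generator gives every orbit of a generator exactly k points, as in
  \<Gamma>. Injectivity on larger windows is imposed separately where local comparison with \<Gamma>
  begins.\<close>

locale finite_gam_set =
  fixes d k :: nat and Q :: "'q set" and qact :: "'q \<Rightarrow> gword set \<Rightarrow> 'q"
  assumes d_pos: "d > 0" and k_gt_1: "k > 1"
    and finite_Q: "finite Q" and Q_nonempty: "Q \<noteq> {}"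
    and qact: "right_action (Gam d k) Q qact"
    and qact_free: "\<And>q i j. q \<in> Q \<Longrightarrow> i < d \<Longrightarrow> 0 < j \<Longrightarrow> j < k \<Longrightarrow> qact q (gen d k i [^]\<^bsub>Gam d k\<^esub> (j::nat)) \<noteq> q"
begin

abbreviation "\<Gamma> \<equiv> Gam d k"
abbreviation gpow :: "nat \<Rightarrow> nat \<Rightarrow> gword set" where "gpow i j \<equiv> gen d k i [^]\<^bsub>\<Gamma>\<^esub> j"

sublocale Gam: group \<Gamma> by (rule group_Gam)

lemmas qactD = right_actionD[OF qact]

lemma gpow_closed: "i < d \<Longrightarrow> gpow i j \<in> carrier \<Gamma>"
  by (rule gen_pow_closed)

lemma gpow_mult: "i < d \<Longrightarrow> gpow i a \<otimes>\<^bsub>\<Gamma>\<^esub> gpow i b = gpow i (a + b)"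
  by (rule Gam.nat_pow_mult) (rule gen_closed)

lemma gpow_k_mult_add: "i < d \<Longrightarrow> gpow i (k * a + b) = gpow i b"
proof -
  assume i: "i < d"
  have "gpow i (k * a) = \<one>\<^bsub>\<Gamma>\<^esub>"
    using Gam.nat_pow_pow[OF gen_closed[OF i], of k a] gen_pow_k[OF i] by simp
  then show ?thesis
    using gpow_mult[OF i, of "k * a" b] gpow_closed[OF i, of b] by simp
qed

lemma act_gpow_add:
  assumes "right_action \<Gamma> V act" "v \<in> V" "i < d"
  shows "act (act v (gpow i a)) (gpow i b) = act v (gpow i (a + b))"
  using right_actionD(3)[OF assms(1,2) gpow_closed[OF assms(3)] gpow_closed[OF assms(3)], of a b]
  by (simp only: gpow_mult[OF assms(3)])

lemma range_gpow_act:
  assumes "i < d"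
  shows "range (\<lambda>j. act v (gpow i j)) = (\<lambda>j. act v (gpow i j)) ` {..<k}"
proof (intro equalityI subsetI)
  fix w assume "w \<in> range (\<lambda>j. act v (gpow i j))"
  then obtain j where "w = act v (gpow i j)" by blast
  also have "gpow i j = gpow i (j mod k)"
    using gpow_k_mult_add[OF assms, of "j div k" "j mod k"] by simp
  finally show "w \<in> (\<lambda>j. act v (gpow i j)) ` {..<k}"
    using k_gt_1 by (intro image_eqI[of _ _ "j mod k"]) auto
qed auto

lemma inj_on_gpow_act:
  assumes act: "right_action \<Gamma> V act" and v: "v \<in> V" and i: "i < d"
    and free: "\<And>v j. v \<in> V \<Longrightarrow> 0 < j \<Longrightarrow> j < k \<Longrightarrow> act v (gpow i j) \<noteq> v"
  shows "inj_on (\<lambda>j. act v (gpow i j)) {..<k}"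
proof (rule linorder_inj_onI)
  fix a b assume ab: "a < b" "a \<in> {..<k}" "b \<in> {..<k}"
  have "act (act v (gpow i a)) (gpow i (b - a)) = act v (gpow i b)"
    using act_gpow_add[OF act v i, of a "b - a"] ab by simp
  moreover have "act (act v (gpow i a)) (gpow i (b - a)) \<noteq> act v (gpow i a)"
    using right_actionD(2)[OF act v gpow_closed[OF i]] ab by (intro free) auto
  ultimately show "act v (gpow i a) \<noteq> act v (gpow i b)" by simp
qed auto

lemma range_gpow_act_eq:
  assumes act: "right_action \<Gamma> V act" and v: "v \<in> V" and i: "i < d"
    and w: "w \<in> range (\<lambda>j. act v (gpow i j))"
  shows "range (\<lambda>j. act w (gpow i j)) = range (\<lambda>j. act v (gpow i j))"
proof -
  obtain a where w: "w = act v (gpow i a)" using w by blast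
  have wj: "act w (gpow i j) = act v (gpow i (a + j))" for j
    unfolding w by (rule act_gpow_add[OF act v i])
  \<comment> \<open>The exponent (k - 1) a inverts a modulo k without subtraction.\<close>
  have "act v (gpow i j) = act w (gpow i ((k - 1) * a + j))" for j
  proof -
    have "a + ((k - 1) * a + j) = k * a + j" using k_gt_1 by (cases k) auto
    then show ?thesis unfolding wj by (simp only: gpow_k_mult_add[OF i])
  qed
  then show ?thesis using wj by (auto simp: image_iff)
qed

definition orb :: "nat \<Rightarrow> 'q \<Rightarrow> 'q set" where
  "orb i q = range (\<lambda>j. qact q (gpow i j))"

sublocale orbit_system d k Q orb
proof
  fix i q assume iq: "i < d" "q \<in> Q"
  have "qact q (gpow i 0) = q" using qactD(1)[OF iq(2)] by simp
  then show "q \<in> orb i q" unfolding orb_def by (metis rangeI)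
  show "orb i q \<subseteq> Q" using qactD(2)[OF iq(2)] gpow_closed[OF iq(1)] by (auto simp: orb_def)
  show "card (orb i q) = k"
    unfolding orb_def range_gpow_act[OF iq(1)]
    using card_image[OF inj_on_gpow_act[OF qact iq(2,1) qact_free]] iq by simp
  fix q' assume "q' \<in> orb i q"
  then show "orb i q' = orb i q" unfolding orb_def by (rule range_gpow_act_eq[OF qact iq(2,1)])
qed (use d_pos k_gt_1 finite_Q Q_nonempty in auto)

section \<open>The lifted action, its checks and its code\<close>

definition vertices :: "nat \<Rightarrow> ('q \<times> nat) set" where
  "vertices n = Q \<times> {..<n}"

text \<open>The step goes to the vertex over \<open>qact (fst v) (gen d k i)\<close> that carries
  the same check label. It therefore circulates inside one check, and its order divides k.\<close>

definition lift_step :: "('q \<Rightarrow> nat \<Rightarrow> nat \<Rightarrow> nat) \<Rightarrow> nat \<Rightarrow> 'q \<times> nat \<Rightarrow> 'q \<times> nat" where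
  "lift_step \<rho> i v = (let q' = qact (fst v) (gen d k i) in (q', Hilbert_Choice.inv (\<rho> q' i) (\<rho> (fst v) i (snd v))))"

lemma liftsD: "\<rho> \<in> lifts n \<Longrightarrow> q \<in> Q \<Longrightarrow> i < d \<Longrightarrow> \<rho> q i permutes {..<n}"
  by (auto simp: lifts_def PiE_iff)

lemma lift_step_iter:
  assumes \<rho>: "\<rho> \<in> lifts n" and v: "v \<in> vertices n" and i: "i < d"
  shows "(lift_step \<rho> i ^^ j) v = (qact (fst v) (gpow i j), Hilbert_Choice.inv (\<rho> (qact (fst v) (gpow i j)) i) (\<rho> (fst v) i (snd v)))
    \<and> (lift_step \<rho> i ^^ j) v \<in> vertices n"
proof -
  have q: "fst v \<in> Q" "snd v < n" using v by (auto simp: vertices_def)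
  let ?m = "\<rho> (fst v) i (snd v)"
  have m: "?m < n" using permutes_in_image[OF liftsD[OF \<rho> q(1) i]] q(2) by auto
  have inQ: "qact (fst v) (gpow i j) \<in> Q" for j using qactD(2)[OF q(1)] gpow_closed[OF i] by blast
  have "(lift_step \<rho> i ^^ j) v = (qact (fst v) (gpow i j), Hilbert_Choice.inv (\<rho> (qact (fst v) (gpow i j)) i) ?m)"
  proof (induction j)
    case 0
    have "Hilbert_Choice.inv (\<rho> (fst v) i) ?m = snd v"
      by (rule inv_f_f) (rule permutes_inj[OF liftsD[OF \<rho> q(1) i]])
    then show ?case using qactD(1)[OF q(1)] by simp
  next
    case (Suc j)
    have "qact (qact (fst v) (gpow i j)) (gen d k i) = qact (fst v) (gpow i (Suc j))"
      using qactD(3)[OF q(1) gpow_closed[OF i, of j] gen_closed[OF i]] by simp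
    moreover have "\<rho> (qact (fst v) (gpow i j)) i (Hilbert_Choice.inv (\<rho> (qact (fst v) (gpow i j)) i) ?m) = ?m"
      by (rule permutes_inverses(1)[OF liftsD[OF \<rho> inQ i]])
    ultimately show ?case using Suc by (simp add: lift_step_def Let_def del: Gam.nat_pow_Suc)
  qed
  moreover have "Hilbert_Choice.inv (\<rho> (qact (fst v) (gpow i j)) i) ?m < n"
    using permutes_in_image[OF permutes_inv[OF liftsD[OF \<rho> inQ[of j] i]]] m by auto
  ultimately show ?thesis using inQ by (auto simp: vertices_def)
qed

definition lift_act :: "nat \<Rightarrow> ('q \<Rightarrow> nat \<Rightarrow> nat \<Rightarrow> nat) \<Rightarrow> 'q \<times> nat \<Rightarrow> gword set \<Rightarrow> 'q \<times> nat" where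
  "lift_act n \<rho> = (SOME act. right_action \<Gamma> (vertices n) act \<and>
      (\<forall>i<d. \<forall>x\<in>vertices n. act x (gen d k i) = lift_step \<rho> i x))"

lemma lift_act:
  assumes \<rho>: "\<rho> \<in> lifts n"
  shows "right_action \<Gamma> (vertices n) (lift_act n \<rho>)"
    and "i < d \<Longrightarrow> v \<in> vertices n \<Longrightarrow> lift_act n \<rho> v (gen d k i) = lift_step \<rho> i v"
proof -
  have "\<exists>act. right_action \<Gamma> (vertices n) act \<and>
      (\<forall>i<d. \<forall>x\<in>vertices n. act x (gen d k i) = lift_step \<rho> i x)"
  proof (rule right_action_Gam_exists)
    fix i v assume iv: "i < d" "v \<in> vertices n"
    show "lift_step \<rho> i v \<in> vertices n" 
      using conjunct2[OF lift_step_iter[OF \<rho> iv(2,1), of 1]] by (simp only: funpow_simps_right(1) One_nat_def funpow.simps o_apply id_apply)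
    have "gpow i k = \<one>\<^bsub>\<Gamma>\<^esub>" by (rule gen_pow_k[OF iv(1)])
    moreover have q: "fst v \<in> Q" using iv by (auto simp: vertices_def)
    ultimately have "(lift_step \<rho> i ^^ k) v = (fst v, Hilbert_Choice.inv (\<rho> (fst v) i) (\<rho> (fst v) i (snd v)))"
      using lift_step_iter[OF \<rho> iv(2,1), of k] qactD(1) by simp
    also have "Hilbert_Choice.inv (\<rho> (fst v) i) (\<rho> (fst v) i (snd v)) = snd v"
      by (rule inv_f_f) (rule permutes_inj[OF liftsD[OF \<rho> q iv(1)]])
    finally show "(lift_step \<rho> i ^^ k) v = v" by simp
  qed (use k_gt_1 in simp)
  from someI_ex[OF this] show "right_action \<Gamma> (vertices n) (lift_act n \<rho>)"
    "i < d \<Longrightarrow> v \<in> vertices n \<Longrightarrow> lift_act n \<rho> v (gen d k i) = lift_step \<rho> i v"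
    unfolding lift_act_def[symmetric] by auto
qed

lemma lift_act_gpow:
  assumes \<rho>: "\<rho> \<in> lifts n" and v: "v \<in> vertices n" and i: "i < d"
  shows "lift_act n \<rho> v (gpow i j) = (qact (fst v) (gpow i j), Hilbert_Choice.inv (\<rho> (qact (fst v) (gpow i j)) i) (\<rho> (fst v) i (snd v)))"
  using right_action_gen_pow[OF lift_act(1)[OF \<rho>] v i, of "lift_step \<rho> i" j]
    lift_act(2)[OF \<rho> i] lift_step_iter[OF \<rho> v i, of j] by simp

text \<open>The lift covers the base equivariantly, so windows that embed in the base embed in the
  lift.\<close>

lemma fst_lift_act:
  assumes \<rho>: "\<rho> \<in> lifts n" and v: "v \<in> vertices n" and g: "g \<in> carrier \<Gamma>"
  shows "fst (lift_act n \<rho> v g) = qact (fst v) g"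
proof -
  note A = right_actionD[OF lift_act(1)[OF \<rho>] v]
  have q: "fst v \<in> Q" using v by (auto simp: vertices_def)
  have "k > 0" using k_gt_1 by simp
  then show ?thesis using g
  proof (induction rule: Gam_induct)
    case one
    then show ?case using A(1) qactD(1)[OF q] by simp
  next
    case (step g i)
    have "lift_act n \<rho> v (g \<otimes>\<^bsub>\<Gamma>\<^esub> gen d k i) = lift_step \<rho> i (lift_act n \<rho> v g)"
      using A(3)[OF step(1) gen_closed[OF step(2)]] lift_act(2)[OF \<rho> step(2) A(2)[OF step(1)]] by simp
    then show ?case using step qactD(3)[OF q step(1) gen_closed[OF step(2)]] by (simp add: lift_step_def Let_def)
  qed
qed

definition check :: "nat \<Rightarrow> ('q \<Rightarrow> nat \<Rightarrow> nat \<Rightarrow> nat) \<Rightarrow> (nat \<times> 'q set) \<times> nat \<Rightarrow> ('q \<times> nat) set" where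
  "check n \<rho> c = {v \<in> vertices n. fst v \<in> snd (fst c) \<and> \<rho> (fst v) (fst (fst c)) (snd v) = snd c}"

text \<open>This identifies the labelled checks with the orbits of single generators in the lifted
  action, so that codewords satisfy the equations defining X along the action.\<close>

lemma check_eq_orbit:
  assumes \<rho>: "\<rho> \<in> lifts n" and v: "v \<in> vertices n" and i: "i < d"
  shows "(\<lambda>j. lift_act n \<rho> v (gpow i j)) ` {..<k} = check n \<rho> ((i, orb i (fst v)), \<rho> (fst v) i (snd v))"
proof -
  let ?m = "\<rho> (fst v) i (snd v)"
  have q: "fst v \<in> Q" using v by (auto simp: vertices_def)
  have inV: "lift_act n \<rho> v (gpow i j) \<in> vertices n" for j
    using right_actionD(2)[OF lift_act(1)[OF \<rho>] v gpow_closed[OF i]] .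
  have "range (\<lambda>j. lift_act n \<rho> v (gpow i j)) = check n \<rho> ((i, orb i (fst v)), ?m)"
  proof (intro equalityI subsetI)
    fix w assume "w \<in> range (\<lambda>j. lift_act n \<rho> v (gpow i j))"
    then obtain j where w: "w = lift_act n \<rho> v (gpow i j)" by blast
    have "qact (fst v) (gpow i j) \<in> Q" using qactD(2)[OF q gpow_closed[OF i]] .
    then have "\<rho> (fst w) i (snd w) = ?m" unfolding w lift_act_gpow[OF \<rho> v i]
      using permutes_inverses(1)[OF liftsD[OF \<rho> _ i]] by simp
    moreover have "fst w \<in> orb i (fst v)" unfolding w lift_act_gpow[OF \<rho> v i] by (auto simp: orb_def)
    ultimately show "w \<in> check n \<rho> ((i, orb i (fst v)), ?m)" using inV w by (auto simp: check_def)
  next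
    fix w assume w: "w \<in> check n \<rho> ((i, orb i (fst v)), ?m)"
    then obtain j where j: "fst w = qact (fst v) (gpow i j)" by (auto simp: check_def orb_def)
    have wQ: "fst w \<in> Q" using w by (auto simp: check_def vertices_def)
    have "snd w = Hilbert_Choice.inv (\<rho> (fst w) i) (\<rho> (fst w) i (snd w))"
      by (rule inv_f_f[symmetric]) (rule permutes_inj[OF liftsD[OF \<rho> wQ i]])
    then have "w = lift_act n \<rho> v (gpow i j)"
      unfolding lift_act_gpow[OF \<rho> v i] using w j by (auto simp: check_def prod_eq_iff)
    then show "w \<in> range (\<lambda>j. lift_act n \<rho> v (gpow i j))" by blast
  qed
  then show ?thesis by (simp only: range_gpow_act[OF i])
qed

lemma inj_on_lift_act_gpow:
  assumes \<rho>: "\<rho> \<in> lifts n" and v: "v \<in> vertices n" and i: "i < d"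
  shows "inj_on (\<lambda>j. lift_act n \<rho> v (gpow i j)) {..<k}"
proof (rule inj_on_gpow_act[OF lift_act(1)[OF \<rho>] v i])
  fix v j assume v: "v \<in> vertices n" and j: "0 < j" "j < k"
  have "fst (lift_act n \<rho> v (gpow i j)) \<noteq> fst v"
    unfolding fst_lift_act[OF \<rho> v gpow_closed[OF i]]
    using v i j by (intro qact_free) (auto simp: vertices_def)
  then show "lift_act n \<rho> v (gpow i j) \<noteq> v" by auto
qed

lemma sum_check:
  assumes \<rho>: "\<rho> \<in> lifts n" and v: "v \<in> vertices n" and i: "i < d"
  shows "sum x (check n \<rho> ((i, orb i (fst v)), \<rho> (fst v) i (snd v))) = (\<Sum>j<k. x (lift_act n \<rho> v (gpow i j)))"
  unfolding check_eq_orbit[OF assms, symmetric]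
  by (rule sum.reindex[OF inj_on_lift_act_gpow[OF assms], unfolded o_def])

definition checks :: "nat \<Rightarrow> ((nat \<times> 'q set) \<times> nat) set" where
  "checks n = orbits \<times> {..<n}"

lemma finite_checks: "finite (checks n)"
  using finite_orbits by (simp add: checks_def)

lemma finite_vertices: "finite (vertices n)"
  using finite_Q by (simp add: vertices_def)

lemma check_subset: "check n \<rho> c \<subseteq> vertices n"
  by (auto simp: check_def)

lemma check_vertex:
  assumes \<rho>: "\<rho> \<in> lifts n" and v: "v \<in> vertices n" and c: "c \<in> checks n"
  shows "v \<in> check n \<rho> c \<longleftrightarrow> (\<exists>i<d. c = ((i, orb i (fst v)), \<rho> (fst v) i (snd v)))"
proof
  assume vc: "v \<in> check n \<rho> c"
  obtain i O' m where c': "c = ((i, O'), m)" by (metis prod.collapse)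
  have i: "i < d" "O' \<in> orb i ` Q" using c by (auto simp: c' checks_def orbits_def)
  have "orb i (fst v) = O'" using vc i orb_eq by (auto simp: check_def c')
  then show "\<exists>i<d. c = ((i, orb i (fst v)), \<rho> (fst v) i (snd v))"
    using vc i c' by (auto simp: check_def)
next
  assume "\<exists>i<d. c = ((i, orb i (fst v)), \<rho> (fst v) i (snd v))"
  then show "v \<in> check n \<rho> c" using v orb_self by (auto simp: check_def vertices_def)
qed

lemma check_mem_checks:
  assumes \<rho>: "\<rho> \<in> lifts n" and v: "v \<in> vertices n" and i: "i < d"
  shows "((i, orb i (fst v)), \<rho> (fst v) i (snd v)) \<in> checks n"
  using v permutes_in_image[OF liftsD[OF \<rho> _ i]] orbits_I[OF i] by (auto simp: checks_def vertices_def)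

definition code :: "nat \<Rightarrow> ('q \<Rightarrow> nat \<Rightarrow> nat \<Rightarrow> nat) \<Rightarrow> ('q \<times> nat \<Rightarrow> bit) set" where
  "code n \<rho> = {x \<in> PiE (vertices n) (\<lambda>_. UNIV). \<forall>c\<in>checks n. sum x (check n \<rho> c) = 0}"

text \<open>A codeword read along an orbit map is a point of X. Consequently characters that are
  trivial on X are trivial on every window of a codeword.\<close>

lemma code_local_parity:
  assumes \<rho>: "\<rho> \<in> lifts n" and v: "v \<in> vertices n" and x: "x \<in> code n \<rho>"
  shows "(\<lambda>g\<in>carrier \<Gamma>. x (lift_act n \<rho> v g)) \<in> parity_set d k"
proof -
  have "(\<Sum>j<k. x (lift_act n \<rho> v (g \<otimes>\<^bsub>\<Gamma>\<^esub> gpow i j))) = 0" if g: "g \<in> carrier \<Gamma>" and i: "i < d" for g i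
  proof -
    have w: "lift_act n \<rho> v g \<in> vertices n" using right_actionD(2)[OF lift_act(1)[OF \<rho>] v g] .
    have "(\<Sum>j<k. x (lift_act n \<rho> v (g \<otimes>\<^bsub>\<Gamma>\<^esub> gpow i j))) = (\<Sum>j<k. x (lift_act n \<rho> (lift_act n \<rho> v g) (gpow i j)))"
      using right_actionD(3)[OF lift_act(1)[OF \<rho>] v g gpow_closed[OF i]] by simp
    also have "\<dots> = 0" unfolding sum_check[OF \<rho> w i, symmetric]
      using x check_mem_checks[OF \<rho> w i] by (simp add: code_def)
    finally show ?thesis .
  qed
  then show ?thesis by (simp add: parity_set_def gpow_closed)
qed

end

section \<open>Dual codewords of light lifts are local\<close>

context finite_gam_set
begin

lemma gam_nbhd_iter_gpow:
  assumes "g \<in> (gam_nbhd d k ^^ r) F" "i < d" "j < k"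
  shows "g \<otimes>\<^bsub>\<Gamma>\<^esub> gpow i j \<in> (gam_nbhd d k ^^ Suc r) F"
  using gam_nbhdI[OF assms] by simp

text \<open>The sets of checks of \<open>T\<close> meeting the \<open>r\<close>-th neighbourhood of \<open>v\<close> increase with \<open>r\<close>, hence
  two consecutive ones coincide; a configuration of \<open>X\<close> cut off outside the corresponding
  neighbourhood satisfies all checks of \<open>T\<close>.\<close>

lemma few_checks_imp_null:
  assumes \<rho>: "\<rho> \<in> lifts n" and v: "v \<in> vertices n" and F: "F \<subseteq> carrier \<Gamma>"
    and inj: "inj_on (lift_act n \<rho> v) ((gam_nbhd d k ^^ Suc K) F)"
    and T: "T \<subseteq> checks n" "card T \<le> K" and A: "A \<subseteq> F" and W: "W \<subseteq> vertices n"
    and WA: "W \<inter> lift_act n \<rho> v ` (gam_nbhd d k ^^ Suc K) F = lift_act n \<rho> v ` A"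
    and odd: "\<And>u. u \<in> vertices n \<Longrightarrow> u \<in> W \<longleftrightarrow> odd (card {c\<in>T. u \<in> check n \<rho> c})"
  shows "null_set_of d k A"
  unfolding null_set_of_def
proof
  fix a assume a: "a \<in> parity_set d k"
  let ?F = "\<lambda>r. (gam_nbhd d k ^^ r) F" and ?v = "lift_act n \<rho> v"
  have Fc: "?F r \<subseteq> carrier \<Gamma>" for r
    by (induction r) (use F gam_nbhd_closed in auto)
  have finT: "finite T" using T(1) finite_checks finite_subset by blast
  define D where "D r = {c\<in>T. check n \<rho> c \<inter> ?v ` ?F r \<noteq> {}}" for r
  have finD: "finite (D r)" for r using finT by (simp add: D_def)
  have mono: "D r \<subseteq> D (Suc r)" for r
  proof -
    have "?v ` ?F r \<subseteq> ?v ` ?F (Suc r)" by (intro image_mono gam_nbhd_iter_mono) simp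
    moreover have "{c\<in>T. check n \<rho> c \<inter> B \<noteq> {}} \<subseteq> {c\<in>T. check n \<rho> c \<inter> B' \<noteq> {}}" if "B \<subseteq> B'" for B B'
      using that by blast
    ultimately show ?thesis unfolding D_def by (simp only:)
  qed
  have "\<exists>r\<le>K. D r = D (Suc r)"
  proof (rule ccontr)
    assume "\<not> ?thesis"
    then have strict: "D r \<subset> D (Suc r)" if "r \<le> K" for r using mono that by blast
    have "r \<le> card (D r)" if "r \<le> Suc K" for r
      using that
    proof (induction r)
      case (Suc r)
      have "card (D r) < card (D (Suc r))" using strict[of r] Suc.prems finD by (intro psubset_card_mono) auto
      then show ?case using Suc by simp
    qed simp
    then have "Suc K \<le> card (D (Suc K))" by simp
    also have "\<dots> \<le> card T" using finT by (intro card_mono) (auto simp: D_def)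
    finally show False using T(2) by simp
  qed
  then obtain r where r: "r \<le> K" "D r = D (Suc r)" by blast
  let ?S = "?v ` ?F (Suc r)"
  define b where "b u = (if u \<in> ?S then a (the_inv_into (?F (Suc r)) ?v u) else 0)" for u
  have injr: "inj_on ?v (?F (Suc r))"
    by (rule inj_on_subset[OF inj gam_nbhd_iter_mono]) (use r in simp)
  have b: "b (?v g) = a g" if "g \<in> ?F (Suc r)" for g
    using the_inv_into_f_f[OF injr that] that by (simp add: b_def)
  have check0: "sum b (check n \<rho> c) = 0" if c: "c \<in> T" for c
  proof (cases "c \<in> D r")
    case True
    then obtain g where g: "g \<in> ?F r" "?v g \<in> check n \<rho> c" by (auto simp: D_def)
    have gc: "g \<in> carrier \<Gamma>" using g(1) Fc by blast
    have w: "?v g \<in> vertices n" using right_actionD(2)[OF lift_act(1)[OF \<rho>] v gc] .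
    obtain i where i: "i < d" "c = ((i, orb i (fst (?v g))), \<rho> (fst (?v g)) i (snd (?v g)))"
      using check_vertex[OF \<rho> w] g(2) c T(1) by blast
    have "sum b (check n \<rho> c) = (\<Sum>j<k. b (lift_act n \<rho> (?v g) (gpow i j)))"
      unfolding i(2) by (rule sum_check[OF \<rho> w i(1)])
    also have "\<dots> = (\<Sum>j<k. a (g \<otimes>\<^bsub>\<Gamma>\<^esub> gpow i j))"
    proof (rule sum.cong)
      fix j assume j: "j \<in> {..<k}"
      have "lift_act n \<rho> (?v g) (gpow i j) = ?v (g \<otimes>\<^bsub>\<Gamma>\<^esub> gpow i j)"
        using right_actionD(3)[OF lift_act(1)[OF \<rho>] v gc gpow_closed[OF i(1)]] by simp
      then show "b (lift_act n \<rho> (?v g) (gpow i j)) = a (g \<otimes>\<^bsub>\<Gamma>\<^esub> gpow i j)"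
        using b[OF gam_nbhd_iter_gpow[OF g(1) i(1)]] j by simp
    qed simp
    also have "\<dots> = 0" using a gc i(1) by (simp add: parity_set_def)
    finally show ?thesis .
  next
    case False
    \<comment> \<open>The equality of the two consecutive sets of checks enters here: a check that
      misses the smaller neighbourhood misses the whole support of \<open>b\<close>.\<close>
    then have "check n \<rho> c \<inter> ?S = {}" using c unfolding r(2) by (simp add: D_def)
    then show ?thesis by (intro sum.neutral) (auto simp: b_def)
  qed
  have finW: "finite W" using W finite_vertices finite_subset by blast
  have "sum a A = sum b (?v ` A)"
  proof -
    have AF: "A \<subseteq> ?F (Suc r)" using A gam_nbhd_iter_mono[of 0 "Suc r" d k F] by auto
    have "sum b (?v ` A) = (\<Sum>g\<in>A. b (?v g))"
      by (rule sum.reindex[OF inj_on_subset[OF injr AF], unfolded o_def])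
    also have "\<dots> = sum a A" by (rule sum.cong) (use b AF in auto)
    finally show ?thesis by simp
  qed
  also have "\<dots> = sum b W"
  proof (rule sum.mono_neutral_left[OF finW])
    show "?v ` A \<subseteq> W" using WA by blast
    have "?S \<subseteq> ?v ` ?F (Suc K)" using r by (intro image_mono gam_nbhd_iter_mono) simp
    then show "\<forall>u\<in>W - ?v ` A. b u = 0" using WA by (auto simp: b_def)
  qed
  \<comment> \<open>\<open>W\<close> is the sum modulo 2 of the checks in \<open>T\<close>, so
    summing \<open>b\<close> over \<open>W\<close> means summing \<open>b\<close> over each of these
    checks.\<close>
  also have "\<dots> = (\<Sum>u\<in>vertices n. if u \<in> W then b u else 0)"
    using W finite_vertices by (simp add: sum.If_cases Int_absorb1)
  also have "\<dots> = (\<Sum>u\<in>vertices n. \<Sum>c\<in>T. if u \<in> check n \<rho> c then b u else 0)"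
  proof (rule sum.cong)
    fix u assume u: "u \<in> vertices n"
    have "(\<Sum>c\<in>T. if u \<in> check n \<rho> c then b u else 0) = of_nat (card {c\<in>T. u \<in> check n \<rho> c}) * b u"
      using finT by (simp add: sum.If_cases Int_def)
    also have "\<dots> = (if u \<in> W then b u else 0)" using odd[OF u] by (simp add: of_nat_bit)
    finally show "(if u \<in> W then b u else 0) = (\<Sum>c\<in>T. if u \<in> check n \<rho> c then b u else 0)" by simp
  qed simp
  also have "\<dots> = (\<Sum>c\<in>T. \<Sum>u\<in>vertices n. if u \<in> check n \<rho> c then b u else 0)" by (rule sum.swap)
  also have "\<dots> = (\<Sum>c\<in>T. sum b (check n \<rho> c))"
  proof (rule sum.cong)
    fix c
    have "vertices n \<inter> {u. u \<in> check n \<rho> c} = check n \<rho> c" using check_subset[of n \<rho> c] by blast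
    then show "(\<Sum>u\<in>vertices n. if u \<in> check n \<rho> c then b u else 0) = sum b (check n \<rho> c)"
      by (simp add: sum.If_cases[OF finite_vertices])
  qed simp
  also have "\<dots> = 0" using check0 by (simp add: sum.neutral)
  finally show "sum a A = 0" .
qed

text \<open>The complement of the event bounded in \<open>few_lifts_with_heavy_checks\<close>.
  Binomials are symmetric, so a light family may still contain almost all checks of a class.\<close>

definition light_lift :: "nat \<Rightarrow> nat \<Rightarrow> nat \<Rightarrow> ('q \<Rightarrow> nat \<Rightarrow> nat \<Rightarrow> nat) \<Rightarrow> bool" where
  "light_lift n K N \<rho> \<longleftrightarrow> (\<forall>T\<in>PiE orbits (\<lambda>_. Pow {..<n}).
     card (check_sum n \<rho> T) \<le> N \<longrightarrow> (\<Prod>c\<in>orbits. n choose card (T c)) \<le> n ^ K)"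

definition check_family :: "(nat \<times> 'q set \<Rightarrow> nat set) \<Rightarrow> ((nat \<times> 'q set) \<times> nat) set" where
  "check_family T = (SIGMA c:orbits. T c)"

lemma card_checks_at_vertex:
  assumes \<rho>: "\<rho> \<in> lifts n" and u: "u \<in> vertices n" and T: "\<And>c. c \<in> orbits \<Longrightarrow> T c \<subseteq> {..<n}"
  shows "card {c\<in>check_family T. u \<in> check n \<rho> c} = card {i\<in>{..<d}. \<rho> (fst u) i (snd u) \<in> T (i, orb i (fst u))}"
proof -
  have q: "fst u \<in> Q" using u by (auto simp: vertices_def)
  have sub: "check_family T \<subseteq> checks n" using T by (auto simp: check_family_def checks_def)
  have "{c\<in>check_family T. u \<in> check n \<rho> c}
    = (\<lambda>i. ((i, orb i (fst u)), \<rho> (fst u) i (snd u))) ` {i\<in>{..<d}. \<rho> (fst u) i (snd u) \<in> T (i, orb i (fst u))}"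
  proof (intro equalityI subsetI)
    fix c assume c: "c \<in> {c\<in>check_family T. u \<in> check n \<rho> c}"
    then obtain i where "i < d" "c = ((i, orb i (fst u)), \<rho> (fst u) i (snd u))"
      using check_vertex[OF \<rho> u] sub by blast
    then show "c \<in> (\<lambda>i. ((i, orb i (fst u)), \<rho> (fst u) i (snd u))) ` {i\<in>{..<d}. \<rho> (fst u) i (snd u) \<in> T (i, orb i (fst u))}"
      using c by (auto simp: check_family_def)
  next
    fix c assume "c \<in> (\<lambda>i. ((i, orb i (fst u)), \<rho> (fst u) i (snd u))) ` {i\<in>{..<d}. \<rho> (fst u) i (snd u) \<in> T (i, orb i (fst u))}"
    then show "c \<in> {c\<in>check_family T. u \<in> check n \<rho> c}"
      using check_vertex[OF \<rho> u check_mem_checks[OF \<rho> u]] orbits_I[OF _ q] by (auto simp: check_family_def)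
  qed
  then show ?thesis by (simp add: card_image inj_on_def)
qed

text \<open>Replacing a set of checks filling more than half of an orbit by its complement changes the
  sum by a constant on each fibre; on no fibre can this constant be nonzero, since both sums have
  small support.\<close>

lemma light_lift_few_checks:
  assumes \<rho>: "\<rho> \<in> lifts n" and light: "light_lift n K N \<rho>"
    and n: "real K * log 2 n \<le> sqrt n" "n > 2 * K + N" "n > 1"
    and T: "T \<subseteq> checks n" and W: "W \<subseteq> vertices n" "card W \<le> N"
    and odd: "\<And>u. u \<in> vertices n \<Longrightarrow> u \<in> W \<longleftrightarrow> odd (card {c\<in>T. u \<in> check n \<rho> c})"
  shows "\<exists>T'\<subseteq>checks n. card T' \<le> 2 * K \<and>
    (\<forall>u\<in>vertices n. u \<in> W \<longleftrightarrow> odd (card {c\<in>T'. u \<in> check n \<rho> c}))"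
proof -
  define t where "t = (\<lambda>c\<in>orbits. {m. (c, m) \<in> T})"
  have tP: "t \<in> PiE orbits (\<lambda>_. Pow {..<n})" using T by (auto simp: t_def checks_def)
  then have tsub: "t c \<subseteq> {..<n}" if "c \<in> orbits" for c using that by auto
  have T_eq: "T = check_family t" using T by (auto simp: t_def check_family_def checks_def)
  have finW: "finite W" using W finite_vertices finite_subset by blast
  have W_eq: "check_sum n \<rho> t = W"
    using W(1) odd card_checks_at_vertex[OF \<rho> _ tsub]
    by (auto simp: check_sum_def vertices_def T_eq)
  have prod: "(\<Prod>c\<in>orbits. n choose card (t c)) \<le> n ^ K"
    using light tP W(2) unfolding light_lift_def W_eq[symmetric] by blast
  have tcard: "card (t c) \<le> n" if "c \<in> orbits" for c using card_mono[OF _ tsub[OF that]] by simp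
  have min: "(\<Sum>c\<in>orbits. min (card (t c)) (n - card (t c))) \<le> 2 * K"
    by (rule sum_min_card_le[OF finite_orbits tcard prod n(1,3)])
  define flip where "flip c \<longleftrightarrow> n < 2 * card (t c)" for c
  define t' where "t' c = (if flip c then {..<n} - t c else t c)" for c
  have t'sub: "t' c \<subseteq> {..<n}" if "c \<in> orbits" for c using tsub[OF that] by (auto simp: t'_def)
  have t'card: "card (t' c) = min (card (t c)) (n - card (t c))" if "c \<in> orbits" for c
    using tsub[OF that] finite_subset[OF tsub[OF that]] by (auto simp: t'_def flip_def card_Diff_subset)
  define T' where "T' = check_family t'"
  have "card T' = (\<Sum>c\<in>orbits. card (t' c))"
    unfolding T'_def check_family_def using finite_orbits finite_subset[OF t'sub] by (subst card_SigmaI) auto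
  then have T'card: "card T' \<le> 2 * K" using min t'card by simp
  have T'sub: "T' \<subseteq> checks n" using t'sub by (auto simp: T'_def check_family_def checks_def)
  have finT': "finite T'" using T'sub finite_checks finite_subset by blast
  let ?fl = "\<lambda>q. card {i\<in>{..<d}. flip (i, orb i q)}"
  have parity: "odd (card {c\<in>T'. u \<in> check n \<rho> c}) \<longleftrightarrow> (u \<in> W) \<noteq> odd (?fl (fst u))"
    if u: "u \<in> vertices n" for u
  proof -
    let ?q = "fst u" and ?r = "\<lambda>i. \<rho> (fst u) i (snd u)"
    have q: "?q \<in> Q" "snd u < n" using u by (auto simp: vertices_def)
    have "?r i < n" if "i < d" for i using permutes_in_image[OF liftsD[OF \<rho> q(1) that]] q(2) by auto
    then have "{i\<in>{..<d}. ?r i \<in> t' (i, orb i ?q)} =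
      sym_diff {i\<in>{..<d}. ?r i \<in> t (i, orb i ?q)} {i\<in>{..<d}. flip (i, orb i ?q)}"
      by (auto simp: t'_def)
    moreover have "odd (card (sym_diff A B)) \<longleftrightarrow> odd (card A) \<noteq> odd (card B)" if "finite A" "finite B" for A B :: "nat set"
    proof -
      have "sum (\<lambda>_. 1 :: bit) (sym_diff A B) = sum (\<lambda>_. 1) A + sum (\<lambda>_. 1) B"
        by (rule sum_bit_sym_diff[OF that])
      then show ?thesis by (cases "odd (card A)"; cases "odd (card B)"; auto simp: of_nat_bit)
    qed
    ultimately have "odd (card {i\<in>{..<d}. ?r i \<in> t' (i, orb i ?q)}) \<longleftrightarrow>
       odd (card {i\<in>{..<d}. ?r i \<in> t (i, orb i ?q)}) \<noteq> odd (?fl ?q)" by simp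
    then show ?thesis
      using odd[OF u] card_checks_at_vertex[OF \<rho> u tsub] card_checks_at_vertex[OF \<rho> u t'sub]
      by (simp add: T'_def T_eq)
  qed
  have "even (?fl q)" if q: "q \<in> Q" for q
  proof (rule ccontr)
    assume fl: "odd (?fl q)"
    \<comment> \<open>A check meets a fibre in at most one vertex. If the constant were odd,
      \<open>W\<close> and the at most 2 K checks would cover all n vertices of the fibre,
      contradicting n > 2 K + N.\<close>
    have "{q} \<times> {..<n} \<subseteq> W \<union> (\<Union>c\<in>T'. check n \<rho> c \<inter> {q} \<times> {..<n})"
    proof
      fix u assume u: "u \<in> {q} \<times> {..<n}"
      then have uV: "u \<in> vertices n" "fst u = q" using q by (auto simp: vertices_def)
      show "u \<in> W \<union> (\<Union>c\<in>T'. check n \<rho> c \<inter> {q} \<times> {..<n})"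
      proof (cases "u \<in> W")
        case False
        then have "odd (card {c\<in>T'. u \<in> check n \<rho> c})" using parity[OF uV(1)] fl uV(2) by simp
        then have "{c\<in>T'. u \<in> check n \<rho> c} \<noteq> {}" by (metis card.empty even_zero)
        then show ?thesis using u by blast
      qed simp
    qed
    then have "card ({q} \<times> {..<n}) \<le> card (W \<union> (\<Union>c\<in>T'. check n \<rho> c \<inter> {q} \<times> {..<n}))"
      using finW finT' by (intro card_mono) auto
    also have "\<dots> \<le> card W + (\<Sum>c\<in>T'. card (check n \<rho> c \<inter> {q} \<times> {..<n}))"
      by (rule order_trans[OF card_Un_le add_left_mono[OF card_UN_le[OF finT']]])
    also have "\<dots> \<le> N + (\<Sum>c\<in>T'. 1)"
    proof (intro add_mono W(2) sum_mono)
      fix c assume c: "c \<in> T'"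
      obtain i O' m where c': "c = ((i, O'), m)" by (metis prod.collapse)
      have i: "i < d" using c T'sub by (auto simp: c' checks_def orbits_def)
      have "u = u'" if "u \<in> check n \<rho> c \<inter> {q} \<times> {..<n}" "u' \<in> check n \<rho> c \<inter> {q} \<times> {..<n}" for u u'
      proof -
        have "fst u = q" "fst u' = q" using that by auto
        moreover have "\<rho> (fst u) i (snd u) = m" "\<rho> (fst u') i (snd u') = m"
          using that by (simp_all add: check_def c')
        ultimately show ?thesis
          using injD[OF permutes_inj[OF liftsD[OF \<rho> q i]], of "snd u" "snd u'"] by (simp add: prod_eq_iff)
      qed
      then show "card (check n \<rho> c \<inter> {q} \<times> {..<n}) \<le> 1"
        by (subst card_le_Suc0_iff_eq[unfolded One_nat_def[symmetric]]) auto
    qed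
    also have "\<dots> \<le> N + 2 * K" using T'card by simp
    finally show False using n(2) by simp
  qed
  then have "u \<in> W \<longleftrightarrow> odd (card {c\<in>T'. u \<in> check n \<rho> c})" if "u \<in> vertices n" for u
    using parity[OF that] that by (auto simp: vertices_def)
  then show ?thesis using T'sub T'card by blast
qed

text \<open>By duality a character that is trivial on the code is a sum of checks, and on a light
  lift at most 2 K of them suffice. This number fixes the radius of the neighbourhoods; as these are
  disjoint, \<open>few_checks_imp_null\<close> applies at each vertex separately.\<close>

lemma code_pair_null:
  assumes \<rho>: "\<rho> \<in> lifts n" and light: "light_lift n K N \<rho>"
    and n: "real K * log 2 n \<le> sqrt n" "n > 2 * K + N" "n > 1"
    and F: "F \<subseteq> carrier \<Gamma>" "finite F" "2 * card F \<le> N"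
    and v: "v \<in> vertices n" "v' \<in> vertices n"
    and inj: "inj_on (lift_act n \<rho> v) ((gam_nbhd d k ^^ Suc (2 * K)) F)"
      "inj_on (lift_act n \<rho> v') ((gam_nbhd d k ^^ Suc (2 * K)) F)"
    and disj: "lift_act n \<rho> v ` (gam_nbhd d k ^^ Suc (2 * K)) F \<inter> lift_act n \<rho> v' ` (gam_nbhd d k ^^ Suc (2 * K)) F = {}"
    and A: "A \<subseteq> F" "A' \<subseteq> F"
    and zero: "\<And>x. x \<in> code n \<rho> \<Longrightarrow> (\<Sum>g\<in>A. x (lift_act n \<rho> v g)) + (\<Sum>g\<in>A'. x (lift_act n \<rho> v' g)) = 0"
  shows "null_set_of d k A \<and> null_set_of d k A'"
proof -
  let ?F = "(gam_nbhd d k ^^ Suc (2 * K)) F" and ?v = "lift_act n \<rho> v" and ?v' = "lift_act n \<rho> v'"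
  have FF: "F \<subseteq> ?F" using gam_nbhd_iter_mono[of 0 "Suc (2 * K)" d k F] by simp
  have AF: "A \<subseteq> ?F" "A' \<subseteq> ?F" using A FF by auto
  have finA: "finite A" "finite A'" using A F(2) finite_subset by auto
  let ?W = "?v ` A \<union> ?v' ` A'"
  have W: "?W \<subseteq> vertices n"
    using right_actionD(2)[OF lift_act(1)[OF \<rho>] v(1)] right_actionD(2)[OF lift_act(1)[OF \<rho>] v(2)] A F(1) by blast
  have dj: "?v ` A \<inter> ?v' ` A' = {}" using disj AF by blast
  have sumW: "sum x ?W = (\<Sum>g\<in>A. x (?v g)) + (\<Sum>g\<in>A'. x (?v' g))" for x :: "'q \<times> nat \<Rightarrow> bit"
    using dj finA inj_on_subset[OF inj(1) AF(1)] inj_on_subset[OF inj(2) AF(2)]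
    by (simp add: sum.union_disjoint sum.reindex)
  have "\<exists>T\<subseteq>checks n. \<forall>u. u \<in> ?W \<longleftrightarrow> odd (card {c\<in>T. u \<in> check n \<rho> c})"
  proof (rule parity_check_duality[OF finite_checks finite_vertices check_subset W])
    fix x :: "'q \<times> nat \<Rightarrow> bit" assume x: "\<And>c. c \<in> checks n \<Longrightarrow> sum x (check n \<rho> c) = 0"
    have "sum (restrict x (vertices n)) (check n \<rho> c) = sum x (check n \<rho> c)" for c
      using check_subset[of n \<rho> c] by (intro sum.cong) auto
    then have "restrict x (vertices n) \<in> code n \<rho>" using x by (simp add: code_def)
    then have "sum (restrict x (vertices n)) ?W = 0" unfolding sumW by (rule zero)
    also have "sum (restrict x (vertices n)) ?W = sum x ?W" using W by (intro sum.cong) auto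
    finally show "sum x ?W = 0" .
  qed
  then obtain T where T: "T \<subseteq> checks n" "\<And>u. u \<in> ?W \<longleftrightarrow> odd (card {c\<in>T. u \<in> check n \<rho> c})" by blast
  have "card ?W \<le> card (?v ` A) + card (?v' ` A')" by (rule card_Un_le)
  also have "\<dots> \<le> card F + card F"
    using card_image_le[OF finA(1), of ?v] card_image_le[OF finA(2), of ?v'] card_mono[OF F(2) A(1)] card_mono[OF F(2) A(2)] by simp
  finally have "card ?W \<le> N" using F(3) by simp
  from light_lift_few_checks[OF \<rho> light n T(1) W this T(2)]
  obtain T' where T': "T' \<subseteq> checks n" "card T' \<le> 2 * K"
    "\<And>u. u \<in> vertices n \<Longrightarrow> u \<in> ?W \<longleftrightarrow> odd (card {c\<in>T'. u \<in> check n \<rho> c})" by blast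
  have "?W \<inter> ?v ` ?F = ?v ` A" using disj AF by blast
  moreover have "?W \<inter> ?v' ` ?F = ?v' ` A'" using disj AF by blast
  ultimately show ?thesis
    using few_checks_imp_null[OF \<rho> v(1) F(1) inj(1) T'(1,2) A(1) W _ T'(3)]
      few_checks_imp_null[OF \<rho> v(2) F(1) inj(2) T'(1,2) A(2) W _ T'(3)] by blast
qed

end

section \<open>Fourier analysis on the code and the joint law of two views\<close>

context finite_gam_set
begin

lemma finite_code: "finite (code n \<rho>)"
  by (rule finite_subset[of _ "PiE (vertices n) (\<lambda>_. UNIV)"])
    (auto simp: code_def intro!: finite_PiE finite_vertices finite_UNIV_bit)

lemma zero_in_code: "(\<lambda>v\<in>vertices n. 0) \<in> code n \<rho>"
proof -
  have "sum (\<lambda>v\<in>vertices n. 0 :: bit) (check n \<rho> c) = 0" for c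
    using check_subset[of n \<rho> c] by (intro sum.neutral) auto
  then show ?thesis by (simp add: code_def)
qed

definition code_add :: "nat \<Rightarrow> ('q \<times> nat \<Rightarrow> bit) \<Rightarrow> ('q \<times> nat \<Rightarrow> bit) \<Rightarrow> 'q \<times> nat \<Rightarrow> bit" where
  "code_add n x y = (\<lambda>v\<in>vertices n. x v + y v)"

lemma sum_code_add:
  assumes "\<And>a. a \<in> A \<Longrightarrow> f a \<in> vertices n"
  shows "(\<Sum>a\<in>A. code_add n x y (f a)) = (\<Sum>a\<in>A. x (f a)) + (\<Sum>a\<in>A. y (f a))"
  using assms by (simp add: code_add_def sum.distrib)

lemma code_add_code: "x \<in> code n \<rho> \<Longrightarrow> y \<in> code n \<rho> \<Longrightarrow> code_add n x y \<in> code n \<rho>"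
proof -
  assume xy: "x \<in> code n \<rho>" "y \<in> code n \<rho>"
  have "sum (code_add n x y) (check n \<rho> c) = sum x (check n \<rho> c) + sum y (check n \<rho> c)" for c
    using sum_code_add[of "check n \<rho> c" id n x y] check_subset[of n \<rho> c] by auto
  then show ?thesis using xy by (simp add: code_def code_add_def)
qed

lemma code_add_cancel: "x \<in> code n \<rho> \<Longrightarrow> code_add n (code_add n x y) y = x"
proof
  fix v assume x: "x \<in> code n \<rho>"
  have "x v + y v + y v = x v" by (simp add: add.assoc)
  moreover have "x v = undefined" if "v \<notin> vertices n" using x that unfolding code_def by (blast intro: PiE_arb)
  ultimately show "code_add n (code_add n x y) y v = x v" by (auto simp: code_add_def)
qed

text \<open>Orthogonality of characters: translating by a codeword on which the functional is 1
  reverses the sign of the sum.\<close>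

lemma code_character_sum:
  assumes "\<And>a. a \<in> A \<Longrightarrow> f a \<in> vertices n" "\<And>a. a \<in> A' \<Longrightarrow> f' a \<in> vertices n"
  shows "(\<Sum>x\<in>code n \<rho>. bit_sgn (\<Sum>a\<in>A. x (f a)) * bit_sgn (\<Sum>a\<in>A'. x (f' a)))
    = card (code n \<rho>) * of_bool (\<forall>x\<in>code n \<rho>. (\<Sum>a\<in>A. x (f a)) + (\<Sum>a\<in>A'. x (f' a)) = 0)"
proof -
  let ?l = "\<lambda>x. (\<Sum>a\<in>A. x (f a)) + (\<Sum>a\<in>A'. x (f' a))"
  have eq: "(\<Sum>x\<in>code n \<rho>. bit_sgn (\<Sum>a\<in>A. x (f a)) * bit_sgn (\<Sum>a\<in>A'. x (f' a))) = (\<Sum>x\<in>code n \<rho>. bit_sgn (?l x))"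
    by (simp add: bit_sgn_add)
  show ?thesis
  proof (cases "\<forall>x\<in>code n \<rho>. ?l x = 0")
    case True
    then show ?thesis unfolding eq by simp
  next
    case False
    then obtain x0 where x0: "x0 \<in> code n \<rho>" "?l x0 = 1" by auto
    have ladd: "?l (code_add n x y) = ?l x + ?l y" for x y
      by (simp add: sum_code_add assms add_ac)
    have "(\<Sum>x\<in>code n \<rho>. bit_sgn (?l x)) = (\<Sum>x\<in>code n \<rho>. bit_sgn (?l (code_add n x x0)))"
      by (rule sum.reindex_bij_witness[of _ "\<lambda>x. code_add n x x0" "\<lambda>x. code_add n x x0"])
        (use x0 code_add_code code_add_cancel in auto)
    also have "\<dots> = (\<Sum>x\<in>code n \<rho>. - bit_sgn (?l x))"
      unfolding ladd x0(2) bit_sgn_add[of _ 1] by simp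
    finally have "(\<Sum>x\<in>code n \<rho>. bit_sgn (?l x)) = 0" by (simp add: sum_negf)
    then show ?thesis unfolding eq using False by simp
  qed
qed

text \<open>Phrased through characters: those supported on the two windows and trivial on the code
  are already trivial on X at each window. Fourier inversion turns this into independence of the two
  views.\<close>

definition independent_pair :: "nat \<Rightarrow> ('q \<Rightarrow> nat \<Rightarrow> nat \<Rightarrow> nat) \<Rightarrow> gword set set \<Rightarrow> 'q \<times> nat \<Rightarrow> 'q \<times> nat \<Rightarrow> bool" where
  "independent_pair n \<rho> F v v' \<longleftrightarrow> (\<forall>A\<subseteq>F. \<forall>A'\<subseteq>F.
     (\<forall>x\<in>code n \<rho>. (\<Sum>g\<in>A. x (lift_act n \<rho> v g)) + (\<Sum>g\<in>A'. x (lift_act n \<rho> v' g)) = 0)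
      \<longrightarrow> null_set_of d k A \<and> null_set_of d k A')"

lemma null_imp_code_sum_0:
  assumes \<rho>: "\<rho> \<in> lifts n" and v: "v \<in> vertices n" and A: "A \<subseteq> carrier \<Gamma>" "null_set_of d k A" and x: "x \<in> code n \<rho>"
  shows "(\<Sum>g\<in>A. x (lift_act n \<rho> v g)) = 0"
proof -
  have "sum (\<lambda>g\<in>carrier \<Gamma>. x (lift_act n \<rho> v g)) A = 0"
    using A(2) code_local_parity[OF \<rho> v x] unfolding null_set_of_def by blast
  moreover have "sum (\<lambda>g\<in>carrier \<Gamma>. x (lift_act n \<rho> v g)) A = (\<Sum>g\<in>A. x (lift_act n \<rho> v g))"
    using A(1) by (intro sum.cong) auto
  ultimately show ?thesis by simp
qed

context
  fixes n \<rho> F v v'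
  assumes \<rho>: "\<rho> \<in> lifts n" and F: "F \<subseteq> carrier \<Gamma>" "finite F"
    and v: "v \<in> vertices n" "v' \<in> vertices n" and ind: "independent_pair n \<rho> F v v'"
begin

lemma code_pair_character_sum:
  assumes A: "A \<subseteq> F" "A' \<subseteq> F"
  shows "(\<Sum>x\<in>code n \<rho>. bit_sgn (\<Sum>g\<in>A. x (lift_act n \<rho> v g)) * bit_sgn (\<Sum>g\<in>A'. x (lift_act n \<rho> v' g)))
    = card (code n \<rho>) * of_bool (null_set_of d k A) * of_bool (null_set_of d k A')"
proof -
  have inV: "lift_act n \<rho> v g \<in> vertices n" "lift_act n \<rho> v' g \<in> vertices n" if "g \<in> F" for g
    using right_actionD(2)[OF lift_act(1)[OF \<rho>]] v F(1) that by blast+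
  have "(\<forall>x\<in>code n \<rho>. (\<Sum>g\<in>A. x (lift_act n \<rho> v g)) + (\<Sum>g\<in>A'. x (lift_act n \<rho> v' g)) = 0)
     \<longleftrightarrow> null_set_of d k A \<and> null_set_of d k A'"
  proof
    assume "null_set_of d k A \<and> null_set_of d k A'"
    then show "\<forall>x\<in>code n \<rho>. (\<Sum>g\<in>A. x (lift_act n \<rho> v g)) + (\<Sum>g\<in>A'. x (lift_act n \<rho> v' g)) = 0"
      using null_imp_code_sum_0[OF \<rho> v(1), of A] null_imp_code_sum_0[OF \<rho> v(2), of A'] A F(1) by simp
  qed (use ind A in \<open>unfold independent_pair_def, blast\<close>)
  then show ?thesis
    using code_character_sum[of A "lift_act n \<rho> v" n A' "lift_act n \<rho> v'" \<rho>] inV A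
    by (auto simp: subset_iff)
qed

text \<open>After Fourier expansion only pairs of null characters survive, and the sum factors. For
  a uniform codeword the two views are thus distributed like windows of two independent Haar
  points.\<close>

lemma card_code_pair_pattern:
  "(\<Sum>x\<in>code n \<rho>. of_bool (\<forall>g\<in>F. x (lift_act n \<rho> v g) = p g) * of_bool (\<forall>g\<in>F. x (lift_act n \<rho> v' g) = p' g))
    = card (code n \<rho>) * (pattern_prob d k F p * pattern_prob d k F p')"
proof -
  let ?a = "\<lambda>x A. bit_sgn (\<Sum>g\<in>A. x (lift_act n \<rho> v g))" and ?b = "\<lambda>x A. bit_sgn (\<Sum>g\<in>A. x (lift_act n \<rho> v' g))"
  have "(\<Sum>x\<in>code n \<rho>. of_bool (\<forall>g\<in>F. x (lift_act n \<rho> v g) = p g) * of_bool (\<forall>g\<in>F. x (lift_act n \<rho> v' g) = p' g))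
    = (\<Sum>x\<in>code n \<rho>. (\<Sum>A\<in>Pow F. \<Sum>A'\<in>Pow F. (?a x A * bit_sgn (sum p A)) * (?b x A' * bit_sgn (sum p' A'))) / (2 ^ card F * 2 ^ card F))"
    by (simp only: pattern_indicator[OF F(2)] sum_product times_divide_times_eq)
  also have "\<dots> = (\<Sum>A\<in>Pow F. \<Sum>A'\<in>Pow F. \<Sum>x\<in>code n \<rho>. (?a x A * bit_sgn (sum p A)) * (?b x A' * bit_sgn (sum p' A'))) / (2 ^ card F * 2 ^ card F)"
    unfolding sum_divide_distrib[symmetric]
    by (rule arg_cong2[where f = "(/)", OF trans[OF sum.swap sum.cong[OF refl sum.swap]] refl])
  also have "\<dots> = (\<Sum>A\<in>Pow F. \<Sum>A'\<in>Pow F. card (code n \<rho>) * ((of_bool (null_set_of d k A) * bit_sgn (sum p A)) * (of_bool (null_set_of d k A') * bit_sgn (sum p' A')))) / (2 ^ card F * 2 ^ card F)"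
  proof -
    have "(\<Sum>x\<in>code n \<rho>. (?a x A * bit_sgn (sum p A)) * (?b x A' * bit_sgn (sum p' A')))
      = card (code n \<rho>) * ((of_bool (null_set_of d k A) * bit_sgn (sum p A)) * (of_bool (null_set_of d k A') * bit_sgn (sum p' A')))"
      if A: "A \<in> Pow F" "A' \<in> Pow F" for A A'
    proof -
      have "(\<Sum>x\<in>code n \<rho>. (?a x A * bit_sgn (sum p A)) * (?b x A' * bit_sgn (sum p' A')))
        = (\<Sum>x\<in>code n \<rho>. ?a x A * ?b x A') * (bit_sgn (sum p A) * bit_sgn (sum p' A'))"
        unfolding sum_distrib_right by (intro sum.cong) (auto simp: mult_ac)
      then show ?thesis using code_pair_character_sum[of A A'] A by (simp add: mult_ac)
    qed
    then show ?thesis by simp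
  qed
  also have "\<dots> = card (code n \<rho>) * (pattern_prob d k F p * pattern_prob d k F p')"
    unfolding pattern_prob_def times_divide_times_eq sum_product by (simp add: sum_distrib_left)
  finally show ?thesis .
qed

end


definition view :: "nat \<Rightarrow> ('q \<Rightarrow> nat \<Rightarrow> nat \<Rightarrow> nat) \<Rightarrow> gword set set \<Rightarrow> 'q \<times> nat \<Rightarrow> ('q \<times> nat \<Rightarrow> bit) \<Rightarrow> gword set \<Rightarrow> bit" where
  "view n \<rho> F v x = (\<lambda>g\<in>F. x (lift_act n \<rho> v g))"

definition view3 where
  "view3 n \<rho> F v X = (view n \<rho> F v (fst X), view n \<rho> F v (fst (snd X)), view n \<rho> F v (snd (snd X)))"

definition code3 where "code3 n \<rho> = code n \<rho> \<times> code n \<rho> \<times> code n \<rho>"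

end

definition patterns3 :: "gword set set \<Rightarrow> ((gword set \<Rightarrow> bit) \<times> (gword set \<Rightarrow> bit) \<times> (gword set \<Rightarrow> bit)) set" where
  "patterns3 F = PiE F (\<lambda>_. UNIV) \<times> PiE F (\<lambda>_. UNIV) \<times> PiE F (\<lambda>_. UNIV)"

text \<open>The law on the window \<open>F\<close> of three independent Haar points, summed over the
  event \<open>L\<close>.\<close>

definition pattern_prob3 where
  "pattern_prob3 d k F L = (\<Sum>P\<in>L. pattern_prob d k F (fst P) * (pattern_prob d k F (fst (snd P)) * pattern_prob d k F (snd (snd P))))"

lemma sum_triple_product:
  fixes f g h :: "'x \<Rightarrow> real"
  shows "(\<Sum>X\<in>A \<times> A \<times> A. f (fst X) * (g (fst (snd X)) * h (snd (snd X)))) = sum f A * (sum g A * sum h A)"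
proof -
  have "(\<Sum>X\<in>A \<times> A \<times> A. f (fst X) * (g (fst (snd X)) * h (snd (snd X)))) = (\<Sum>x\<in>A. \<Sum>Y\<in>A \<times> A. f x * (g (fst Y) * h (snd Y)))"
    by (simp add: sum.cartesian_product split_def)
  also have "\<dots> = (\<Sum>x\<in>A. \<Sum>y\<in>A. \<Sum>z\<in>A. f x * (g y * h z))"
    by (simp add: sum.cartesian_product split_def)
  also have "\<dots> = sum f A * (sum g A * sum h A)"
    unfolding sum_distrib_right[of f]
    by (intro sum.cong refl) (simp only: sum_product, simp only: sum_distrib_left)
  finally show ?thesis .
qed

lemma finite_patterns: "finite F \<Longrightarrow> finite (PiE F (\<lambda>_. UNIV :: bit set))"
  by (intro finite_PiE finite_UNIV_bit)

lemma finite_patterns3: "finite F \<Longrightarrow> finite (patterns3 F)"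
  unfolding patterns3_def by (intro finite_cartesian_product finite_patterns)

context finite_gam_set
begin

lemma view_eq_iff: "p \<in> PiE F (\<lambda>_. UNIV) \<Longrightarrow> view n \<rho> F v x = p \<longleftrightarrow> (\<forall>g\<in>F. x (lift_act n \<rho> v g) = p g)"
proof -
  assume p: "p \<in> PiE F (\<lambda>_. UNIV)"
  show ?thesis
  proof
    assume "\<forall>g\<in>F. x (lift_act n \<rho> v g) = p g"
    then show "view n \<rho> F v x = p"
      unfolding view_def by (intro PiE_ext[OF _ p]) auto
  qed (auto simp: view_def)
qed

lemma finite_code3: "finite (code3 n \<rho>)"
  unfolding code3_def using finite_code by blast

lemma card_code3: "real (card (code3 n \<rho>)) = real (card (code n \<rho>)) * (card (code n \<rho>) * card (code n \<rho>))"
  by (simp add: code3_def card_cartesian_product)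

context
  fixes n \<rho> F v v'
  assumes \<rho>: "\<rho> \<in> lifts n" and F: "F \<subseteq> carrier \<Gamma>" "finite F"
    and v: "v \<in> vertices n" "v' \<in> vertices n" and ind: "independent_pair n \<rho> F v v'"
begin

lemma sum_code_views:
  assumes "p \<in> PiE F (\<lambda>_. UNIV)" "p' \<in> PiE F (\<lambda>_. UNIV)"
  shows "(\<Sum>x\<in>code n \<rho>. of_bool (view n \<rho> F v x = p \<and> view n \<rho> F v' x = p'))
    = card (code n \<rho>) * (pattern_prob d k F p * pattern_prob d k F p')"
  unfolding card_code_pair_pattern[OF \<rho> F v ind, symmetric]
  by (intro sum.cong refl) (auto simp: view_eq_iff assms)

lemma sum_code3_views:
  assumes L: "L \<subseteq> patterns3 F" "L' \<subseteq> patterns3 F"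
  shows "(\<Sum>X\<in>code3 n \<rho>. of_bool (view3 n \<rho> F v X \<in> L) * of_bool (view3 n \<rho> F v' X \<in> L'))
    = card (code3 n \<rho>) * (pattern_prob3 d k F L * pattern_prob3 d k F L')"
proof -
  have fin: "finite L" "finite L'" using L finite_patterns3[OF F(2)] finite_subset by auto
  let ?pp = "\<lambda>P. pattern_prob d k F (fst P) * (pattern_prob d k F (fst (snd P)) * pattern_prob d k F (snd (snd P)))"
  let ?c = "real (card (code n \<rho>))"
  have pairs: "(\<Sum>X\<in>code3 n \<rho>. of_bool (view3 n \<rho> F v X = P) * of_bool (view3 n \<rho> F v' X = P'))
      = card (code3 n \<rho>) * (?pp P * ?pp P')"
    if P: "P \<in> L" "P' \<in> L'" for P P'
  proof -
    obtain p q r where Pp: "P = (p, q, r)" by (metis prod.collapse)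
    obtain p' q' r' where Pp': "P' = (p', q', r')" by (metis prod.collapse)
    have mem: "p \<in> PiE F (\<lambda>_. UNIV)" "q \<in> PiE F (\<lambda>_. UNIV)" "r \<in> PiE F (\<lambda>_. UNIV)"
       "p' \<in> PiE F (\<lambda>_. UNIV)" "q' \<in> PiE F (\<lambda>_. UNIV)" "r' \<in> PiE F (\<lambda>_. UNIV)"
      using P L by (auto simp: Pp Pp' patterns3_def)
    let ?f = "\<lambda>p p' x. of_bool (view n \<rho> F v x = p \<and> view n \<rho> F v' x = p') :: real"
    have "(\<Sum>X\<in>code3 n \<rho>. of_bool (view3 n \<rho> F v X = P) * of_bool (view3 n \<rho> F v' X = P'))
      = (\<Sum>X\<in>code n \<rho> \<times> code n \<rho> \<times> code n \<rho>. ?f p p' (fst X) * (?f q q' (fst (snd X)) * ?f r r' (snd (snd X))))"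
      unfolding code3_def by (intro sum.cong refl) (auto simp: view3_def Pp Pp')
    also have "\<dots> = sum (?f p p') (code n \<rho>) * (sum (?f q q') (code n \<rho>) * sum (?f r r') (code n \<rho>))"
      by (rule sum_triple_product)
    also have "\<dots> = card (code3 n \<rho>) * (?pp P * ?pp P')"
      unfolding card_code3 by (simp add: sum_code_views mem Pp Pp' del: of_bool_conj)
    finally show ?thesis .
  qed
  have ind: "of_bool (Y \<in> L) = (\<Sum>P\<in>L. of_bool (Y = P) :: real)" if "finite L" for Y and L :: "((gword set \<Rightarrow> bit) \<times> (gword set \<Rightarrow> bit) \<times> (gword set \<Rightarrow> bit)) set"
    using that by (simp add: of_bool_def)
  have "(\<Sum>X\<in>code3 n \<rho>. of_bool (view3 n \<rho> F v X \<in> L) * of_bool (view3 n \<rho> F v' X \<in> L') :: real)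
    = (\<Sum>X\<in>code3 n \<rho>. \<Sum>P\<in>L. \<Sum>P'\<in>L'. of_bool (view3 n \<rho> F v X = P) * of_bool (view3 n \<rho> F v' X = P'))"
    unfolding ind[OF fin(1)] ind[OF fin(2)] sum_product ..
  also have "\<dots> = (\<Sum>P\<in>L. \<Sum>P'\<in>L'. \<Sum>X\<in>code3 n \<rho>. of_bool (view3 n \<rho> F v X = P) * of_bool (view3 n \<rho> F v' X = P'))"
    by (subst sum.swap, intro sum.cong refl, rule sum.swap)
  also have "\<dots> = (\<Sum>P\<in>L. \<Sum>P'\<in>L'. card (code3 n \<rho>) * (?pp P * ?pp P'))"
    by (intro sum.cong refl pairs)
  also have "\<dots> = card (code3 n \<rho>) * (pattern_prob3 d k F L * pattern_prob3 d k F L')"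
    unfolding pattern_prob3_def sum_product by (simp add: sum_distrib_left)
  finally show ?thesis .
qed

end

end

section \<open>A contradiction from a sparse local codeword\<close>

text \<open>Pattern probabilities are defined as Fourier sums. These properties are what the
  combinatorial argument requires of them as probabilities; the Haar measure supplies them
  afterwards.\<close>

definition regular_pattern_probs :: "nat \<Rightarrow> nat \<Rightarrow> bool" where
  "regular_pattern_probs d k \<longleftrightarrow> (\<forall>F. finite F \<longrightarrow> F \<subseteq> carrier (Gam d k) \<longrightarrow>
     pattern_prob3 d k F (patterns3 F) = 1 \<and> (\<forall>L\<subseteq>patterns3 F. 0 \<le> pattern_prob3 d k F L \<and> pattern_prob3 d k F L \<le> 1))"

context finite_gam_set
begin

lemma view3_patterns: "view3 n \<rho> F v X \<in> patterns3 F"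
  by (auto simp: view3_def view_def patterns3_def)

text \<open>Second moment over random codewords: independent pairs of vertices contribute 0, and
  each vertex has at most \<open>B\<close> partners with which it fails to be independent.\<close>

lemma view_frequency_variance:
  assumes \<rho>: "\<rho> \<in> lifts n" and F: "F \<subseteq> carrier \<Gamma>" "finite F" and q: "q \<in> Q" and n: "n > 0"
    and L: "L \<subseteq> patterns3 F" and reg: "regular_pattern_probs d k"
    and B: "\<And>u. u < n \<Longrightarrow> card {u'\<in>{..<n}. \<not> independent_pair n \<rho> F (q, u) (q, u')} \<le> B"
  shows "(\<Sum>X\<in>code3 n \<rho>. (card {u\<in>{..<n}. view3 n \<rho> F (q, u) X \<in> L} / n - pattern_prob3 d k F L)\<^sup>2)
    \<le> card (code3 n \<rho>) * (B / n)"
proof -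
  define P where "P = pattern_prob3 d k F L"
  define C where "C = real (card (code3 n \<rho>))"
  define I where "I u X = (of_bool (view3 n \<rho> F (q, u) X \<in> L) :: real)" for u X
  have P: "0 \<le> P" "P \<le> 1" and P1: "pattern_prob3 d k F (patterns3 F) = 1"
    using reg F L by (auto simp: regular_pattern_probs_def P_def)
  have v: "(q, u) \<in> vertices n" if "u < n" for u using q that by (auto simp: vertices_def)
  have pair0: "(\<Sum>X\<in>code3 n \<rho>. (I u X - P) * (I u' X - P)) = 0"
    if u: "u < n" "u' < n" and ind: "independent_pair n \<rho> F (q, u) (q, u')" for u u'
  proof -
    note V = sum_code3_views[OF \<rho> F v[OF u(1)] v[OF u(2)] ind]
    \<comment> \<open>The law of one view is the pair law with the certain event at the other
      vertex.\<close>
    have "(\<Sum>X\<in>code3 n \<rho>. I u X) = C * P"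
      using V[OF L order_refl] unfolding I_def P_def C_def by (simp add: view3_patterns P1)
    moreover have "(\<Sum>X\<in>code3 n \<rho>. I u' X) = C * P"
      using V[OF order_refl L] unfolding I_def P_def C_def by (simp add: view3_patterns P1)
    moreover have "(\<Sum>X\<in>code3 n \<rho>. I u X * I u' X) = C * (P * P)"
      using V[OF L L] unfolding I_def P_def C_def .
    moreover have "(\<Sum>X\<in>code3 n \<rho>. (I u X - P) * (I u' X - P))
      = (\<Sum>X\<in>code3 n \<rho>. I u X * I u' X) - P * (\<Sum>X\<in>code3 n \<rho>. I u X) - P * (\<Sum>X\<in>code3 n \<rho>. I u' X) + C * (P * P)"
      by (simp add: algebra_simps sum.distrib sum_subtractf sum_distrib_left C_def)
    ultimately show ?thesis by (simp add: algebra_simps)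
  qed
  have pair1: "(\<Sum>X\<in>code3 n \<rho>. (I u X - P) * (I u' X - P)) \<le> C" for u u'
  proof -
    have "(I u X - P) * (I u' X - P) \<le> 1" for X
    proof -
      have "\<bar>I u X - P\<bar> \<le> 1" "\<bar>I u' X - P\<bar> \<le> 1" using P by (auto simp: I_def of_bool_def)
      then have "\<bar>(I u X - P) * (I u' X - P)\<bar> \<le> 1" unfolding abs_mult by (intro mult_le_one) auto
      then show ?thesis by linarith
    qed
    then have "(\<Sum>X\<in>code3 n \<rho>. (I u X - P) * (I u' X - P)) \<le> (\<Sum>X\<in>code3 n \<rho>. 1)" by (intro sum_mono)
    then show ?thesis by (simp add: C_def)
  qed
  have sq: "(card {u\<in>{..<n}. view3 n \<rho> F (q, u) X \<in> L} / n - P)\<^sup>2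
     = (\<Sum>u<n. \<Sum>u'<n. (I u X - P) * (I u' X - P)) / (real n * real n)" for X
  proof -
    have "(\<Sum>u<n. I u X) = card {u\<in>{..<n}. view3 n \<rho> F (q, u) X \<in> L}"
      by (simp add: I_def Int_def)
    then have "card {u\<in>{..<n}. view3 n \<rho> F (q, u) X \<in> L} / n - P = (\<Sum>u<n. I u X - P) / n"
      using n by (simp add: sum_subtractf field_simps)
    then show ?thesis by (simp only: power2_eq_square times_divide_times_eq sum_product)
  qed
  have "(\<Sum>X\<in>code3 n \<rho>. (card {u\<in>{..<n}. view3 n \<rho> F (q, u) X \<in> L} / n - P)\<^sup>2)
    = (\<Sum>X\<in>code3 n \<rho>. \<Sum>u<n. \<Sum>u'<n. (I u X - P) * (I u' X - P)) / (real n * real n)"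
    unfolding sq by (rule sum_divide_distrib[symmetric])
  also have "\<dots> = (\<Sum>u<n. \<Sum>u'<n. \<Sum>X\<in>code3 n \<rho>. (I u X - P) * (I u' X - P)) / (real n * real n)"
    by (rule arg_cong2[where f = "(/)", OF trans[OF sum.swap sum.cong[OF refl sum.swap]] refl])
  also have "\<dots> \<le> (\<Sum>u<n. \<Sum>u'<n. if \<not> independent_pair n \<rho> F (q, u) (q, u') then C else 0) / (real n * real n)"
    using pair0 pair1 by (intro divide_right_mono sum_mono) auto
  also have "\<dots> = (\<Sum>u<n. real (card {u'\<in>{..<n}. \<not> independent_pair n \<rho> F (q, u) (q, u')}) * C) / (real n * real n)"
    by (simp add: sum.If_cases Int_def)
  also have "\<dots> \<le> (\<Sum>u<n. B * C) / (real n * real n)"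
    using B by (intro divide_right_mono sum_mono mult_right_mono) (auto simp: C_def)
  also have "\<dots> = C * (B / n)" using n by (simp add: field_simps)
  finally show ?thesis by (simp add: P_def C_def)
qed

text \<open>If the windows meet in the images of g and g', then \<open>u'\<close> is recovered from
  the pair (g, g').\<close>

lemma card_overlapping_le:
  assumes \<rho>: "\<rho> \<in> lifts n" and F: "F \<subseteq> carrier \<Gamma>" "finite F" and v: "v \<in> vertices n" and q: "q \<in> Q"
  shows "card {u'\<in>{..<n}. lift_act n \<rho> v ` F \<inter> lift_act n \<rho> (q, u') ` F \<noteq> {}} \<le> card F * card F"
proof -
  note A = right_actionD[OF lift_act(1)[OF \<rho>]]
  have "{u'\<in>{..<n}. lift_act n \<rho> v ` F \<inter> lift_act n \<rho> (q, u') ` F \<noteq> {}}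
    \<subseteq> (\<lambda>(g, g'). snd (lift_act n \<rho> (lift_act n \<rho> v g) (inv\<^bsub>\<Gamma>\<^esub> g'))) ` (F \<times> F)"
  proof
    fix u' assume "u' \<in> {u'\<in>{..<n}. lift_act n \<rho> v ` F \<inter> lift_act n \<rho> (q, u') ` F \<noteq> {}}"
    then obtain g g' where g: "u' < n" "g \<in> F" "g' \<in> F" "lift_act n \<rho> v g = lift_act n \<rho> (q, u') g'" by blast
    have w: "(q, u') \<in> vertices n" using q g by (auto simp: vertices_def)
    have g'c: "g' \<in> carrier \<Gamma>" using g(3) F(1) by blast
    have "lift_act n \<rho> (lift_act n \<rho> v g) (inv\<^bsub>\<Gamma>\<^esub> g') = (q, u')"
      unfolding g(4) A(3)[OF w g'c Gam.inv_closed[OF g'c], symmetric] Gam.r_inv[OF g'c] by (rule A(1)[OF w])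
    then show "u' \<in> (\<lambda>(g, g'). snd (lift_act n \<rho> (lift_act n \<rho> v g) (inv\<^bsub>\<Gamma>\<^esub> g'))) ` (F \<times> F)"
      using g by (intro image_eqI[of _ _ "(g, g')"]) auto
  qed
  from card_mono[OF _ this] have "card {u'\<in>{..<n}. lift_act n \<rho> v ` F \<inter> lift_act n \<rho> (q, u') ` F \<noteq> {}}
     \<le> card ((\<lambda>(g, g'). snd (lift_act n \<rho> (lift_act n \<rho> v g) (inv\<^bsub>\<Gamma>\<^esub> g'))) ` (F \<times> F))"
    using F(2) by blast
  also have "\<dots> \<le> card (F \<times> F)" by (rule card_image_le) (use F(2) in blast)
  finally show ?thesis by (simp add: card_cartesian_product)
qed

text \<open>Injectivity of the windows is inherited from the base through
  \<open>fst_lift_act\<close>; the rest is \<open>code_pair_null\<close>.\<close>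

lemma light_lift_independent_pair:
  assumes \<rho>: "\<rho> \<in> lifts n" and light: "light_lift n K (2 * card F) \<rho>"
    and n: "real K * log 2 n \<le> sqrt n" "n > 2 * K + 2 * card F" "n > 1"
    and F: "F \<subseteq> carrier \<Gamma>" "finite F"
    and inj: "\<And>q. q \<in> Q \<Longrightarrow> inj_on (qact q) ((gam_nbhd d k ^^ Suc (2 * K)) F)"
    and v: "v \<in> vertices n" "v' \<in> vertices n"
    and disj: "lift_act n \<rho> v ` (gam_nbhd d k ^^ Suc (2 * K)) F \<inter> lift_act n \<rho> v' ` (gam_nbhd d k ^^ Suc (2 * K)) F = {}"
  shows "independent_pair n \<rho> F v v'"
proof -
  have inj': "inj_on (lift_act n \<rho> w) ((gam_nbhd d k ^^ Suc (2 * K)) F)" if w: "w \<in> vertices n" for w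
  proof (rule inj_onI)
    fix g h assume gh: "g \<in> (gam_nbhd d k ^^ Suc (2 * K)) F" "h \<in> (gam_nbhd d k ^^ Suc (2 * K)) F"
      "lift_act n \<rho> w g = lift_act n \<rho> w h"
    have c: "g \<in> carrier \<Gamma>" "h \<in> carrier \<Gamma>" using gh(1,2) gam_nbhd_iter(1)[OF F, of "Suc (2 * K)"] by blast+
    have "qact (fst w) g = qact (fst w) h"
      using gh(3) fst_lift_act[OF \<rho> w c(1)] fst_lift_act[OF \<rho> w c(2)] by simp
    then show "g = h" using inj_onD[OF inj, of "fst w" g h] w gh(1,2) by (auto simp: vertices_def)
  qed
  show ?thesis
    unfolding independent_pair_def
    using code_pair_null[OF \<rho> light n F _ v inj'[OF v(1)] inj'[OF v(2)] disj] by blast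
qed

end

section \<open>Local rules, their defects, and how they are seen in a lift\<close>

definition shift_pattern :: "nat \<Rightarrow> nat \<Rightarrow> gword set set \<Rightarrow> gword set \<Rightarrow> (gword set \<Rightarrow> bit) \<Rightarrow> gword set \<Rightarrow> bit" where
  "shift_pattern d k F g p = (\<lambda>h\<in>F. p (g \<otimes>\<^bsub>Gam d k\<^esub> h))"

definition shift_pattern3 where
  "shift_pattern3 d k F g P = (shift_pattern d k F g (fst P), shift_pattern d k F g (fst (snd P)), shift_pattern d k F g (snd (snd P)))"

text \<open>Large enough to evaluate a local rule with window \<open>F\<close> at all k points of
  every check through the base point.\<close>

definition shifted_window :: "nat \<Rightarrow> nat \<Rightarrow> gword set set \<Rightarrow> gword set set" where
  "shifted_window d k F = (\<Union>i<d. \<Union>j<k. (\<lambda>h. (gen d k i [^]\<^bsub>Gam d k\<^esub> (j::nat)) \<otimes>\<^bsub>Gam d k\<^esub> h) ` F)"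

text \<open>The set \<open>L\<close> is a local rule that decides membership in the sparse set. It
  is read here on the window that the defects use, so that one window serves for all events.\<close>

definition window_event where
  "window_event d k F L = {P \<in> patterns3 (shifted_window d k F). shift_pattern3 d k F \<one>\<^bsub>Gam d k\<^esub> P \<in> L}"

definition defect_event where
  "defect_event d k F L i = {P \<in> patterns3 (shifted_window d k F).
     odd (card {j\<in>{..<k}. shift_pattern3 d k F (gen d k i [^]\<^bsub>Gam d k\<^esub> (j::nat)) P \<in> L})}"

context finite_gam_set
begin

lemma shift_view:
  assumes \<rho>: "\<rho> \<in> lifts n" and v: "v \<in> vertices n" and F: "F \<subseteq> carrier \<Gamma>" and i: "i < d" "j < k"
  shows "shift_pattern d k F (gpow i j) (view n \<rho> (shifted_window d k F) v x) = view n \<rho> F (lift_act n \<rho> v (gpow i j)) x"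
  unfolding shift_pattern_def view_def
proof (rule restrict_ext)
  fix h assume h: "h \<in> F"
  then have "gpow i j \<otimes>\<^bsub>\<Gamma>\<^esub> h \<in> shifted_window d k F" using i unfolding shifted_window_def by blast
  then show "(\<lambda>g\<in>shifted_window d k F. x (lift_act n \<rho> v g)) (gpow i j \<otimes>\<^bsub>\<Gamma>\<^esub> h) = x (lift_act n \<rho> (lift_act n \<rho> v (gpow i j)) h)"
    using right_actionD(3)[OF lift_act(1)[OF \<rho>] v gpow_closed[OF i(1)]] h F by auto
qed

lemma shift_view3:
  assumes \<rho>: "\<rho> \<in> lifts n" and v: "v \<in> vertices n" and F: "F \<subseteq> carrier \<Gamma>" and i: "i < d" "j < k"
  shows "shift_pattern3 d k F (gpow i j) (view3 n \<rho> (shifted_window d k F) v X) = view3 n \<rho> F (lift_act n \<rho> v (gpow i j)) X"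
  using shift_view[OF assms] by (simp add: shift_pattern3_def view3_def)

lemma window_view3:
  assumes \<rho>: "\<rho> \<in> lifts n" and v: "v \<in> vertices n" and F: "F \<subseteq> carrier \<Gamma>"
  shows "view3 n \<rho> (shifted_window d k F) v X \<in> window_event d k F L \<longleftrightarrow> view3 n \<rho> F v X \<in> L"
  using shift_view3[OF \<rho> v F d_pos, of 0] k_gt_1 right_actionD(1)[OF lift_act(1)[OF \<rho>] v]
  by (simp add: window_event_def view3_patterns)

lemma defect_view3:
  assumes \<rho>: "\<rho> \<in> lifts n" and v: "v \<in> vertices n" and F: "F \<subseteq> carrier \<Gamma>" and i: "i < d"
  shows "view3 n \<rho> (shifted_window d k F) v X \<in> defect_event d k F L i \<longleftrightarrow>
    odd (card {j\<in>{..<k}. view3 n \<rho> F (lift_act n \<rho> v (gpow i j)) X \<in> L})"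
proof -
  have "{j\<in>{..<k}. shift_pattern3 d k F (gpow i j) (view3 n \<rho> (shifted_window d k F) v X) \<in> L}
    = {j\<in>{..<k}. view3 n \<rho> F (lift_act n \<rho> v (gpow i j)) X \<in> L}"
    using shift_view3[OF \<rho> v F i, of _ X] by auto
  then show ?thesis by (simp add: defect_event_def view3_patterns)
qed

text \<open>Each check of the class contains exactly one vertex over \<open>q\<close>, and
  \<open>\<rho> q i\<close> is the bijection between these vertices and the check labels.\<close>

lemma card_odd_checks:
  assumes \<rho>: "\<rho> \<in> lifts n" and i: "i < d" and q: "q \<in> Q"
  shows "card {m\<in>{..<n}. odd (card {q'\<in>orb i q. m \<in> \<rho> q' i ` {u\<in>{..<n}. R (q', u)}})}
    = card {u\<in>{..<n}. odd (card {j\<in>{..<k}. R (lift_act n \<rho> (q, u) (gpow i j))})}"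
proof -
  note perm = liftsD[OF \<rho> _ i]
  have key: "card {q'\<in>orb i q. \<rho> q i u \<in> \<rho> q' i ` {u\<in>{..<n}. R (q', u)}} = card {j\<in>{..<k}. R (lift_act n \<rho> (q, u) (gpow i j))}"
    if u: "u < n" for u
  proof -
    have v: "(q, u) \<in> vertices n" using q u by (auto simp: vertices_def)
    let ?m = "\<rho> q i u"
    have mem: "?m \<in> \<rho> q' i ` {u\<in>{..<n}. R (q', u)} \<longleftrightarrow> R (q', Hilbert_Choice.inv (\<rho> q' i) ?m)" if q': "q' \<in> Q" for q'
    proof
      assume "?m \<in> \<rho> q' i ` {u\<in>{..<n}. R (q', u)}"
      then show "R (q', Hilbert_Choice.inv (\<rho> q' i) ?m)"
        using permutes_inverses(2)[OF perm[OF q']] by auto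
    next
      assume R: "R (q', Hilbert_Choice.inv (\<rho> q' i) ?m)"
      have "Hilbert_Choice.inv (\<rho> q' i) ?m < n"
        using permutes_in_image[OF permutes_inv[OF perm[OF q']]] permutes_in_image[OF perm[OF q]] u by auto
      then show "?m \<in> \<rho> q' i ` {u\<in>{..<n}. R (q', u)}"
        using R permutes_inverses(1)[OF perm[OF q'], of ?m] by (intro image_eqI[of _ _ "Hilbert_Choice.inv (\<rho> q' i) ?m"]) auto
    qed
    have "{q'\<in>orb i q. ?m \<in> \<rho> q' i ` {u\<in>{..<n}. R (q', u)}}
      = (\<lambda>j. qact q (gpow i j)) ` {j\<in>{..<k}. R (lift_act n \<rho> (q, u) (gpow i j))}"
    proof -
      have "orb i q = (\<lambda>j. qact q (gpow i j)) ` {..<k}" unfolding orb_def by (rule range_gpow_act[OF i])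
      moreover have "?m \<in> \<rho> (qact q (gpow i j)) i ` {u\<in>{..<n}. R (qact q (gpow i j), u)} \<longleftrightarrow> R (lift_act n \<rho> (q, u) (gpow i j))" for j
        unfolding mem[OF qactD(2)[OF q gpow_closed[OF i]]] lift_act_gpow[OF \<rho> v i] by simp
      ultimately show ?thesis by auto
    qed
    moreover have "inj_on (\<lambda>j. qact q (gpow i j)) {..<k}"
      by (rule inj_on_gpow_act[OF qact q i qact_free]) (use i in auto)
    then have "inj_on (\<lambda>j. qact q (gpow i j)) {j\<in>{..<k}. R (lift_act n \<rho> (q, u) (gpow i j))}"
      by (rule inj_on_subset) auto
    ultimately show ?thesis by (simp only: card_image)
  qed
  have "{m\<in>{..<n}. odd (card {q'\<in>orb i q. m \<in> \<rho> q' i ` {u\<in>{..<n}. R (q', u)}})}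
    = \<rho> q i ` {u\<in>{..<n}. odd (card {j\<in>{..<k}. R (lift_act n \<rho> (q, u) (gpow i j))})}"
  proof (intro equalityI subsetI)
    fix m assume m: "m \<in> {m\<in>{..<n}. odd (card {q'\<in>orb i q. m \<in> \<rho> q' i ` {u\<in>{..<n}. R (q', u)}})}"
    then have "m \<in> \<rho> q i ` {..<n}" using permutes_image[OF perm[OF q]] by simp
    then obtain u where u: "u < n" "m = \<rho> q i u" by auto
    then show "m \<in> \<rho> q i ` {u\<in>{..<n}. odd (card {j\<in>{..<k}. R (lift_act n \<rho> (q, u) (gpow i j))})}"
      using m key[OF u(1)] by simp
  next
    fix m assume "m \<in> \<rho> q i ` {u\<in>{..<n}. odd (card {j\<in>{..<k}. R (lift_act n \<rho> (q, u) (gpow i j))})}"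
    then obtain u where u: "u < n" "m = \<rho> q i u" "odd (card {j\<in>{..<k}. R (lift_act n \<rho> (q, u) (gpow i j))})" by auto
    moreover have "m < n" using permutes_in_image[OF perm[OF q]] u by auto
    ultimately show "m \<in> {m\<in>{..<n}. odd (card {q'\<in>orb i q. m \<in> \<rho> q' i ` {u\<in>{..<n}. R (q', u)}})}"
      using key[OF u(1)] by simp
  qed
  then show ?thesis by (simp add: card_image[OF permutes_inj_on[OF perm[OF q]]])
qed

end

lemma finite_shifted_window: "finite F \<Longrightarrow> finite (shifted_window d k F)"
  by (simp add: shifted_window_def)

lemma shifted_window_closed: "F \<subseteq> carrier (Gam d k) \<Longrightarrow> shifted_window d k F \<subseteq> carrier (Gam d k)"
proof -
  interpret Gam: group "Gam d k" by (rule group_Gam)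
  show "F \<subseteq> carrier (Gam d k) \<Longrightarrow> ?thesis"
    by (auto simp: shifted_window_def gen_pow_closed)
qed

lemma eventually_log_le_sqrt: "eventually (\<lambda>n. real K * log 2 (real n) \<le> sqrt (real n)) at_top"
  by real_asymp

text \<open>Chebyshev's inequality with a union bound over the events in \<open>J\<close>, written
  as an averaging argument.\<close>

lemma ex_codewords_with_frequencies:
  fixes \<eta> b :: real
  assumes "finite J" "finite C" "C \<noteq> {}" "\<eta> > 0"
    and var: "\<And>j. j \<in> J \<Longrightarrow> (\<Sum>X\<in>C. (f j X - P j)\<^sup>2) \<le> card C * b" and b: "card J * b < \<eta>\<^sup>2"
  shows "\<exists>X\<in>C. \<forall>j\<in>J. \<bar>f j X - P j\<bar> < \<eta>"
proof (rule ccontr)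
  assume "\<not> ?thesis"
  then have ex: "\<exists>j\<in>J. \<eta> \<le> \<bar>f j X - P j\<bar>" if "X \<in> C" for X using that by (auto simp: not_less)
  have "\<eta>\<^sup>2 \<le> (\<Sum>j\<in>J. (f j X - P j)\<^sup>2)" if X: "X \<in> C" for X
  proof -
    obtain j where j: "j \<in> J" "\<eta> \<le> \<bar>f j X - P j\<bar>" using ex[OF X] by blast
    have "\<eta>\<^sup>2 \<le> (f j X - P j)\<^sup>2" using j(2) assms(4) abs_le_square_iff[of \<eta> "f j X - P j"] by simp
    also have "\<dots> \<le> (\<Sum>j\<in>J. (f j X - P j)\<^sup>2)" by (rule member_le_sum[OF j(1)]) (use assms(1) in auto)
    finally show ?thesis .
  qed
  then have "(\<Sum>X\<in>C. \<eta>\<^sup>2) \<le> (\<Sum>X\<in>C. \<Sum>j\<in>J. (f j X - P j)\<^sup>2)" by (rule sum_mono)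
  also have "\<dots> = (\<Sum>j\<in>J. \<Sum>X\<in>C. (f j X - P j)\<^sup>2)" by (rule sum.swap)
  also have "\<dots> \<le> (\<Sum>j\<in>J. card C * b)" by (rule sum_mono) (rule var)
  also have "\<dots> = card C * (card J * b)" by simp
  also have "\<dots> < card C * \<eta>\<^sup>2" using b assms(2,3) by (intro mult_strict_left_mono) (auto simp: card_gt_0_iff)
  finally show False by simp
qed

text \<open>The order of choices matters. The rule fixes the window and \<open>N\<close>, then
  \<open>K\<close> is chosen from \<open>N\<close>, the radius from \<open>K\<close>, the finite
  \<Gamma>-set from the radius, and only then n. The bound \<delta> precedes them all and depends on
  d and k alone.\<close>

theorem no_sparse_local_codeword:
  fixes d k :: nat
  assumes d: "d \<ge> 3" and dk: "d < k" and reg: "regular_pattern_probs d k"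
  shows "\<exists>\<delta>>(0::real). \<forall>F L (p::real). finite F \<longrightarrow> F \<subseteq> carrier (Gam d k) \<longrightarrow> 0 < p \<longrightarrow> p < \<delta> \<longrightarrow>
    \<bar>pattern_prob3 d k (shifted_window d k F) (window_event d k F L) - p\<bar> \<le> p / 40 \<longrightarrow>
    (\<forall>i<d. pattern_prob3 d k (shifted_window d k F) (defect_event d k F L i) \<le> p / 40) \<longrightarrow> False"
proof -
  have k: "k > 1" "k > 0" "d > 0" using d dk by auto
  from sparse_near_codeword_parameters[OF d k(2)]
  obtain \<delta> :: real where \<delta>: "\<delta> > 0" and param: "\<forall>(p::real) (y::real). 0 < p \<longrightarrow> p < \<delta> \<longrightarrow> y = k * p * (1 + 2 * (1 / 20)) / 2 \<longrightarrow>
    0 < y \<and> y \<le> 1 \<and> y ^ d \<le> p \<and>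
    2 + (1 - 1 / 20) * (d * ln y - ln p) + d * (1 + 2 * (1 / 20)) / 2 * (1 - ln y) \<le> 0"
    by (elim exE conjE) (rule that)
  have main: False
    if F0: "finite F0" "F0 \<subseteq> carrier (Gam d k)" and p: "0 < p" "p < \<delta>"
      and win: "\<bar>pattern_prob3 d k (shifted_window d k F0) (window_event d k F0 L) - p\<bar> \<le> p / 40"
      and defect: "\<forall>i<d. pattern_prob3 d k (shifted_window d k F0) (defect_event d k F0 L i) \<le> p / 40"
    for F0 L and p :: real
  proof -
    define F where "F = shifted_window d k F0"
    have F: "F \<subseteq> carrier (Gam d k)" "finite F"
      unfolding F_def using F0 by (auto intro: finite_shifted_window shifted_window_closed[THEN subsetD])
    define N where "N = 2 * card F"
    define g where "g = (real k - real d) / real d / 2"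
    have g: "g > 0" using dk k by (simp add: g_def)
    \<comment> \<open>With K g at least N + 1, the factor n^(-K g) beats the order n^N of the number
      of possible check sums.\<close>
    obtain K :: nat where K: "real N + 1 \<le> K * g"
    proof -
      obtain K :: nat where "(real N + 1) / g \<le> K" using real_arch_simple by blast
      then show thesis using that[of K] g by (simp add: field_simps)
    qed
    define Fs where "Fs = (gam_nbhd d k ^^ Suc (2 * K)) F"
    have Fs: "Fs \<subseteq> carrier (Gam d k)" "finite Fs" unfolding Fs_def by (intro gam_nbhd_iter[OF F])+
    \<comment> \<open>Injectivity on the powers of the generators gives freeness of the base;
      injectivity on \<open>Fs\<close> gives embedded windows.\<close>
    define Z where "Z = Fs \<union> (\<lambda>(i, j). gen d k i [^]\<^bsub>Gam d k\<^esub> (j::nat)) ` ({..<d} \<times> {..<k})"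
    have Z: "finite Z" "Z \<subseteq> carrier (Gam d k)" using Fs gen_pow_closed by (auto simp: Z_def)
    obtain Q :: "(gword set \<Rightarrow> gword set) set" and qact where Q: "finite Q" "Q \<noteq> {}"
      "right_action (Gam d k) Q qact" "\<And>q. q \<in> Q \<Longrightarrow> inj_on (qact q) Z"
      using Gam_residually_finite[OF k(1) Z] by blast
    interpret finite_gam_set d k Q qact
    proof
      fix q i j assume q: "q \<in> Q" and i: "i < d" and j: "0 < j" "j < k"
      have pow: "gen d k i [^]\<^bsub>Gam d k\<^esub> l \<in> Z" if "l < k" for l :: nat
        unfolding Z_def using i that by (intro UnI2 image_eqI[of _ _ "(i, l)"]) auto
      have "\<one>\<^bsub>Gam d k\<^esub> \<in> Z" "gen d k i [^]\<^bsub>Gam d k\<^esub> j \<in> Z"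
        using pow[of 0] pow[of j] j by auto
      then have "qact q (gen d k i [^]\<^bsub>Gam d k\<^esub> j) \<noteq> qact q \<one>\<^bsub>Gam d k\<^esub>"
        using inj_onD[OF Q(4)[OF q]] gen_pow_neq_one[OF i j] by blast
      then show "qact q (gen d k i [^]\<^bsub>Gam d k\<^esub> j) \<noteq> q"
        using right_actionD(1)[OF Q(3) q] by simp
    qed (use Q k in auto)
    define C where "C = (2 / (1 - 2 powr (- g))) ^ card orbits"
    have C: "C > 0" unfolding C_def using g powr_less_cancel_iff[of 2 "-g" 0] by (intro zero_less_power divide_pos_pos) auto
    define B where "B = card Fs * card Fs"
    \<comment> \<open>The index d stands for membership in the sparse set, and j < d for a defect at
      generator j.\<close>
    define J where "J = (Q \<times> {..<d + 1})"
    have "eventually (\<lambda>n. n > 2 * K + N \<and> n > 1 \<and> real K * log 2 (real n) \<le> sqrt (real n) \<and>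
        2 * ((card Q + 1) ^ N * C) < real n \<and> ln 2 / p < real n \<and> card J * B / (p / 40)\<^sup>2 < real n) at_top"
      by (intro eventually_conj eventually_log_le_sqrt eventually_gt_at_top) real_asymp+
    then obtain n where n: "n > 2 * K + N" "n > 1" "real K * log 2 (real n) \<le> sqrt (real n)"
      "2 * ((card Q + 1) ^ N * C) < real n" "ln 2 / p < real n" "card J * B / (p / 40)\<^sup>2 < real n"
      by (auto dest!: eventually_happens)
    have n0: "n > 0" using n by simp
    define y where "y = k * p * (1 + 2 * (1 / 20)) / 2"
    let ?sparse = "{\<rho>\<in>lifts n. \<exists>S. sparse_near_codeword (1 / 20) p n \<rho> S}"
    let ?heavy = "{\<rho>\<in>lifts n. \<exists>T\<in>PiE orbits (\<lambda>_. Pow {..<n}).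
        n ^ K < (\<Prod>c\<in>orbits. n choose card (T c)) \<and> card (check_sum n \<rho> T) \<le> N}"
    have Lp: "real (card (lifts n)) > 0" using card_lifts_pos by simp
    have "real (card ?sparse) \<le> card (lifts n) * exp (- p * n)"
      using param[rule_format, OF p y_def] by (intro few_lifts_with_sparse_near_codeword[OF p(1) y_def _ _ _ n0]) auto
    also have "\<dots> < card (lifts n) * (1 / 2)"
    proof (rule mult_strict_left_mono[OF _ Lp])
      have "ln 2 < p * n" using n(5) p by (simp add: field_simps)
      then have "exp (- (p * n)) < exp (- ln 2)" by simp
      then show "exp (- p * n) < 1 / 2" by (simp add: exp_minus)
    qed
    finally have sparse: "real (card ?sparse) < card (lifts n) * (1 / 2)" .
    have "real (card ?heavy) \<le> card (lifts n) * ((card Q * n + 1) ^ N * real n powr (- (K * g)) * C)"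
      unfolding C_def by (rule few_lifts_with_heavy_checks[OF g_def g n0])
    also have "\<dots> < card (lifts n) * (1 / 2)"
    proof (rule mult_strict_left_mono[OF _ Lp])
      have "real (card Q * n + 1) ^ N \<le> real ((card Q + 1) * n) ^ N"
        using n0 by (intro power_mono) (auto simp del: of_nat_add of_nat_mult)
      moreover have "real n powr (- (K * g)) \<le> real n powr (- (real N + 1))"
        using n(2) K by (intro powr_mono) auto
      ultimately have "real (card Q * n + 1) ^ N * real n powr (- (K * g)) \<le> real ((card Q + 1) * n) ^ N * real n powr (- (real N + 1))"
        by (intro mult_mono) auto
      also have "\<dots> = (card Q + 1) ^ N * (real n ^ N * real n powr (- (real N + 1)))"
        by (simp only: of_nat_mult of_nat_power power_mult_distrib mult.assoc)
      also have "real n ^ N * real n powr (- (real N + 1)) = 1 / n"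
        using n0 by (simp add: powr_realpow[symmetric] powr_add[symmetric] powr_minus divide_inverse)
      finally have "real (card Q * n + 1) ^ N * real n powr (- (K * g)) * C \<le> (card Q + 1) ^ N * (1 / n) * C"
        using C by (intro mult_right_mono) auto
      also have "\<dots> < 1 / 2" using n(4) n0 by (simp add: field_simps)
      finally show "(card Q * n + 1) ^ N * real n powr (- (K * g)) * C < 1 / 2" by simp
    qed
    finally have heavy: "real (card ?heavy) < card (lifts n) * (1 / 2)" .
    \<comment> \<open>Each bad event holds for less than half of the lifts, so some lift avoids
      both.\<close>
    have "card (?sparse \<union> ?heavy) < card (lifts n)"
    proof -
      have "real (card (?sparse \<union> ?heavy)) \<le> real (card ?sparse) + card ?heavy"
        using card_Un_le[of ?sparse ?heavy] by linarith
      then show ?thesis using sparse heavy by linarith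
    qed
    then have "\<not> lifts n \<subseteq> ?sparse \<union> ?heavy"
      using card_mono[of "?sparse \<union> ?heavy" "lifts n"] finite_lifts by (auto simp: not_le)
    then obtain \<rho> where \<rho>: "\<rho> \<in> lifts n" "\<rho> \<notin> ?sparse" "\<rho> \<notin> ?heavy" by blast
    have light: "light_lift n K (2 * card F) \<rho>"
      using \<rho> unfolding light_lift_def N_def by (auto simp: not_less)
    have inj: "inj_on (qact q) ((gam_nbhd d k ^^ Suc (2 * K)) F)" if "q \<in> Q" for q
      using Q(4)[OF that] unfolding Fs_def[symmetric] by (rule inj_on_subset) (simp add: Z_def)
    have BB: "card {u'\<in>{..<n}. \<not> independent_pair n \<rho> F (q, u) (q, u')} \<le> B" if q: "q \<in> Q" and u: "u < n" for q u
    proof -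
      have v: "(q, u) \<in> vertices n" if "u < n" for u using q that by (auto simp: vertices_def)
      have "{u'\<in>{..<n}. \<not> independent_pair n \<rho> F (q, u) (q, u')}
         \<subseteq> {u'\<in>{..<n}. lift_act n \<rho> (q, u) ` Fs \<inter> lift_act n \<rho> (q, u') ` Fs \<noteq> {}}"
        unfolding Fs_def using light_lift_independent_pair[OF \<rho>(1) light n(3) _ n(2) F inj v[OF u] v] n(1)
        by (auto simp: N_def)
      then have "card {u'\<in>{..<n}. \<not> independent_pair n \<rho> F (q, u) (q, u')}
        \<le> card {u'\<in>{..<n}. lift_act n \<rho> (q, u) ` Fs \<inter> lift_act n \<rho> (q, u') ` Fs \<noteq> {}}"
        by (intro card_mono) auto
      also have "\<dots> \<le> B" unfolding B_def by (rule card_overlapping_le[OF \<rho>(1) Fs v[OF u] q])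
      finally show ?thesis .
    qed
    define ev where "ev j = (if j = d then window_event d k F0 L else defect_event d k F0 L j)" for j
    have ev: "ev j \<subseteq> patterns3 F" for j by (auto simp: ev_def window_event_def defect_event_def F_def)
    let ?f = "\<lambda>(q, j) X. real (card {u\<in>{..<n}. view3 n \<rho> F (q, u) X \<in> ev j}) / n"
    have "\<exists>X\<in>code3 n \<rho>. \<forall>qj\<in>J. \<bar>?f qj X - (case qj of (q, j) \<Rightarrow> pattern_prob3 d k F (ev j))\<bar> < p / 40"
    proof (rule ex_codewords_with_frequencies)
      show "code3 n \<rho> \<noteq> {}" unfolding code3_def using zero_in_code by blast
      show "card J * (real B / n) < (p / 40)\<^sup>2"
        using n(6) n0 p by (simp add: field_simps)
      fix qj assume "qj \<in> J"
      then obtain q j where qj: "qj = (q, j)" "q \<in> Q" by (auto simp: J_def)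
      show "(\<Sum>X\<in>code3 n \<rho>. (?f qj X - (case qj of (q, j) \<Rightarrow> pattern_prob3 d k F (ev j)))\<^sup>2) \<le> card (code3 n \<rho>) * (real B / n)"
        using view_frequency_variance[OF \<rho>(1) F qj(2) n0 ev reg BB[OF qj(2)]] by (simp add: qj(1))
    qed (use finite_Q finite_code3 p in \<open>auto simp: J_def\<close>)
    then obtain X where X: "\<And>q j. q \<in> Q \<Longrightarrow> j < d + 1 \<Longrightarrow>
      \<bar>real (card {u\<in>{..<n}. view3 n \<rho> F (q, u) X \<in> ev j}) / n - pattern_prob3 d k F (ev j)\<bar> < p / 40"
      by (fastforce simp: J_def)
    define S where "S q = {u\<in>{..<n}. view3 n \<rho> F0 (q, u) X \<in> L}" for q
    have vq: "(q, u) \<in> vertices n" if "q \<in> Q" "u < n" for q u using that by (auto simp: vertices_def)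
    have S: "{u\<in>{..<n}. view3 n \<rho> F (q, u) X \<in> ev d} = S q" if q: "q \<in> Q" for q
      using window_view3[OF \<rho>(1) vq[OF q] F0(2), where X = X and L = L] by (auto simp: ev_def S_def F_def)
    have "sparse_near_codeword (1 / 20) p n \<rho> S"
      unfolding sparse_near_codeword_def
    proof (intro conjI ballI allI impI)
      fix q assume q: "q \<in> Q"
      show "S q \<subseteq> {..<n}" by (auto simp: S_def)
      have "\<bar>real (card (S q)) / n - pattern_prob3 d k F (ev d)\<bar> < p / 40"
        using X[OF q, of d] unfolding S[OF q] by simp
      \<comment> \<open>The sampling error p/40 and the error p/40 of the local rule add up to the
        tolerance 1/20.\<close>
      then have "\<bar>real (card (S q)) / n - p\<bar> < p / 20"
        using win unfolding ev_def F_def if_P[OF refl] by linarith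
      then have "(1 - 1 / 20) * p \<le> real (card (S q)) / n \<and> real (card (S q)) / n \<le> (1 + 1 / 20) * p"
        unfolding left_diff_distrib distrib_right by linarith
      then show "(1 - 1 / 20) * p * real n \<le> real (card (S q))" "real (card (S q)) \<le> (1 + 1 / 20) * p * real n"
        using n0 by (simp_all add: field_simps)
    next
      fix i c assume i: "i < d" and "c \<in> orb i ` Q"
      then obtain q where q: "q \<in> Q" "c = orb i q" by blast
      have "card {m\<in>{..<n}. odd (card {q'\<in>c. m \<in> \<rho> q' i ` S q'})}
        = card {u\<in>{..<n}. odd (card {j\<in>{..<k}. view3 n \<rho> F0 (lift_act n \<rho> (q, u) (gpow i j)) X \<in> L})}"
        unfolding q(2) S_def by (rule card_odd_checks[OF \<rho>(1) i q(1)])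
      also have "\<dots> = card {u\<in>{..<n}. view3 n \<rho> F (q, u) X \<in> ev i}"
        using defect_view3[OF \<rho>(1) vq[OF q(1)] F0(2) i, where X = X and L = L] i by (intro arg_cong[where f = card]) (auto simp: ev_def F_def)
      finally have eq: "card {m\<in>{..<n}. odd (card {q'\<in>c. m \<in> \<rho> q' i ` S q'})} = card {u\<in>{..<n}. view3 n \<rho> F (q, u) X \<in> ev i}" .
      have "real (card {u\<in>{..<n}. view3 n \<rho> F (q, u) X \<in> ev i}) / n < p / 40 + p / 40"
      proof -
        have "pattern_prob3 d k F (ev i) \<le> p / 40" using defect i by (simp add: ev_def F_def)
        moreover have "i < d + 1" using i by simp
        ultimately show ?thesis using X[OF q(1), of i] by linarith
      qed
      also have "\<dots> = 1 / 20 * 1 * p" by simp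
      also have "\<dots> \<le> 1 / 20 * real k * p" using k p by (intro mult_right_mono mult_left_mono) auto
      finally have "real (card {u\<in>{..<n}. view3 n \<rho> F (q, u) X \<in> ev i}) \<le> 1 / 20 * real k * p * n"
        using n0 by (simp add: field_simps)
      then show "real (card {m\<in>{..<n}. odd (card {q'\<in>c. m \<in> \<rho> q' i ` S q'})}) \<le> 1 / 20 * real k * p * real n"
        unfolding eq .
    qed
    then show False using \<rho>(1,2) by blast
  qed
  show ?thesis
    by (intro exI[of _ \<delta>] conjI \<delta> allI impI) (rule main)
qed

section \<open>The Haar measure of the parity group\<close>

text \<open>The approximable sets form a sigma-algebra. A countable union is first truncated at a
  cost of \<epsilon>/2, and the remaining \<epsilon>/2 is divided among the finitely many sets
  kept.\<close>

lemma approximation_by_algebra: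
  assumes M: "finite_measure M" and A: "algebra (space M) \<A>" "\<A> \<subseteq> sets M"
    and E: "E \<in> sigma_sets (space M) \<A>" and "\<epsilon> > 0"
  shows "\<exists>B\<in>\<A>. measure M (sym_diff E B) < \<epsilon>"
proof -
  interpret finite_measure M by fact
  interpret A: algebra "space M" \<A> by fact
  have sub: "sigma_sets (space M) \<A> \<subseteq> sets M"
    using A(2) sets.sigma_sets_subset by blast
  show ?thesis using E \<open>\<epsilon> > 0\<close>
  proof (induction arbitrary: \<epsilon> rule: sigma_sets.induct)
    case (Basic a)
    then show ?case by (intro bexI[of _ a]) auto
  next
    case Empty
    then show ?case by (intro bexI[of _ "{}"]) auto
  next
    case (Compl a)
    obtain B where B: "B \<in> \<A>" "measure M (sym_diff a B) < \<epsilon>" using Compl by blast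
    have "a \<subseteq> space M" "B \<subseteq> space M" using sets.sets_into_space sub Compl(1) B(1) A(2) by blast+
    then have "sym_diff (space M - a) (space M - B) = sym_diff a B" by blast
    then show ?case using B by (intro bexI[of _ "space M - B"]) auto
  next
    case (Union a)
    let ?U = "\<Union>i. a i"
    have am: "a i \<in> sets M" for i using Union(1) sub by blast
    have "(\<lambda>n. measure M (\<Union>i\<le>n. a i)) \<longlonglongrightarrow> measure M (\<Union>n. \<Union>i\<le>n. a i)"
    proof (rule finite_Lim_measure_incseq)
      show "range (\<lambda>n. \<Union>i\<le>n. a i) \<subseteq> sets M" using am by auto
      show "incseq (\<lambda>n. \<Union>i\<le>n. a i)" by (intro incseq_SucI UN_mono) auto
    qed
    moreover have "(\<Union>n. \<Union>i\<le>n. a i) = ?U" by blast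
    ultimately have "(\<lambda>n. measure M (\<Union>i\<le>n. a i)) \<longlonglongrightarrow> measure M ?U" by simp
    from order_tendstoD(1)[OF this, of "measure M ?U - \<epsilon> / 2"] Union(3)
    obtain n where n: "measure M ?U - \<epsilon> / 2 < measure M (\<Union>i\<le>n. a i)"
      by (auto simp: eventually_sequentially)
    have "\<exists>B\<in>\<A>. measure M (sym_diff (a i) B) < \<epsilon> / (2 * (n + 1))" for i
      using Union(2)[of "\<epsilon> / (2 * (n + 1))" i] Union(3) by simp
    then obtain B where B: "\<And>i. B i \<in> \<A>" "\<And>i. measure M (sym_diff (a i) (B i)) < \<epsilon> / (2 * (n + 1))" by metis
    let ?V = "\<Union>i\<le>n. a i" and ?B = "\<Union>i\<le>n. B i"
    have Bm: "B i \<in> sets M" for i using B(1) A(2) by blast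
    have BA: "?B \<in> \<A>" using B(1) by (intro A.finite_UN) auto
    have "measure M (sym_diff ?U ?B) \<le> measure M ((?U - ?V) \<union> (\<Union>i\<le>n. sym_diff (a i) (B i)))"
      using am Bm by (intro finite_measure_mono) blast+
    also have "\<dots> \<le> measure M (?U - ?V) + measure M (\<Union>i\<le>n. sym_diff (a i) (B i))"
      using am Bm by (intro measure_Un_le) auto
    also have "measure M (?U - ?V) = measure M ?U - measure M ?V"
      using am by (intro finite_measure_Diff) auto
    also have "measure M (\<Union>i\<le>n. sym_diff (a i) (B i)) \<le> (\<Sum>i\<le>n. measure M (sym_diff (a i) (B i)))"
      using am Bm by (intro finite_measure_subadditive_finite) auto
    also have "\<dots> \<le> (\<Sum>i\<le>n. \<epsilon> / (2 * (n + 1)))"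
      by (intro sum_mono less_imp_le B(2))
    also have "\<dots> = \<epsilon> / 2" by (simp add: field_simps)
    finally have "measure M (sym_diff ?U ?B) < \<epsilon>" using n by linarith
    then show ?case using BA by blast
  qed
qed

locale parity_haar =
  fixes d k :: nat and m :: "(gword set \<Rightarrow> bit) measure"
  assumes d_gt_0: "d > 0" and k_gt_1: "k > 1"
    and haar: "haar_prob_measure (parity_group d k) (parity_topology d k) m"
begin

abbreviation "\<Gamma> \<equiv> Gam d k"
abbreviation "X \<equiv> parity_set d k"

sublocale Gam: group \<Gamma> by (rule group_Gam)

sublocale prob_space m using haar by (simp add: haar_prob_measure_def)

lemma topspace_parity: "topspace (parity_topology d k) = X"
  by (auto simp: parity_topology_def parity_set_def)

lemma space_m: "space m = X"
  using haar by (simp add: haar_prob_measure_def topspace_parity)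

lemma sets_m: "sets m = sigma_sets X {U. openin (parity_topology d k) U}"
proof -
  have "{U. openin (parity_topology d k) U} \<subseteq> Pow X"
    using openin_subset[of "parity_topology d k"] by (auto simp: topspace_parity)
  then show ?thesis using haar by (simp add: haar_prob_measure_def borel_of_def topspace_parity)
qed

definition cyl :: "gword set set \<Rightarrow> (gword set \<Rightarrow> bit) \<Rightarrow> (gword set \<Rightarrow> bit) set" where
  "cyl F p = {x \<in> X. \<forall>g\<in>F. x g = p g}"

lemma cyl_open:
  assumes "finite F" "F \<subseteq> carrier \<Gamma>"
  shows "openin (parity_topology d k) (cyl F p)"
proof -
  let ?U = "\<lambda>g. if g \<in> F then {p g} else UNIV"
  have "openin (product_topology (\<lambda>_. discrete_topology (UNIV :: bit set)) (carrier \<Gamma>)) (PiE (carrier \<Gamma>) ?U)"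
    unfolding openin_PiE_gen
  proof (intro disjI2 conjI)
    show "finite {i \<in> carrier \<Gamma>. ?U i \<noteq> topspace (discrete_topology (UNIV :: bit set))}"
      by (rule finite_subset[OF _ assms(1)]) auto
  qed auto
  moreover have "cyl F p = PiE (carrier \<Gamma>) ?U \<inter> X"
    using assms(2) by (auto simp: cyl_def parity_set_def PiE_iff extensional_def split: if_splits)
  ultimately show ?thesis unfolding parity_topology_def openin_subtopology by blast
qed

lemma cyl_sets: "finite F \<Longrightarrow> F \<subseteq> carrier \<Gamma> \<Longrightarrow> cyl F p \<in> sets m"
  unfolding sets_m using cyl_open by (intro sigma_sets.Basic) simp

text \<open>Patterns restricted to \<open>F\<close> make the family countable, and the empty set
  makes it closed under intersection when patterns conflict.\<close>

definition cyls :: "(gword set \<Rightarrow> bit) set set" where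
  "cyls = insert {} ((\<lambda>(F, p). cyl F p) ` (SIGMA F:{F. finite F \<and> F \<subseteq> carrier \<Gamma>}. PiE F (\<lambda>_. UNIV)))"

lemma countable_cyls: "countable cyls"
proof -
  have "countable {F. finite F \<and> F \<subseteq> carrier \<Gamma>}"
    using countable_Collect_finite_subset[OF countable_carrier_Gam] by simp
  then show ?thesis unfolding cyls_def
    by (intro countable_insert countable_image countable_SIGMA) (auto intro!: countable_finite finite_PiE finite_UNIV_bit)
qed

text \<open>Cylinders are a countable base, so they generate the Borel sets.\<close>

lemma open_eq_Union_cyls:
  assumes U: "openin (parity_topology d k) U"
  shows "U = \<Union>{C\<in>cyls. C \<subseteq> U}"
proof (intro equalityI subsetI)
  fix x assume x: "x \<in> U"
  obtain V where V: "openin (product_topology (\<lambda>_. discrete_topology (UNIV :: bit set)) (carrier \<Gamma>)) V" "U = V \<inter> X"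
    using U unfolding parity_topology_def openin_subtopology by blast
  obtain W where W: "finite {i \<in> carrier \<Gamma>. W i \<noteq> topspace (discrete_topology (UNIV :: bit set))}" "x \<in> PiE (carrier \<Gamma>) W" "PiE (carrier \<Gamma>) W \<subseteq> V"
    using V x unfolding openin_product_topology_alt by blast
  define F where "F = {i \<in> carrier \<Gamma>. W i \<noteq> UNIV}"
  have F: "finite F" "F \<subseteq> carrier \<Gamma>" using W(1) by (auto simp: F_def)
  have "cyl F (restrict x F) \<subseteq> PiE (carrier \<Gamma>) W"
  proof
    fix y assume y: "y \<in> cyl F (restrict x F)"
    have "y g \<in> W g" if g: "g \<in> carrier \<Gamma>" for g
    proof (cases "g \<in> F")
      case True
      then have "y g = x g" using y by (simp add: cyl_def)
      then show ?thesis using W(2) g by auto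
    qed (use g in \<open>simp add: F_def\<close>)
    then show "y \<in> PiE (carrier \<Gamma>) W" using y by (auto simp: cyl_def parity_set_def)
  qed
  then have "cyl F (restrict x F) \<subseteq> U" using W(3) V(2) by (auto simp: cyl_def)
  moreover have "x \<in> cyl F (restrict x F)" using x V(2) by (auto simp: cyl_def)
  moreover have "cyl F (restrict x F) \<in> cyls"
    unfolding cyls_def using F by (intro insertI2 image_eqI[of _ _ "(F, restrict x F)"]) auto
  ultimately show "x \<in> \<Union>{C\<in>cyls. C \<subseteq> U}" by blast
qed auto

lemma cyls_sets: "cyls \<subseteq> sets m"
  using cyl_sets by (auto simp: cyls_def)

lemma sets_m_cyls: "sets m = sigma_sets X cyls"
proof
  have "cyls \<subseteq> Pow X" by (auto simp: cyls_def cyl_def)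
  show "sets m \<subseteq> sigma_sets X cyls"
    unfolding sets_m
  proof (rule sigma_sets_mono)
    show "{U. openin (parity_topology d k) U} \<subseteq> sigma_sets X cyls"
    proof
      fix U assume "U \<in> {U. openin (parity_topology d k) U}"
      then have "U = \<Union>{C\<in>cyls. C \<subseteq> U}" using open_eq_Union_cyls by blast
      moreover have "\<Union>{C\<in>cyls. C \<subseteq> U} \<in> sigma_sets X cyls"
        by (rule sigma_sets_UNION) (auto intro!: countable_subset[OF _ countable_cyls] sigma_sets.Basic)
      ultimately show "U \<in> sigma_sets X cyls" by simp
    qed
  qed
  show "sigma_sets X cyls \<subseteq> sets m"
    using sets.sigma_sets_subset[OF cyls_sets] by (simp add: space_m)
qed

lemma Int_stable_cyls: "Int_stable cyls"
proof (rule Int_stableI)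
  fix A B assume "A \<in> cyls" "B \<in> cyls"
  show "A \<inter> B \<in> cyls"
  proof (cases "A \<inter> B = {}")
    case False
    then obtain x where x: "x \<in> A" "x \<in> B" by blast
    obtain F p where F: "A = cyl F p" "finite F" "F \<subseteq> carrier \<Gamma>" using \<open>A \<in> cyls\<close> x by (auto simp: cyls_def)
    obtain F' p' where F': "B = cyl F' p'" "finite F'" "F' \<subseteq> carrier \<Gamma>" using \<open>B \<in> cyls\<close> x by (auto simp: cyls_def)
    have "A \<inter> B = cyl (F \<union> F') (restrict x (F \<union> F'))"
      using x unfolding F(1) F'(1) by (auto simp: cyl_def)
    moreover have "cyl (F \<union> F') (restrict x (F \<union> F')) \<in> cyls"
      unfolding cyls_def using F F' by (intro insertI2 image_eqI[of _ _ "(F \<union> F', restrict x (F \<union> F'))"]) auto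
    ultimately show ?thesis by simp
  qed (simp add: cyls_def)
qed

lemma coordinate_measurable: "g \<in> carrier \<Gamma> \<Longrightarrow> (\<lambda>x. x g) \<in> measurable m (count_space UNIV)"
proof (rule measurableI)
  fix A :: "bit set" assume g: "g \<in> carrier \<Gamma>"
  have "(\<lambda>x. x g) -` A \<inter> space m = (\<Union>b\<in>A. cyl {g} (\<lambda>_. b))" by (auto simp: cyl_def space_m)
  then show "(\<lambda>x. x g) -` A \<inter> space m \<in> sets m"
    using g cyl_sets[of "{g}"] finite_subset[OF subset_UNIV finite_UNIV_bit] by auto
qed auto

definition character :: "gword set set \<Rightarrow> (gword set \<Rightarrow> bit) \<Rightarrow> real" where
  "character A x = bit_sgn (sum x A)"

lemma sum_measurable:
  assumes "finite A" "A \<subseteq> carrier \<Gamma>"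
  shows "(\<lambda>x. sum x A) \<in> measurable m (count_space UNIV)"
  using assms
proof (induction A rule: finite_induct)
  case (insert g A)
  then have "(\<lambda>x. (x g, sum x A)) \<in> measurable m (count_space UNIV \<Otimes>\<^sub>M count_space UNIV)"
    using coordinate_measurable by (intro measurable_Pair) auto
  moreover have "(\<lambda>(a, b). a + b :: bit) \<in> measurable (count_space UNIV \<Otimes>\<^sub>M count_space UNIV) (count_space UNIV)"
    by (subst pair_measure_countable) (auto intro!: countable_finite finite_UNIV_bit)
  ultimately have "(\<lambda>(a, b). a + b) \<circ> (\<lambda>x. (x g, sum x A)) \<in> measurable m (count_space UNIV)"
    by (rule measurable_comp)
  then show ?case using insert by (simp add: o_def)
qed simp

lemma character_measurable:
  assumes "finite A" "A \<subseteq> carrier \<Gamma>"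
  shows "character A \<in> borel_measurable m"
  unfolding character_def[abs_def] using sum_measurable[OF assms]
  by (rule measurable_compose) simp

lemma character_integrable:
  assumes "finite A" "A \<subseteq> carrier \<Gamma>"
  shows "integrable m (character A)"
  by (rule integrable_const_bound[of _ 1]) (auto simp: character_measurable[OF assms], auto simp: character_def bit_sgn_def)

text \<open>Invariance of \<open>m\<close> is used only here. Translation by a point of X on which
  the character is -1 exchanges its two level sets, which therefore have equal measure.\<close>

lemma integral_character:
  assumes A: "finite A" "A \<subseteq> carrier \<Gamma>"
  shows "integral\<^sup>L m (character A) = of_bool (null_set_of d k A)"
proof (cases "null_set_of d k A")
  case True
  have "integral\<^sup>L m (character A) = integral\<^sup>L m (\<lambda>_. 1)"
    using True by (intro Bochner_Integration.integral_cong) (auto simp: character_def null_set_of_def space_m)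
  then show ?thesis using True prob_space by simp
next
  case False
  then obtain a where a: "a \<in> X" "sum a A = 1" by (auto simp: null_set_of_def)
  let ?E = "\<lambda>b. {x\<in>space m. sum x A = b}"
  have E: "?E b \<in> sets m" for b
    using measurable_sets[OF sum_measurable[OF A], of "{b}"] by (simp add: vimage_def Int_def conj_commute)
  define t where "t x = a \<otimes>\<^bsub>parity_group d k\<^esub> x" for x
  have t: "t x = (\<lambda>g\<in>carrier \<Gamma>. a g + x g)" for x
    by (simp add: t_def parity_group_def product_group_def Z2_group_def)
  have tX: "t x \<in> X" if "x \<in> X" for x
    using subgroup.m_closed[OF subgroup_parity_set a(1) that] by (simp add: t_def parity_group_def)
  have tt: "t (t x) = x" if "x \<in> X" for x
  proof
    fix g
    have "x g = undefined" if "g \<notin> carrier \<Gamma>" using \<open>x \<in> X\<close> that by (auto simp: parity_set_def)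
    then show "t (t x) g = x g" by (auto simp: t add.assoc[symmetric])
  qed
  have tsum: "sum (t x) A = 1 + sum x A" for x
  proof -
    have "sum (t x) A = (\<Sum>g\<in>A. a g + x g)" using A(2) by (intro sum.cong) (auto simp: t)
    then show ?thesis by (simp add: sum.distrib a(2))
  qed
  have "t ` ?E 0 = ?E 1"
  proof (intro equalityI subsetI)
    fix y assume "y \<in> ?E 1"
    then have "t y \<in> ?E 0" "y = t (t y)" using tX tt tsum by (auto simp: space_m)
    then show "y \<in> t ` ?E 0" by blast
  qed (use tX tsum in \<open>auto simp: space_m\<close>)
  moreover have "emeasure m (t ` ?E 0) = emeasure m (?E 0)"
    using haar a(1) E unfolding haar_prob_measure_def t_def by (auto simp: parity_group_def)
  ultimately have eq: "measure m (?E 0) = measure m (?E 1)" by (simp add: measure_def)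
  have "integral\<^sup>L m (character A) = integral\<^sup>L m (\<lambda>x. indicator (?E 0) x - indicator (?E 1) x)"
  proof (intro Bochner_Integration.integral_cong refl)
    fix x assume "x \<in> space m"
    then show "character A x = indicator (?E 0) x - indicator (?E 1) x"
      by (cases "sum x A = 0") (auto simp: character_def indicator_def)
  qed
  also have "\<dots> = measure m (?E 0) - measure m (?E 1)"
    using E[of 0] E[of 1] by (subst Bochner_Integration.integral_diff) (auto simp: less_top[symmetric])
  finally show ?thesis using False eq by simp
qed

text \<open>Integrating the Fourier expansion of the indicator gives the same sum that governs views
  of codewords. This is the link between Haar points and the finite code.\<close>

lemma measure_cyl:
  assumes F: "finite F" "F \<subseteq> carrier \<Gamma>"
  shows "measure m (cyl F p) = pattern_prob d k F p"
proof -
  have sub: "finite A" "A \<subseteq> carrier \<Gamma>" if "A \<in> Pow F" for A using that F finite_subset by auto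
  have "measure m (cyl F p) = integral\<^sup>L m (indicator (cyl F p))"
    using cyl_sets[OF F] by simp
  also have "\<dots> = integral\<^sup>L m (\<lambda>x. (\<Sum>A\<in>Pow F. character A x * bit_sgn (sum p A)) / 2 ^ card F)"
  proof (intro Bochner_Integration.integral_cong refl)
    fix x assume "x \<in> space m"
    then have "indicator (cyl F p) x = (of_bool (\<forall>g\<in>F. x g = p g) :: real)"
      by (auto simp: cyl_def space_m indicator_def)
    then show "indicator (cyl F p) x = (\<Sum>A\<in>Pow F. character A x * bit_sgn (sum p A)) / 2 ^ card F"
      unfolding character_def by (simp only: pattern_indicator[OF F(1)])
  qed
  also have "\<dots> = (\<Sum>A\<in>Pow F. integral\<^sup>L m (character A) * bit_sgn (sum p A)) / 2 ^ card F"
    using character_integrable[OF sub] by (simp add: Bochner_Integration.integral_sum)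
  also have "\<dots> = pattern_prob d k F p"
    unfolding pattern_prob_def using integral_character[OF sub] by simp
  finally show ?thesis .
qed

end

section \<open>Shift invariance and triples of independent Haar points\<close>

context parity_haar
begin

definition transl :: "gword set \<Rightarrow> (gword set \<Rightarrow> bit) \<Rightarrow> gword set \<Rightarrow> bit" where
  "transl g = shift_action \<Gamma> g"

lemma transl_apply: "h \<in> carrier \<Gamma> \<Longrightarrow> transl g x h = x (inv\<^bsub>\<Gamma>\<^esub> g \<otimes>\<^bsub>\<Gamma>\<^esub> h)"
  by (simp add: transl_def shift_action_def)

lemma transl_parity_set:
  assumes g: "g \<in> carrier \<Gamma>" and x: "x \<in> X"
  shows "transl g x \<in> X"
proof -
  have "(\<Sum>j<k. transl g x (h \<otimes>\<^bsub>\<Gamma>\<^esub> (gen d k i [^]\<^bsub>\<Gamma>\<^esub> j))) = 0" if h: "h \<in> carrier \<Gamma>" and i: "i < d" for h i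
  proof -
    have "(\<Sum>j<k. transl g x (h \<otimes>\<^bsub>\<Gamma>\<^esub> (gen d k i [^]\<^bsub>\<Gamma>\<^esub> j))) = (\<Sum>j<k. x ((inv\<^bsub>\<Gamma>\<^esub> g \<otimes>\<^bsub>\<Gamma>\<^esub> h) \<otimes>\<^bsub>\<Gamma>\<^esub> (gen d k i [^]\<^bsub>\<Gamma>\<^esub> j)))"
      using g h gen_pow_closed[OF i] by (intro sum.cong refl) (simp add: transl_apply Gam.m_assoc)
    also have "\<dots> = 0" using x g h i by (simp add: parity_set_def)
    finally show ?thesis .
  qed
  then show ?thesis by (simp add: parity_set_def transl_def shift_action_def)
qed

lemma transl_one: "x \<in> X \<Longrightarrow> transl \<one>\<^bsub>\<Gamma>\<^esub> x = x"
proof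
  fix h assume x: "x \<in> X"
  show "transl \<one>\<^bsub>\<Gamma>\<^esub> x h = x h"
    using x by (cases "h \<in> carrier \<Gamma>") (auto simp: transl_def shift_action_def parity_set_def)
qed

lemma transl_mult:
  assumes "g \<in> carrier \<Gamma>" "h \<in> carrier \<Gamma>"
  shows "transl (g \<otimes>\<^bsub>\<Gamma>\<^esub> h) x = transl g (transl h x)"
  using assms unfolding transl_def shift_action_def
  by (intro restrict_ext) (simp add: Gam.inv_mult_group Gam.m_assoc)

lemma transl_vimage_cyl:
  assumes g: "g \<in> carrier \<Gamma>" and F: "F \<subseteq> carrier \<Gamma>"
  shows "transl g -` cyl F p \<inter> X = cyl ((\<lambda>h. inv\<^bsub>\<Gamma>\<^esub> g \<otimes>\<^bsub>\<Gamma>\<^esub> h) ` F) (\<lambda>h. p (g \<otimes>\<^bsub>\<Gamma>\<^esub> h))"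
proof -
  have "g \<otimes>\<^bsub>\<Gamma>\<^esub> (inv\<^bsub>\<Gamma>\<^esub> g \<otimes>\<^bsub>\<Gamma>\<^esub> h) = h" if "h \<in> F" for h
    using g F that by (simp add: Gam.m_assoc[symmetric] subset_iff)
  then show ?thesis
    using transl_parity_set[OF g] F by (auto simp: cyl_def transl_apply subset_iff)
qed

lemma transl_measurable:
  assumes g: "g \<in> carrier \<Gamma>"
  shows "transl g \<in> measurable m m"
proof (rule measurable_sigma_sets)
  show "sets m = sigma_sets X cyls" by (rule sets_m_cyls)
  show "cyls \<subseteq> Pow X" by (auto simp: cyls_def cyl_def)
  show "transl g \<in> space m \<rightarrow> X" using transl_parity_set[OF g] by (auto simp: space_m)
  fix C assume "C \<in> cyls"
  then consider "C = {}" | F p where "finite F" "F \<subseteq> carrier \<Gamma>" "C = cyl F p" by (auto simp: cyls_def)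
  then show "transl g -` C \<inter> space m \<in> sets m"
  proof cases
    case 2
    show ?thesis unfolding 2(3) space_m transl_vimage_cyl[OF g 2(2)]
      using 2 g by (intro cyl_sets) auto
  qed simp
qed

lemma null_set_of_transl:
  assumes g: "g \<in> carrier \<Gamma>" and A: "A \<subseteq> carrier \<Gamma>"
  shows "null_set_of d k ((\<lambda>h. g \<otimes>\<^bsub>\<Gamma>\<^esub> h) ` A) \<longleftrightarrow> null_set_of d k A"
proof -
  have imp: "null_set_of d k ((\<lambda>h. g \<otimes>\<^bsub>\<Gamma>\<^esub> h) ` A)" if g: "g \<in> carrier \<Gamma>" and A: "A \<subseteq> carrier \<Gamma>" and N: "null_set_of d k A" for g A
    unfolding null_set_of_def
  proof
    fix a assume a: "a \<in> X"
    have "sum a ((\<lambda>h. g \<otimes>\<^bsub>\<Gamma>\<^esub> h) ` A) = (\<Sum>h\<in>A. a (g \<otimes>\<^bsub>\<Gamma>\<^esub> h))"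
      using g A by (intro sum.reindex[unfolded o_def]) (auto simp: inj_on_def subset_iff)
    also have "\<dots> = sum (transl (inv\<^bsub>\<Gamma>\<^esub> g) a) A"
      using g A by (intro sum.cong) (auto simp: transl_apply subset_iff)
    also have "\<dots> = 0" using N transl_parity_set[of "inv\<^bsub>\<Gamma>\<^esub> g" a] g a by (auto simp: null_set_of_def)
    finally show "sum a ((\<lambda>h. g \<otimes>\<^bsub>\<Gamma>\<^esub> h) ` A) = 0" .
  qed
  have "(\<lambda>h. inv\<^bsub>\<Gamma>\<^esub> g \<otimes>\<^bsub>\<Gamma>\<^esub> h) ` (\<lambda>h. g \<otimes>\<^bsub>\<Gamma>\<^esub> h) ` A = A"
  proof -
    have "inv\<^bsub>\<Gamma>\<^esub> g \<otimes>\<^bsub>\<Gamma>\<^esub> (g \<otimes>\<^bsub>\<Gamma>\<^esub> h) = h" if "h \<in> A" for h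
      using g A that by (simp add: Gam.m_assoc[symmetric] subset_iff)
    then show ?thesis by (simp add: image_image)
  qed
  moreover have "(\<lambda>h. g \<otimes>\<^bsub>\<Gamma>\<^esub> h) ` A \<subseteq> carrier \<Gamma>" using g A by auto
  ultimately show ?thesis using imp[OF g A] imp[of "inv\<^bsub>\<Gamma>\<^esub> g" "(\<lambda>h. g \<otimes>\<^bsub>\<Gamma>\<^esub> h) ` A"] g by auto
qed

lemma pattern_prob_transl:
  assumes g: "g \<in> carrier \<Gamma>" and F: "F \<subseteq> carrier \<Gamma>" "finite F"
  shows "pattern_prob d k ((\<lambda>h. g \<otimes>\<^bsub>\<Gamma>\<^esub> h) ` F) p = pattern_prob d k F (\<lambda>h. p (g \<otimes>\<^bsub>\<Gamma>\<^esub> h))"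
proof -
  let ?t = "\<lambda>h. g \<otimes>\<^bsub>\<Gamma>\<^esub> h"
  have inj: "inj_on ?t F" using g F by (auto simp: inj_on_def subset_iff)
  have "(\<Sum>A\<in>Pow (?t ` F). of_bool (null_set_of d k A) * bit_sgn (sum p A))
    = (\<Sum>A\<in>image ?t ` Pow F. of_bool (null_set_of d k A) * bit_sgn (sum p A))"
    by (simp only: image_Pow_surj[OF HOL.refl])
  also have "\<dots> = (\<Sum>A\<in>Pow F. of_bool (null_set_of d k (?t ` A)) * bit_sgn (sum p (?t ` A)))"
    by (rule sum.reindex[OF inj_on_image_Pow[OF inj], unfolded o_def])
  also have "\<dots> = (\<Sum>A\<in>Pow F. of_bool (null_set_of d k A) * bit_sgn (\<Sum>h\<in>A. p (?t h)))"
  proof (rule sum.cong)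
    fix A assume "A \<in> Pow F"
    then have A: "A \<subseteq> F" by simp
    have "sum p (?t ` A) = (\<Sum>h\<in>A. p (?t h))"
      by (rule sum.reindex[OF inj_on_subset[OF inj A], unfolded o_def])
    then show "of_bool (null_set_of d k (?t ` A)) * bit_sgn (sum p (?t ` A)) = of_bool (null_set_of d k A) * bit_sgn (\<Sum>h\<in>A. p (?t h))"
      using null_set_of_transl[OF g, of A] A F by simp
  qed simp
  finally show ?thesis by (simp add: pattern_prob_def card_image[OF inj])
qed

text \<open>The annihilator of X is shift invariant, hence so are pattern probabilities;
  \<open>m\<close> and its image agree on an intersection-stable generator.\<close>

lemma transl_preserves:
  assumes g: "g \<in> carrier \<Gamma>"
  shows "distr m m (transl g) = m"
proof (rule measure_eqI_generator_eq[OF Int_stable_cyls, of X _ _ "\<lambda>_. X"])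
  show "cyls \<subseteq> Pow X" by (auto simp: cyls_def cyl_def)
  show "sets (distr m m (transl g)) = sigma_sets X cyls" "sets m = sigma_sets X cyls"
    by (simp_all add: sets_m_cyls)
  have "X = cyl {} (restrict undefined {})" by (auto simp: cyl_def)
  then have "X \<in> cyls"
    unfolding cyls_def by (intro insertI2 image_eqI[of _ _ "({}, restrict undefined {})"]) auto
  then show "range (\<lambda>_. X) \<subseteq> cyls" by auto
  show "(\<Union>i::nat. X) = X" by simp
  show "emeasure (distr m m (transl g)) X \<noteq> \<infinity>" for i :: nat
    using transl_measurable[OF g] space_m sets.top[of m] by (simp add: emeasure_distr)
  fix C assume C: "C \<in> cyls"
  then consider "C = {}" | F p where "finite F" "F \<subseteq> carrier \<Gamma>" "C = cyl F p" by (auto simp: cyls_def)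
  then show "emeasure (distr m m (transl g)) C = emeasure m C"
  proof cases
    case 2
    let ?t = "\<lambda>h. inv\<^bsub>\<Gamma>\<^esub> g \<otimes>\<^bsub>\<Gamma>\<^esub> h"
    have tF: "finite (?t ` F)" "?t ` F \<subseteq> carrier \<Gamma>" using 2 g by auto
    have "emeasure (distr m m (transl g)) C = emeasure m (cyl (?t ` F) (\<lambda>h. p (g \<otimes>\<^bsub>\<Gamma>\<^esub> h)))"
      using C cyls_sets transl_vimage_cyl[OF g 2(2), of p] transl_measurable[OF g] unfolding 2(3)
      by (subst emeasure_distr) (auto simp: space_m)
    also have "\<dots> = pattern_prob d k (?t ` F) (\<lambda>h. p (g \<otimes>\<^bsub>\<Gamma>\<^esub> h))"
      by (simp only: emeasure_eq_measure measure_cyl[OF tF])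
    also have "\<dots> = pattern_prob d k F (\<lambda>h. p (g \<otimes>\<^bsub>\<Gamma>\<^esub> ?t h))"
      using pattern_prob_transl[of "inv\<^bsub>\<Gamma>\<^esub> g" F] g 2 by simp
    also have "\<dots> = measure m (cyl F (\<lambda>h. p (g \<otimes>\<^bsub>\<Gamma>\<^esub> ?t h)))"
      by (simp only: measure_cyl[OF 2(1,2)])
    also have "cyl F (\<lambda>h. p (g \<otimes>\<^bsub>\<Gamma>\<^esub> ?t h)) = C"
    proof -
      have "g \<otimes>\<^bsub>\<Gamma>\<^esub> ?t h = h" if "h \<in> F" for h
        using g 2 that by (simp add: Gam.m_assoc[symmetric] subset_iff)
      then show ?thesis unfolding 2(3) cyl_def by auto
    qed
    finally show ?thesis by (simp only: emeasure_eq_measure)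
  qed simp
qed

definition m3 :: "((gword set \<Rightarrow> bit) \<times> (gword set \<Rightarrow> bit) \<times> (gword set \<Rightarrow> bit)) measure" where
  "m3 = m \<Otimes>\<^sub>M (m \<Otimes>\<^sub>M m)"

definition restr3 where "restr3 F \<omega> = (restrict (fst \<omega>) F, restrict (fst (snd \<omega>)) F, restrict (snd (snd \<omega>)) F)"

definition transl3 where "transl3 g \<omega> = (transl g (fst \<omega>), transl g (fst (snd \<omega>)), transl g (snd (snd \<omega>)))"

lemma space_m3: "space m3 = X \<times> X \<times> X"
  by (simp add: m3_def space_pair_measure space_m)

sublocale mm: pair_prob_space m m ..

sublocale mm3: pair_prob_space m "m \<Otimes>\<^sub>M m" ..

lemma prob_space_m3: "prob_space m3"
  unfolding m3_def by (rule mm3.prob_space_axioms)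

definition local_set where "local_set F L = {\<omega> \<in> space m3. restr3 F \<omega> \<in> L}"

lemma local_set_decomp:
  "local_set F L = (\<Union>P\<in>L \<inter> patterns3 F. cyl F (fst P) \<times> cyl F (fst (snd P)) \<times> cyl F (snd (snd P)))"
proof (intro equalityI subsetI)
  fix \<omega> assume "\<omega> \<in> local_set F L"
  then have w: "\<omega> \<in> X \<times> X \<times> X" "restr3 F \<omega> \<in> L" by (auto simp: local_set_def space_m3)
  have "restr3 F \<omega> \<in> patterns3 F" by (simp add: patterns3_def restr3_def)
  moreover have "\<omega> \<in> cyl F (fst (restr3 F \<omega>)) \<times> cyl F (fst (snd (restr3 F \<omega>))) \<times> cyl F (snd (snd (restr3 F \<omega>)))"
    using w(1) by (auto simp: restr3_def cyl_def)
  ultimately show "\<omega> \<in> (\<Union>P\<in>L \<inter> patterns3 F. cyl F (fst P) \<times> cyl F (fst (snd P)) \<times> cyl F (snd (snd P)))"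
    using w(2) by blast
next
  have cylD: "restrict x F = p" if "x \<in> cyl F p" "p \<in> PiE F (\<lambda>_. UNIV)" for x p
    by (rule PiE_ext[OF _ that(2)]) (use that in \<open>auto simp: cyl_def\<close>)
  fix \<omega> assume "\<omega> \<in> (\<Union>P\<in>L \<inter> patterns3 F. cyl F (fst P) \<times> cyl F (fst (snd P)) \<times> cyl F (snd (snd P)))"
  then obtain P where P: "P \<in> L" "P \<in> patterns3 F" and w: "fst \<omega> \<in> cyl F (fst P)"
    "fst (snd \<omega>) \<in> cyl F (fst (snd P))" "snd (snd \<omega>) \<in> cyl F (snd (snd P))"
    by (auto simp: mem_Times_iff)
  have "fst P \<in> PiE F (\<lambda>_. UNIV)" "fst (snd P) \<in> PiE F (\<lambda>_. UNIV)" "snd (snd P) \<in> PiE F (\<lambda>_. UNIV)"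
    using P(2) unfolding patterns3_def mem_Times_iff by blast+
  then have "restr3 F \<omega> = P" using cylD[OF w(1)] cylD[OF w(2)] cylD[OF w(3)] by (simp add: restr3_def)
  then show "\<omega> \<in> local_set F L"
    using P(1) w by (simp add: local_set_def space_m3 cyl_def mem_Times_iff)
qed

lemma local_set_sets:
  assumes F: "finite F" "F \<subseteq> carrier \<Gamma>"
  shows "local_set F L \<in> sets m3"
  unfolding local_set_decomp m3_def
  by (intro sets.finite_UN pair_measureI cyl_sets F) (use finite_patterns3[OF F(1)] in auto)

text \<open>A local event is a finite disjoint union of products of three cylinders.\<close>

lemma measure_local_set:
  assumes F: "finite F" "F \<subseteq> carrier \<Gamma>" and L: "L \<subseteq> patterns3 F"
  shows "measure m3 (local_set F L) = pattern_prob3 d k F L"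
proof -
  let ?C = "\<lambda>P. cyl F (fst P) \<times> cyl F (fst (snd P)) \<times> cyl F (snd (snd P))"
  have LL: "L \<inter> patterns3 F = L" using L by blast
  have fL: "finite L" using L finite_patterns3[OF F(1)] finite_subset by blast
  have disj: "cyl F p \<inter> cyl F q = {}" if pq: "p \<in> PiE F (\<lambda>_. UNIV)" "q \<in> PiE F (\<lambda>_. UNIV)" and neq: "p \<noteq> q" for p q
  proof -
    obtain g where "g \<in> F" "p g \<noteq> q g" using neq PiE_ext[OF pq] by blast
    then show ?thesis by (auto simp: cyl_def)
  qed
  have "disjoint_family_on ?C L"
    unfolding disjoint_family_on_def
  proof (intro ballI impI)
    fix P P' assume P: "P \<in> L" "P' \<in> L" "P \<noteq> P'"
    then have mem: "P \<in> patterns3 F" "P' \<in> patterns3 F" using L by auto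
    from P(3) consider "fst P \<noteq> fst P'" | "fst (snd P) \<noteq> fst (snd P')" | "snd (snd P) \<noteq> snd (snd P')"
      by (auto simp: prod_eq_iff)
    then show "?C P \<inter> ?C P' = {}"
    proof cases
      case 1
      then show ?thesis using disj[of "fst P" "fst P'"] mem by (auto simp: patterns3_def)
    next
      case 2
      then show ?thesis using disj[of "fst (snd P)" "fst (snd P')"] mem by (auto simp: patterns3_def)
    next
      case 3
      then show ?thesis using disj[of "snd (snd P)" "snd (snd P')"] mem by (auto simp: patterns3_def)
    qed
  qed
  then have "measure m3 (\<Union>P\<in>L. ?C P) = (\<Sum>P\<in>L. measure m3 (?C P))"
    using fL cyl_sets[OF F] unfolding m3_def by (intro mm3.finite_measure_finite_Union) auto
  also have "\<dots> = (\<Sum>P\<in>L. pattern_prob d k F (fst P) * (pattern_prob d k F (fst (snd P)) * pattern_prob d k F (snd (snd P))))"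
  proof (rule sum.cong)
    fix P
    have "emeasure m3 (?C P) = emeasure m (cyl F (fst P)) * (emeasure m (cyl F (fst (snd P))) * emeasure m (cyl F (snd (snd P))))"
      unfolding m3_def
      by (simp add: emeasure_pair_measure_Times cyl_sets[OF F]
        sigma_finite_measure.emeasure_pair_measure_Times[OF prob_space_imp_sigma_finite[OF mm.prob_space_axioms]])
    then show "measure m3 (?C P) = pattern_prob d k F (fst P) * (pattern_prob d k F (fst (snd P)) * pattern_prob d k F (snd (snd P)))"
      by (simp add: measure_def enn2real_mult measure_cyl[OF F, unfolded measure_def])
  qed simp
  finally show ?thesis unfolding local_set_decomp LL pattern_prob3_def .
qed

lemma regular_pattern_probs: "regular_pattern_probs d k"
  unfolding regular_pattern_probs_def
proof (intro allI impI conjI)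
  fix F assume F: "finite F" "F \<subseteq> carrier \<Gamma>"
  have "local_set F (patterns3 F) = space m3"
    by (auto simp: local_set_def patterns3_def restr3_def)
  then show "pattern_prob3 d k F (patterns3 F) = 1"
    using measure_local_set[OF F order_refl] prob_space.prob_space[OF prob_space_m3] by simp
  fix L assume L: "L \<subseteq> patterns3 F"
  show "0 \<le> pattern_prob3 d k F L" "pattern_prob3 d k F L \<le> 1"
    unfolding measure_local_set[OF F L, symmetric]
    by (rule measure_nonneg, rule prob_space.prob_le_1[OF prob_space_m3])
qed

end

section \<open>From local events to arbitrary measurable events\<close>

context parity_haar
begin

definition local_sets where
  "local_sets = {A. \<exists>F L. finite F \<and> F \<subseteq> carrier \<Gamma> \<and> A = local_set F L}"

lemma restr3_restr3: "F \<subseteq> F' \<Longrightarrow> restr3 F (restr3 F' \<omega>) = restr3 F \<omega>"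
  by (simp add: restr3_def Int_absorb1)

lemma local_set_mono_window: "F \<subseteq> F' \<Longrightarrow> local_set F L = local_set F' {P. restr3 F P \<in> L}"
  by (simp add: local_set_def restr3_restr3)

lemma algebra_local_sets: "algebra (space m3) local_sets"
proof (rule algebra_iff_Un[THEN iffD2], intro conjI ballI)
  show "local_sets \<subseteq> Pow (space m3)" by (auto simp: local_sets_def local_set_def)
  have "{} = local_set {} {}" by (simp add: local_set_def)
  then show "{} \<in> local_sets" unfolding local_sets_def by blast
  fix A assume "A \<in> local_sets"
  then obtain F L where F: "finite F" "F \<subseteq> carrier \<Gamma>" "A = local_set F L" by (auto simp: local_sets_def)
  have "space m3 - A = local_set F (- L)" by (auto simp: F(3) local_set_def)
  then show "space m3 - A \<in> local_sets" using F unfolding local_sets_def by blast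
  fix B assume "B \<in> local_sets"
  then obtain F' L' where F': "finite F'" "F' \<subseteq> carrier \<Gamma>" "B = local_set F' L'" by (auto simp: local_sets_def)
  have "A \<union> B = local_set (F \<union> F') {P. restr3 F P \<in> L \<or> restr3 F' P \<in> L'}"
    unfolding F(3) F'(3) local_set_mono_window[OF Un_upper1, of F L F'] local_set_mono_window[OF Un_upper2, of F' L' F]
    by (auto simp: local_set_def)
  moreover have "finite (F \<union> F')" "F \<union> F' \<subseteq> carrier \<Gamma>" using F F' by auto
  ultimately show "A \<union> B \<in> local_sets" unfolding local_sets_def by blast
qed

lemma local_sets_sets: "local_sets \<subseteq> sets m3"
  using local_set_sets by (auto simp: local_sets_def)

text \<open>It suffices that the identity is measurable from the sigma-algebra generated by local
  events, which is checked on the three coordinates.\<close>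

lemma sets_m3_local_sets: "sets m3 \<subseteq> sigma_sets (space m3) local_sets"
proof -
  define N where "N = sigma (space m3) local_sets"
  have sub: "local_sets \<subseteq> Pow (space m3)" by (auto simp: local_sets_def local_set_def)
  have N: "space N = space m3" "sets N = sigma_sets (space m3) local_sets"
    using sub by (simp_all add: N_def)
  have proj: "f \<in> measurable N m" if f: "\<And>\<omega>. \<omega> \<in> space m3 \<Longrightarrow> f \<omega> \<in> X"
    and loc: "\<And>F p. \<exists>L. {\<omega>\<in>space m3. f \<omega> \<in> cyl F p} = local_set F L" for f
  proof (rule measurable_sigma_sets)
    show "sets m = sigma_sets X cyls" by (rule sets_m_cyls)
    show "cyls \<subseteq> Pow X" by (auto simp: cyls_def cyl_def)
    show "f \<in> space N \<rightarrow> X" using f N by auto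
    fix C assume "C \<in> cyls"
    then consider "C = {}" | F p where "finite F" "F \<subseteq> carrier \<Gamma>" "C = cyl F p" by (auto simp: cyls_def)
    then show "f -` C \<inter> space N \<in> sets N"
    proof cases
      case 2
      obtain L where "{\<omega>\<in>space m3. f \<omega> \<in> cyl F p} = local_set F L" using loc by blast
      then have "f -` C \<inter> space N = local_set F L" unfolding 2(3) N(1) by auto
      then show ?thesis unfolding N(2) using 2 by (intro sigma_sets.Basic) (auto simp: local_sets_def)
    qed simp
  qed
  have "fst \<in> measurable N m"
  proof (rule proj)
    fix F p
    show "\<exists>L. {\<omega>\<in>space m3. fst \<omega> \<in> cyl F p} = local_set F L"
      by (rule exI[of _ "{P. \<forall>g\<in>F. fst P g = p g}"]) (auto simp: local_set_def restr3_def cyl_def space_m3)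
  qed (auto simp: space_m3)
  moreover have "(\<lambda>\<omega>. fst (snd \<omega>)) \<in> measurable N m"
  proof (rule proj)
    fix F p
    show "\<exists>L. {\<omega>\<in>space m3. fst (snd \<omega>) \<in> cyl F p} = local_set F L"
      by (rule exI[of _ "{P. \<forall>g\<in>F. fst (snd P) g = p g}"]) (auto simp: local_set_def restr3_def cyl_def space_m3)
  qed (auto simp: space_m3)
  moreover have "(\<lambda>\<omega>. snd (snd \<omega>)) \<in> measurable N m"
  proof (rule proj)
    fix F p
    show "\<exists>L. {\<omega>\<in>space m3. snd (snd \<omega>) \<in> cyl F p} = local_set F L"
      by (rule exI[of _ "{P. \<forall>g\<in>F. snd (snd P) g = p g}"]) (auto simp: local_set_def restr3_def cyl_def space_m3)
  qed (auto simp: space_m3)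
  ultimately have "(\<lambda>\<omega>. (fst \<omega>, fst (snd \<omega>), snd (snd \<omega>))) \<in> measurable N m3"
    unfolding m3_def by (intro measurable_Pair)
  then have id: "(\<lambda>\<omega>. \<omega>) \<in> measurable N m3" by simp
  show ?thesis
  proof
    fix A assume A: "A \<in> sets m3"
    then have "A \<subseteq> space m3" by (rule sets.sets_into_space)
    then show "A \<in> sigma_sets (space m3) local_sets"
      using measurable_sets[OF id A] N by (simp add: Int_absorb2)
  qed
qed

lemma transl3_measurable:
  assumes g: "g \<in> carrier \<Gamma>"
  shows "transl3 g \<in> measurable m3 m3"
proof -
  note [measurable] = transl_measurable[OF g]
  show ?thesis unfolding transl3_def[abs_def] m3_def by measurable
qed

lemma transl3_preserves:
  assumes g: "g \<in> carrier \<Gamma>"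
  shows "distr m3 m3 (transl3 g) = m3"
proof -
  have 2: "distr (m \<Otimes>\<^sub>M m) (m \<Otimes>\<^sub>M m) (\<lambda>(x, y). (transl g x, transl g y)) = m \<Otimes>\<^sub>M m"
    using pair_measure_distr[OF transl_measurable[OF g] transl_measurable[OF g]]
    by (simp add: transl_preserves[OF g] prob_space_axioms prob_space_imp_sigma_finite)
  have m2: "(\<lambda>(x, y). (transl g x, transl g y)) \<in> measurable (m \<Otimes>\<^sub>M m) (m \<Otimes>\<^sub>M m)"
    using transl_measurable[OF g] by measurable
  have "distr m3 m3 (\<lambda>(x, y). (transl g x, (\<lambda>(x, y). (transl g x, transl g y)) y)) = m3"
    unfolding m3_def
    using pair_measure_distr[OF transl_measurable[OF g] m2]
    by (simp add: transl_preserves[OF g] 2 mm.prob_space_axioms prob_space_imp_sigma_finite)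
  then show ?thesis by (simp add: transl3_def[abs_def] split_def)
qed

lemma measure_transl3_vimage:
  assumes g: "g \<in> carrier \<Gamma>" and A: "A \<in> sets m3"
  shows "measure m3 (transl3 g -` A \<inter> space m3) = measure m3 A"
  using measure_distr[OF transl3_measurable[OF g] A] by (simp add: transl3_preserves[OF g])

lemma transl3_restr3:
  assumes "g \<in> carrier \<Gamma>" "F \<subseteq> carrier \<Gamma>" "(\<lambda>h. g \<otimes>\<^bsub>\<Gamma>\<^esub> h) ` F \<subseteq> F'"
  shows "restr3 F (transl3 (inv\<^bsub>\<Gamma>\<^esub> g) \<omega>) = shift_pattern3 d k F g (restr3 F' \<omega>)"
proof -
  have "restrict (transl (inv\<^bsub>\<Gamma>\<^esub> g) x) F = shift_pattern d k F g (restrict x F')" for x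
    unfolding shift_pattern_def using assms
    by (intro restrict_ext) (auto simp: transl_apply subset_iff)
  then show ?thesis by (simp add: restr3_def transl3_def shift_pattern3_def)
qed

abbreviation gpow :: "nat \<Rightarrow> nat \<Rightarrow> gword set" where "gpow i j \<equiv> gen d k i [^]\<^bsub>\<Gamma>\<^esub> j"

text \<open>An event \<open>E\<close> encodes an equivariant random subset of \<Gamma>: the site g
  belongs to it if translation by the inverse of g leads into \<open>E\<close>. The defect concerns
  the check of generator i through the identity.\<close>

definition defect :: "nat \<Rightarrow> _ set \<Rightarrow> _ set" where
  "defect i E = {\<omega>\<in>space m3. odd (card {j\<in>{..<k}. transl3 (inv\<^bsub>\<Gamma>\<^esub> gpow i j) \<omega> \<in> E})}"

lemma transl3_space: "g \<in> carrier \<Gamma> \<Longrightarrow> \<omega> \<in> space m3 \<Longrightarrow> transl3 g \<omega> \<in> space m3"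
  using transl_parity_set by (auto simp: space_m3 transl3_def)

text \<open>The defect changes only if one of its k translates falls into the symmetric difference,
  so approximating \<open>E\<close> costs a factor k.\<close>

lemma defect_sym_diff:
  assumes E: "E \<in> sets m3" "E' \<in> sets m3" and i: "i < d"
  shows "defect i E' \<subseteq> defect i E \<union> (\<Union>j<k. transl3 (inv\<^bsub>\<Gamma>\<^esub> gpow i j) -` sym_diff E E' \<inter> space m3)"
proof
  fix \<omega> assume w: "\<omega> \<in> defect i E'"
  show "\<omega> \<in> defect i E \<union> (\<Union>j<k. transl3 (inv\<^bsub>\<Gamma>\<^esub> gpow i j) -` sym_diff E E' \<inter> space m3)"
  proof (rule ccontr)
    assume n: "\<omega> \<notin> defect i E \<union> (\<Union>j<k. transl3 (inv\<^bsub>\<Gamma>\<^esub> gpow i j) -` sym_diff E E' \<inter> space m3)"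
    have ws: "\<omega> \<in> space m3" using w by (simp add: defect_def)
    have "transl3 (inv\<^bsub>\<Gamma>\<^esub> gpow i j) \<omega> \<in> E \<longleftrightarrow> transl3 (inv\<^bsub>\<Gamma>\<^esub> gpow i j) \<omega> \<in> E'" if "j < k" for j
      using n ws that by blast
    then have "{j\<in>{..<k}. transl3 (inv\<^bsub>\<Gamma>\<^esub> gpow i j) \<omega> \<in> E} = {j\<in>{..<k}. transl3 (inv\<^bsub>\<Gamma>\<^esub> gpow i j) \<omega> \<in> E'}" by auto
    then show False using w n ws by (simp add: defect_def)
  qed
qed

lemma window_event_local_set:
  assumes F: "F \<subseteq> carrier \<Gamma>"
  shows "local_set (shifted_window d k F) (window_event d k F L) = local_set F L"
proof -
  let ?W = "shifted_window d k F"
  have "(\<lambda>h. \<one>\<^bsub>\<Gamma>\<^esub> \<otimes>\<^bsub>\<Gamma>\<^esub> h) ` F \<subseteq> ?W"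
    unfolding shifted_window_def using d_gt_0 k_gt_1 by (fastforce intro!: bexI[of _ 0])
  then have "shift_pattern3 d k F \<one>\<^bsub>\<Gamma>\<^esub> (restr3 ?W \<omega>) = restr3 F (transl3 (inv\<^bsub>\<Gamma>\<^esub> \<one>\<^bsub>\<Gamma>\<^esub>) \<omega>)" for \<omega>
    using transl3_restr3[OF Gam.one_closed F] by simp
  moreover have "transl3 (inv\<^bsub>\<Gamma>\<^esub> \<one>\<^bsub>\<Gamma>\<^esub>) \<omega> = \<omega>" if "\<omega> \<in> space m3" for \<omega>
    using that by (auto simp: transl3_def space_m3 transl_one)
  moreover have "restr3 ?W \<omega> \<in> patterns3 ?W" for \<omega> by (simp add: restr3_def patterns3_def)
  ultimately show ?thesis by (auto simp: local_set_def window_event_def)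
qed

lemma defect_event_local_set:
  assumes F: "F \<subseteq> carrier \<Gamma>" and i: "i < d"
  shows "local_set (shifted_window d k F) (defect_event d k F L i) = defect i (local_set F L)"
proof -
  let ?W = "shifted_window d k F"
  have key: "shift_pattern3 d k F (gpow i j) (restr3 ?W \<omega>) = restr3 F (transl3 (inv\<^bsub>\<Gamma>\<^esub> gpow i j) \<omega>)" if j: "j < k" for \<omega> j
  proof -
    have "(\<lambda>h. gpow i j \<otimes>\<^bsub>\<Gamma>\<^esub> h) ` F \<subseteq> ?W" unfolding shifted_window_def using i j by blast
    then show ?thesis using transl3_restr3[OF gen_pow_closed[OF i] F] by simp
  qed
  have "{j\<in>{..<k}. shift_pattern3 d k F (gpow i j) (restr3 ?W \<omega>) \<in> L} = {j\<in>{..<k}. transl3 (inv\<^bsub>\<Gamma>\<^esub> gpow i j) \<omega> \<in> local_set F L}"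
    if "\<omega> \<in> space m3" for \<omega>
    using transl3_space[OF Gam.inv_closed[OF gen_pow_closed[OF i]] that] key[of _ \<omega>] by (auto simp: local_set_def)
  moreover have "restr3 ?W \<omega> \<in> patterns3 ?W" for \<omega> by (simp add: restr3_def patterns3_def)
  ultimately show ?thesis by (auto simp: local_set_def[of ?W] defect_event_def defect_def)
qed

text \<open>An almost surely defect-free event of small positive measure would have a local
  approximation whose errors are small relative to its measure, which
  \<open>no_sparse_local_codeword\<close> excludes.\<close>

theorem no_sparse_codeword_factor:
  assumes "d \<ge> 3" "d < k"
  shows "\<exists>\<delta>>(0::real). \<forall>E\<in>sets m3. (\<forall>i<d. AE \<omega> in m3. \<omega> \<notin> defect i E) \<longrightarrow> measure m3 E < \<delta> \<longrightarrow> measure m3 E = 0"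
proof -
  interpret M: prob_space m3 by (rule prob_space_m3)
  from no_sparse_local_codeword[OF assms regular_pattern_probs]
  obtain \<delta> :: real where \<delta>: "\<delta> > 0" and D: "\<forall>F L (p::real). finite F \<longrightarrow> F \<subseteq> carrier (Gam d k) \<longrightarrow> 0 < p \<longrightarrow> p < \<delta> \<longrightarrow>
    \<bar>pattern_prob3 d k (shifted_window d k F) (window_event d k F L) - p\<bar> \<le> p / 40 \<longrightarrow>
    (\<forall>i<d. pattern_prob3 d k (shifted_window d k F) (defect_event d k F L i) \<le> p / 40) \<longrightarrow> False"
    by (elim exE conjE) (rule that)
  have "measure m3 E = 0" if E: "E \<in> sets m3" and ae: "\<forall>i<d. AE \<omega> in m3. \<omega> \<notin> defect i E" and small: "measure m3 E < \<delta>" for E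
  proof (rule ccontr)
    define p where "p = measure m3 E"
    assume "measure m3 E \<noteq> 0"
    then have p: "0 < p" "p < \<delta>" using small measure_nonneg[of m3 E] by (auto simp: p_def less_le)
    have "E \<in> sigma_sets (space m3) local_sets" using E sets_m3_local_sets by blast
    \<comment> \<open>The k in the denominator pays for the k translates in a defect.\<close>
    from approximation_by_algebra[OF M.finite_measure_axioms algebra_local_sets local_sets_sets this, of "p / (40 * k)"]
    obtain F L where F: "finite F" "F \<subseteq> carrier \<Gamma>" and ap: "measure m3 (sym_diff E (local_set F L)) < p / (40 * k)"
      using p k_gt_1 by (auto simp: local_sets_def)
    let ?E' = "local_set F L" and ?W = "shifted_window d k F"
    have E': "?E' \<in> sets m3" by (rule local_set_sets[OF F])
    have W: "finite ?W" "?W \<subseteq> carrier \<Gamma>" using F finite_shifted_window shifted_window_closed by auto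
    have D1: "sym_diff E ?E' \<in> sets m3" using E E' by auto
    have "p / (40 * k) \<le> p / 40" using p k_gt_1 by (simp add: field_simps)
    moreover have "\<bar>measure m3 ?E' - p\<bar> \<le> measure m3 (sym_diff E ?E')"
    proof -
      have "measure m3 ?E' \<le> measure m3 E + measure m3 (sym_diff E ?E')"
        by (rule order_trans[OF M.finite_measure_mono measure_Un_le[OF E D1]]) (use E D1 in auto)
      moreover have "measure m3 E \<le> measure m3 ?E' + measure m3 (sym_diff E ?E')"
        by (rule order_trans[OF M.finite_measure_mono measure_Un_le[OF E' D1]]) (use E' D1 in auto)
      ultimately show ?thesis by (simp add: p_def abs_le_iff)
    qed
    ultimately have 1: "\<bar>measure m3 ?E' - p\<bar> \<le> p / 40" using ap by linarith
    have 2: "measure m3 (defect i ?E') \<le> p / 40" if i: "i < d" for i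
    proof -
      let ?B = "\<lambda>j. transl3 (inv\<^bsub>\<Gamma>\<^esub> gpow i j) -` sym_diff E ?E' \<inter> space m3"
      note gc = Gam.inv_closed[OF gen_pow_closed[OF i]]
      have B: "?B j \<in> sets m3" for j by (rule measurable_sets[OF transl3_measurable[OF gc] D1])
      have dE: "defect i ?E' \<in> sets m3"
        unfolding defect_event_local_set[OF F(2) i, symmetric] by (rule local_set_sets[OF W])
      have "measure m3 (defect i ?E') \<le> measure m3 (\<Union>j<k. ?B j)"
      proof (rule M.finite_measure_mono_AE)
        show "AE \<omega> in m3. \<omega> \<in> defect i ?E' \<longrightarrow> \<omega> \<in> (\<Union>j<k. ?B j)"
          using ae[rule_format, OF i]
        proof eventually_elim
          case (elim \<omega>)
          then show ?case using defect_sym_diff[OF E E' i] by blast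
        qed
        show "(\<Union>j<k. ?B j) \<in> sets m3" using B by (intro sets.finite_UN) auto
      qed
      also have "\<dots> \<le> (\<Sum>j<k. measure m3 (?B j))"
        using B by (intro M.finite_measure_subadditive_finite) auto
      also have "\<dots> = (\<Sum>j<k. measure m3 (sym_diff E ?E'))"
        by (intro sum.cong refl measure_transl3_vimage gc D1)
      also have "\<dots> \<le> (\<Sum>j<k. p / (40 * k))" using ap by (intro sum_mono) simp
      also have "\<dots> = p / 40" using k_gt_1 by simp
      finally show ?thesis .
    qed
    have w: "window_event d k F L \<subseteq> patterns3 ?W" by (auto simp: window_event_def)
    have de: "defect_event d k F L i \<subseteq> patterns3 ?W" for i by (auto simp: defect_event_def)
    show False
    proof (rule D[rule_format, OF F p])
      show "\<bar>pattern_prob3 d k ?W (window_event d k F L) - p\<bar> \<le> p / 40"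
        using 1 measure_local_set[OF W w] window_event_local_set[OF F(2)] by simp
      show "pattern_prob3 d k ?W (defect_event d k F L i) \<le> p / 40" if i: "i < d" for i
        unfolding measure_local_set[OF W de, symmetric] defect_event_local_set[OF F(2) i] by (rule 2[OF i])
    qed
  qed
  then show ?thesis using \<delta> by blast
qed

end

section \<open>Bernoulli measures\<close>

text \<open>Off the set of full measure the map is replaced by a constant, which makes it measurable
  everywhere.\<close>

lemma factor_map_measurable_version:
  assumes f: "factor_map G M1 T1 M2 T2 f" and M1: "prob_space M1" and M2: "prob_space M2"
  shows "\<exists>f'. f' \<in> measurable M1 M2 \<and> distr M1 M2 f' = M2 \<and> (AE x in M1. f' x = f x)"
proof -
  interpret M1: prob_space M1 by fact
  interpret M2: prob_space M2 by fact
  obtain X where X: "X \<in> sets M1" "AE x in M1. x \<in> X"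
    and fm: "f \<in> measurable (restrict_space M1 X) M2" and fd: "distr (restrict_space M1 X) M2 f = M2"
    using f unfolding factor_map_def by blast
  have Xs: "X \<inter> space M1 = X" using sets.sets_into_space[OF X(1)] by blast
  obtain c where c: "c \<in> space M2" using M2.not_empty by blast
  define f' where "f' x = (if x \<in> X then f x else c)" for x
  have f'm: "f' \<in> measurable M1 M2"
    unfolding f'_def
  proof (rule measurable_If_restrict_space_iff[THEN iffD2])
    show "{x \<in> space M1. x \<in> X} \<in> sets M1" using X(1) Xs by (simp add: Int_def conj_commute)
    show "f \<in> measurable (restrict_space M1 {x. x \<in> X}) M2 \<and> (\<lambda>_. c) \<in> measurable (restrict_space M1 {x. x \<notin> X}) M2"
      using fm c by simp
  qed
  have "distr M1 M2 f' = M2"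
  proof (rule measure_eqI)
    fix A assume "A \<in> sets (distr M1 M2 f')"
    then have A: "A \<in> sets M2" by simp
    have "emeasure (distr M1 M2 f') A = emeasure M1 (f' -` A \<inter> space M1)"
      by (rule emeasure_distr[OF f'm A])
    also have "\<dots> = emeasure M1 (f -` A \<inter> X)"
    proof (rule emeasure_eq_AE)
      show "AE x in M1. x \<in> f' -` A \<inter> space M1 \<longleftrightarrow> x \<in> f -` A \<inter> X"
        using X(2) AE_space by eventually_elim (auto simp: f'_def)
      show "f' -` A \<inter> space M1 \<in> sets M1" by (rule measurable_sets[OF f'm A])
      have "f -` A \<inter> X \<in> sets (restrict_space M1 X)"
        using measurable_sets[OF fm A] X(1) Xs by (simp add: space_restrict_space)
      then show "f -` A \<inter> X \<in> sets M1" using X(1) Xs by (simp add: sets_restrict_space_iff)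
    qed
    also have "\<dots> = emeasure (restrict_space M1 X) (f -` A \<inter> X)"
      by (rule emeasure_restrict_space[symmetric]) (use X(1) Xs in auto)
    also have "\<dots> = emeasure (distr (restrict_space M1 X) M2 f) A"
      using emeasure_distr[OF fm A] X(1) Xs by (simp add: space_restrict_space)
    finally show "emeasure (distr M1 M2 f') A = emeasure M2 A" using fd by simp
  qed simp
  moreover have "AE x in M1. f' x = f x" using X(2) by eventually_elim (simp add: f'_def)
  ultimately show ?thesis using f'm by blast
qed

lemma sets_borel_of: "sets (borel_of T) = sigma_sets (topspace T) {U. openin T U}"
proof -
  have "{U. openin T U} \<subseteq> Pow (topspace T)" using openin_subset[of T] by auto
  then show ?thesis by (simp add: borel_of_def)
qed

text \<open>Otherwise every event has probability 0 or 1. A countable base of a Hausdorff topology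
  then pins down one point that carries all the mass.\<close>

lemma nontrivial_base_set:
  assumes \<kappa>: "standard_prob_space \<kappa>" and nt: "\<not> trivial_base \<kappa>"
  shows "\<exists>B\<in>sets \<kappa>. 0 < measure \<kappa> B \<and> measure \<kappa> B < 1"
proof (rule ccontr)
  interpret prob_space \<kappa> using \<kappa> by (simp add: standard_prob_space_def)
  assume "\<not> ?thesis"
  then have 01: "prob B = 0 \<or> prob B = 1" if "B \<in> sets \<kappa>" for B
    using that prob_le_1[of B] measure_nonneg[of \<kappa> B] by (auto simp: less_le)
  obtain T where T: "topspace T = space \<kappa>" "completely_metrizable_space T" "second_countable T" "sets \<kappa> = sets (borel_of T)"
    using \<kappa> by (auto simp: standard_prob_space_def)
  from T(3)[unfolded second_countable_def]
  obtain \<B> where \<B>0: "countable \<B>" "\<forall>V\<in>\<B>. openin T V"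
    "\<forall>U x. openin T U \<and> x \<in> U \<longrightarrow> (\<exists>V\<in>\<B>. x \<in> V \<and> V \<subseteq> U)"
    by (elim exE conjE) (rule that)
  have \<B>: "countable \<B>" "\<And>V. V \<in> \<B> \<Longrightarrow> openin T V"
    "\<And>U x. openin T U \<Longrightarrow> x \<in> U \<Longrightarrow> \<exists>V\<in>\<B>. x \<in> V \<and> V \<subseteq> U"
    by (rule \<B>0(1), rule \<B>0(2)[rule_format], assumption, rule \<B>0(3)[rule_format], rule conjI)
  have Bs: "V \<in> sets \<kappa>" if "V \<in> \<B>" for V
    unfolding T(4) sets_borel_of using \<B>(2)[OF that] by (intro sigma_sets.Basic) simp
  have "AE x in \<kappa>. x \<in> V \<longleftrightarrow> prob V = 1" if V: "V \<in> \<B>" for V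
    using 01[OF Bs[OF V]]
  proof
    assume "prob V = 1"
    then show ?thesis using prob_eq_1[OF Bs[OF V]] by simp
  next
    assume p0: "prob V = 0"
    then have "AE x in \<kappa>. x \<notin> V" using prob_eq_0[OF Bs[OF V]] by simp
    then show ?thesis using p0 by simp
  qed
  then have ae: "AE x in \<kappa>. \<forall>V\<in>\<B>. x \<in> V \<longleftrightarrow> prob V = 1"
    by (subst AE_ball_countable[OF \<B>(1)]) (rule ballI)
  have happens: "\<exists>x. P x" if "AE x in \<kappa>. P x" for P
    using that eventually_happens[of P "ae_filter \<kappa>"] by (auto simp: ae_filter_eq_bot_iff emeasure_space_1)
  from ae have "AE x in \<kappa>. x \<in> space \<kappa> \<and> (\<forall>V\<in>\<B>. x \<in> V \<longleftrightarrow> prob V = 1)"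
    using AE_space by eventually_elim blast
  \<comment> \<open>A point lying in exactly those base sets that have probability 1. Almost every
    point has this property, and two such points cannot be separated.\<close>
  then obtain a where a: "a \<in> space \<kappa>" "\<And>V. V \<in> \<B> \<Longrightarrow> a \<in> V \<longleftrightarrow> prob V = 1"
    using happens by blast
  have haus: "Hausdorff_space T"
    by (intro metrizable_imp_Hausdorff_space completely_metrizable_imp_metrizable_space T(2))
  have "AE x in \<kappa>. x = a"
    using ae AE_space
  proof eventually_elim
    case (elim x)
    show "x = a"
    proof (rule ccontr)
      assume "x \<noteq> a"
      then have "x \<in> topspace T \<and> a \<in> topspace T \<and> x \<noteq> a" using elim(2) a(1) T(1) by simp
      from haus[unfolded Hausdorff_space_def, rule_format, OF this]
      obtain U U' where U: "openin T U" "openin T U'" "x \<in> U" "a \<in> U'" "disjnt U U'" by (elim exE conjE) (rule that)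
      obtain V where "V \<in> \<B>" "x \<in> V" "V \<subseteq> U" using \<B>(3)[OF U(1,3)] by blast
      then show False using elim(1) a(2) U by (auto simp: disjnt_def)
    qed
  qed
  then show False using nt a(1) by (auto simp: trivial_base_def)
qed

text \<open>Only the Bernoulli part is reduced to finitely many coordinates; the dependence on the
  complementary factor remains arbitrary, because resampling leaves that factor fixed.\<close>

lemma sets_PiM_pair_finite_coordinates:
  assumes Z: "prob_space Z" and E: "E \<in> sets (PiM I (\<lambda>_. \<kappa>) \<Otimes>\<^sub>M Z)" and K: "prob_space \<kappa>" and "\<epsilon> > 0"
  shows "\<exists>H J. H \<in> sets (PiM I (\<lambda>_. \<kappa>) \<Otimes>\<^sub>M Z) \<and> finite J \<and> J \<subseteq> I \<and>
    measure (PiM I (\<lambda>_. \<kappa>) \<Otimes>\<^sub>M Z) (sym_diff E H) < \<epsilon> \<and>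
    (\<forall>b\<in>space (PiM I (\<lambda>_. \<kappa>)). \<forall>b'\<in>space (PiM I (\<lambda>_. \<kappa>)). \<forall>z\<in>space Z.
      (\<forall>g\<in>J. b g = b' g) \<longrightarrow> ((b, z) \<in> H \<longleftrightarrow> (b', z) \<in> H))"
proof -
  let ?B = "PiM I (\<lambda>_. \<kappa>)"
  let ?Y = "?B \<Otimes>\<^sub>M Z"
  interpret \<kappa>: prob_space \<kappa> by fact
  interpret Z: prob_space Z by fact
  interpret B: prob_space ?B by (intro prob_space_PiM K)
  interpret Y: pair_prob_space ?B Z ..
  define dep where "dep J H \<longleftrightarrow> (\<forall>b\<in>space ?B. \<forall>b'\<in>space ?B. \<forall>z\<in>space Z.
      (\<forall>g\<in>J. b g = b' g) \<longrightarrow> ((b, z) \<in> H \<longleftrightarrow> (b', z) \<in> H))" for J H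
  define \<A> where "\<A> = {H \<in> sets ?Y. \<exists>J. finite J \<and> J \<subseteq> I \<and> dep J H}"
  have AI: "H \<in> \<A>" if "H \<in> sets ?Y" "finite J" "J \<subseteq> I" "dep J H" for H J
    unfolding \<A>_def using that by blast
  have alg: "algebra (space ?Y) \<A>"
  proof (rule algebra_iff_Un[THEN iffD2], intro conjI ballI)
    show "\<A> \<subseteq> Pow (space ?Y)" using sets.sets_into_space by (auto simp: \<A>_def)
    have "dep {} {}" by (simp add: dep_def)
    then show "{} \<in> \<A>" by (intro AI[of "{}" "{}"]) auto
    fix H assume "H \<in> \<A>"
    then obtain J where H: "H \<in> sets ?Y" "finite J" "J \<subseteq> I" "dep J H" by (auto simp: \<A>_def)
    have "dep J (space ?Y - H)" using H(4) unfolding dep_def space_pair_measure by blast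
    then show "space ?Y - H \<in> \<A>" using H(1-3) by (intro AI[of _ J]) auto
    fix H' assume "H' \<in> \<A>"
    then obtain J' where H': "H' \<in> sets ?Y" "finite J'" "J' \<subseteq> I" "dep J' H'" by (auto simp: \<A>_def)
    have "dep (J \<union> J') (H \<union> H')" using H(4) H'(4) unfolding dep_def by (simp only: Un_iff ball_Un) blast
    moreover have "finite (J \<union> J')" "J \<union> J' \<subseteq> I" "H \<union> H' \<in> sets ?Y" using H(1-3) H'(1-3) by auto
    ultimately show "H \<union> H' \<in> \<A>" by (intro AI[of _ "J \<union> J'"])
  qed
  have As: "\<A> \<subseteq> sets ?Y" by (auto simp: \<A>_def)
  define N where "N = sigma (space ?Y) \<A>"
  have sub: "\<A> \<subseteq> Pow (space ?Y)" using sets.sets_into_space by (auto simp: \<A>_def)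
  have N: "space N = space ?Y" "sets N = sigma_sets (space ?Y) \<A>" using sub by (simp_all add: N_def)
  have "fst \<in> measurable N ?B"
  proof (rule measurable_PiM_single')
    show "(\<lambda>y. fst y g) \<in> measurable N \<kappa>" if g: "g \<in> I" for g
    proof (rule measurableI)
      fix A assume A: "A \<in> sets \<kappa>"
      let ?H = "(\<lambda>y. fst y g) -` A \<inter> space ?Y"
      have "(\<lambda>y. fst y g) \<in> measurable ?Y \<kappa>" using g by measurable
      then have "?H \<in> sets ?Y" using A by (rule measurable_sets)
      moreover have "dep {g} ?H" by (auto simp: dep_def space_pair_measure)
      ultimately have "?H \<in> \<A>" using g by (intro AI[of _ "{g}"]) auto
      then show "(\<lambda>y. fst y g) -` A \<inter> space N \<in> sets N" unfolding N by (rule sigma_sets.Basic)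
    qed (use g in \<open>auto simp: N space_pair_measure space_PiM\<close>)
    show "fst \<in> space N \<rightarrow> (\<Pi>\<^sub>E i\<in>I. space \<kappa>)" by (auto simp: N space_pair_measure space_PiM)
  qed
  moreover have "snd \<in> measurable N Z"
  proof (rule measurableI)
    fix A assume A: "A \<in> sets Z"
    let ?H = "snd -` A \<inter> space ?Y"
    have "?H \<in> sets ?Y" using measurable_sets[OF measurable_snd A] .
    moreover have "dep {} ?H" by (auto simp: dep_def space_pair_measure)
    ultimately have "?H \<in> \<A>" by (intro AI[of _ "{}"]) auto
    then show "snd -` A \<inter> space N \<in> sets N" unfolding N by (rule sigma_sets.Basic)
  qed (auto simp: N space_pair_measure)
  ultimately have "(\<lambda>y. (fst y, snd y)) \<in> measurable N ?Y" by (rule measurable_Pair)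
  then have id: "(\<lambda>y. y) \<in> measurable N ?Y" by simp
  have "E \<in> sigma_sets (space ?Y) \<A>"
    using measurable_sets[OF id E] sets.sets_into_space[OF E] N by (simp add: Int_absorb2)
  from approximation_by_algebra[OF Y.finite_measure_axioms alg As this \<open>\<epsilon> > 0\<close>]
  show ?thesis unfolding \<A>_def dep_def by blast
qed

section \<open>Splicing two Bernoulli samples, and infinitude of the group\<close>

definition select :: "'i set \<Rightarrow> 'i set \<Rightarrow> ('i \<Rightarrow> 'a) \<Rightarrow> ('i \<Rightarrow> 'a) \<Rightarrow> 'i \<Rightarrow> 'a" where
  "select I S b b' = (\<lambda>i\<in>I. if i \<in> S then b i else b' i)"

lemma select_measurable:
  "(\<lambda>(b, b'). select I S b b') \<in> measurable (PiM I (\<lambda>_. \<kappa>) \<Otimes>\<^sub>M PiM I (\<lambda>_. \<kappa>)) (PiM I (\<lambda>_. \<kappa>))"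
  unfolding select_def split_def by measurable

text \<open>On a box the coordinates inside \<open>S\<close> involve the first sample and the others
  the second, so independence gives the same product as for one sample.\<close>

lemma select_preserves_PiM:
  assumes \<kappa>: "prob_space \<kappa>"
  shows "distr (PiM I (\<lambda>_. \<kappa>) \<Otimes>\<^sub>M PiM I (\<lambda>_. \<kappa>)) (PiM I (\<lambda>_. \<kappa>)) (\<lambda>(b, b'). select I S b b') = PiM I (\<lambda>_. \<kappa>)"
proof -
  let ?B = "PiM I (\<lambda>_. \<kappa>)"
  interpret \<kappa>: prob_space \<kappa> by fact
  interpret P: product_prob_space "\<lambda>_. \<kappa>" I ..
  show ?thesis
  proof (rule P.PiM_eq)
    fix J F assume J: "finite J" "J \<subseteq> I" and F: "\<And>j. j \<in> J \<Longrightarrow> F j \<in> sets \<kappa>"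
    let ?E = "\<lambda>J. prod_emb I (\<lambda>_. \<kappa>) J (PiE J F)"
    have E: "?E J' \<in> sets ?B" if "J' \<subseteq> J" for J'
      using that J F by (intro sets_PiM_I) (auto intro: finite_subset)
    have "(\<lambda>(b, b'). select I S b b') -` ?E J \<inter> space (?B \<Otimes>\<^sub>M ?B) = ?E (J \<inter> S) \<times> ?E (J - S)"
    proof -
      have mem: "b \<in> ?E J' \<longleftrightarrow> b \<in> space ?B \<and> (\<forall>j\<in>J'. b j \<in> F j)" for b J'
        by (auto simp: prod_emb_def space_PiM)
      have sp: "select I S b b' \<in> space ?B" if "b \<in> space ?B" "b' \<in> space ?B" for b b'
        using that by (auto simp: select_def space_PiM)
      have sel: "(\<forall>j\<in>J. select I S b b' j \<in> F j) \<longleftrightarrow> (\<forall>j\<in>J \<inter> S. b j \<in> F j) \<and> (\<forall>j\<in>J - S. b' j \<in> F j)" for b b'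
        using J(2) by (auto simp: select_def subset_iff)
      have "x \<in> (\<lambda>(b, b'). select I S b b') -` ?E J \<inter> space (?B \<Otimes>\<^sub>M ?B) \<longleftrightarrow> x \<in> ?E (J \<inter> S) \<times> ?E (J - S)" for x
      proof (cases x)
        case x: (Pair b b')
        have "x \<in> (\<lambda>(b, b'). select I S b b') -` ?E J \<inter> space (?B \<Otimes>\<^sub>M ?B)
          \<longleftrightarrow> (select I S b b' \<in> space ?B \<and> (\<forall>j\<in>J. select I S b b' j \<in> F j)) \<and> b \<in> space ?B \<and> b' \<in> space ?B"
          by (simp add: x mem space_pair_measure)
        also have "\<dots> \<longleftrightarrow> (b \<in> space ?B \<and> (\<forall>j\<in>J \<inter> S. b j \<in> F j)) \<and> (b' \<in> space ?B \<and> (\<forall>j\<in>J - S. b' j \<in> F j))"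
          unfolding sel using sp by blast
        also have "\<dots> \<longleftrightarrow> x \<in> ?E (J \<inter> S) \<times> ?E (J - S)"
          by (simp add: x mem)
        finally show ?thesis .
      qed
      then show ?thesis by blast
    qed
    then have "emeasure (distr (?B \<Otimes>\<^sub>M ?B) ?B (\<lambda>(b, b'). select I S b b')) (?E J) = emeasure (?B \<Otimes>\<^sub>M ?B) (?E (J \<inter> S) \<times> ?E (J - S))"
      using E[of J] by (simp add: emeasure_distr[OF select_measurable])
    also have "\<dots> = emeasure ?B (?E (J \<inter> S)) * emeasure ?B (?E (J - S))"
      by (rule sigma_finite_measure.emeasure_pair_measure_Times[OF prob_space_imp_sigma_finite[OF prob_space_PiM[OF \<kappa>]]])
        (auto intro!: E)
    also have "\<dots> = (\<Prod>j\<in>J \<inter> S. emeasure \<kappa> (F j)) * (\<Prod>j\<in>J - S. emeasure \<kappa> (F j))"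
      using J F \<kappa> by (subst emeasure_PiM_emb; auto)+
    also have "\<dots> = (\<Prod>j\<in>J. emeasure \<kappa> (F j))"
      using J by (subst prod.union_disjoint[symmetric]) (auto intro!: prod.cong)
    finally show "emeasure (distr (?B \<Otimes>\<^sub>M ?B) ?B (\<lambda>(b, b'). select I S b b')) (?E J) = (\<Prod>j\<in>J. emeasure \<kappa> (F j))" .
  qed simp
qed

text \<open>Two generators acting on the natural numbers by rotating interleaved blocks push the
  point 0 arbitrarily far.\<close>

lemma infinite_Gam:
  assumes "d > 1" "k > 1"
  shows "infinite (carrier (Gam d k))"
proof -
  define f where "f x = k * (x div k) + Suc x mod k" for x :: nat
  have k: "k > 0" using assms by simp
  have f_iter: "(f ^^ j) x = k * (x div k) + (x + j) mod k" for j x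
  proof (induction j)
    case (Suc j)
    have lt: "(x + j) mod k < k" using k by simp
    have "(k * (x div k) + (x + j) mod k) div k = x div k" using k by simp
    moreover have "Suc (k * (x div k) + (x + j) mod k) mod k = (x + Suc j) mod k"
      by (metis add_Suc_right mod_Suc_eq mod_mult_self4 mult.commute)
    ultimately show ?case using Suc by (simp add: f_def)
  qed simp
  \<comment> \<open>Generator 0 rotates the blocks of length k starting at multiples of k; generator
    1 fixes 0 and rotates the same blocks shifted by 1. Alternating them leads from k N to k N + (k
    - 1) and on to k (N + 1).\<close>
  define h where "h i x = (if i = 0 then f x else if i = 1 then (case x of 0 \<Rightarrow> 0 | Suc y \<Rightarrow> Suc (f y)) else x)" for i x :: nat
  have h0: "(h 0 ^^ j) x = (f ^^ j) x" for j x by (induction j) (auto simp: h_def)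
  have h1: "(h 1 ^^ j) 0 = 0" "(h 1 ^^ j) (Suc y) = Suc ((f ^^ j) y)" for j y
    by (induction j) (auto simp: h_def)
  have "\<exists>act. right_action (Gam d k) UNIV act \<and> (\<forall>i<d. \<forall>x\<in>UNIV. act x (gen d k i) = h i x)"
  proof (rule right_action_Gam_exists)
    show "(h i ^^ k) x = x" for i x
    proof -
      have fk: "(f ^^ k) x = x" for x by (simp add: f_iter)
      have "(h i ^^ j) x = x" if "i \<noteq> 0" "i \<noteq> 1" for j by (induction j) (use that in \<open>auto simp: h_def\<close>)
      then show ?thesis using h0 h1 fk by (cases "i = 0"; cases "i = 1"; cases x) auto
    qed
  qed (use k in auto)
  then obtain act where act: "right_action (Gam d k) (UNIV :: nat set) act"
    and gen: "\<And>i x. i < d \<Longrightarrow> act x (gen d k i) = h i x" by blast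
  interpret Gam: group "Gam d k" by (rule group_Gam)
  have "\<exists>g\<in>carrier (Gam d k). act 0 g = k * N" for N
  proof (induction N)
    case 0
    then show ?case using right_actionD(1)[OF act] by (intro bexI[of _ "\<one>\<^bsub>Gam d k\<^esub>"]) auto
  next
    case (Suc N)
    then obtain g where g: "g \<in> carrier (Gam d k)" "act 0 g = k * N" by blast
    let ?a = "gen d k 0 [^]\<^bsub>Gam d k\<^esub> (k - 1)" and ?b = "gen d k 1"
    have c: "?a \<in> carrier (Gam d k)" "?b \<in> carrier (Gam d k)"
      using assms by (auto intro: gen_pow_closed gen_closed)
    have "act (k * N) ?a = (h 0 ^^ (k - 1)) (k * N)"
      by (rule right_action_gen_pow[OF act]) (use gen assms in auto)
    also have "\<dots> = k * N + (k - 1)"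
    proof -
      have "(k * N + (k - 1)) mod k = (k - 1) mod k" by (rule mod_mult_self4)
      moreover have "(k - 1) mod k = k - 1" "k * N div k = N" using k by simp_all
      ultimately show ?thesis unfolding h0 f_iter by simp
    qed
    finally have a: "act (k * N) ?a = Suc (k * N + (k - 2))" using assms by simp
    have "act (Suc (k * N + (k - 2))) ?b = Suc (f (k * N + (k - 2)))" using gen[of 1] assms by (simp add: h_def)
    also have "f (k * N + (k - 2)) = k * N + (k - 1)"
    proof -
      have "(k * N + (k - 2)) div k = N + (k - 2) div k" using k by (intro div_mult_self4) simp
      moreover have "(k - 2) div k = 0" using assms by simp
      moreover have "Suc (k - 2) = k - 1" using assms by simp
      then have "Suc (k * N + (k - 2)) mod k = (k * N + (k - 1)) mod k" by (simp only: add_Suc_right[symmetric])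
      moreover have "(k * N + (k - 1)) mod k = (k - 1) mod k" by (rule mod_mult_self4)
      moreover have "(k - 1) mod k = k - 1" using k by simp
      ultimately show ?thesis unfolding f_def by simp
    qed
    finally have b: "act (Suc (k * N + (k - 2))) ?b = k * Suc N" using assms by simp
    have "act 0 (g \<otimes>\<^bsub>Gam d k\<^esub> ?a \<otimes>\<^bsub>Gam d k\<^esub> ?b) = k * Suc N"
      using right_actionD(3)[OF act, of 0] g c a b by simp
    then show ?case using g c by (intro bexI[of _ "g \<otimes>\<^bsub>Gam d k\<^esub> ?a \<otimes>\<^bsub>Gam d k\<^esub> ?b"]) auto
  qed
  then have "range (\<lambda>N. k * N) \<subseteq> act 0 ` carrier (Gam d k)" by (metis image_iff image_subsetI)
  moreover have "infinite (range (\<lambda>N. k * N))"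
    using k by (intro range_inj_infinite) (simp add: inj_on_def)
  ultimately show ?thesis using finite_subset finite_imageI by blast
qed

section \<open>Resampling the Bernoulli factor\<close>

lemma distr_pair_fst_snd:
  assumes "prob_space M" "prob_space N"
  shows "distr (M \<Otimes>\<^sub>M N) M fst = M" "distr (M \<Otimes>\<^sub>M N) N snd = N"
proof -
  interpret M: prob_space M by fact
  interpret N: prob_space N by fact
  show "distr (M \<Otimes>\<^sub>M N) M fst = M"
  proof (rule measure_eqI)
    fix A assume "A \<in> sets (distr (M \<Otimes>\<^sub>M N) M fst)"
    then have A: "A \<in> sets M" by simp
    have "fst -` A \<inter> space (M \<Otimes>\<^sub>M N) = A \<times> space N"
      using sets.sets_into_space[OF A] by (auto simp: space_pair_measure)
    then show "emeasure (distr (M \<Otimes>\<^sub>M N) M fst) A = emeasure M A"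
      using A by (simp add: emeasure_distr N.emeasure_pair_measure_Times N.emeasure_space_1)
  qed simp
  show "distr (M \<Otimes>\<^sub>M N) N snd = N"
  proof (rule measure_eqI)
    fix A assume "A \<in> sets (distr (M \<Otimes>\<^sub>M N) N snd)"
    then have A: "A \<in> sets N" by simp
    have "snd -` A \<inter> space (M \<Otimes>\<^sub>M N) = space M \<times> A"
      using sets.sets_into_space[OF A] by (auto simp: space_pair_measure)
    then show "emeasure (distr (M \<Otimes>\<^sub>M N) N snd) A = emeasure N A"
      using A by (simp add: emeasure_distr N.emeasure_pair_measure_Times M.emeasure_space_1)
  qed simp
qed

lemma AE_measure_preserving:
  assumes "f \<in> measurable M N" "distr M N f = N" "AE y in N. P y"
  shows "AE x in M. P (f x)"
  using assms(3) by (intro AE_distrD[OF assms(1)]) (subst assms(2))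

text \<open>\<open>\<Phi>\<close> and \<open>\<theta>\<close> are everywhere defined versions of the
  conjugacy and its inverse. Equivariance holds almost everywhere for each g separately; since
  \<Gamma> is countable, such statements can be combined over all sites.\<close>

locale bernoulli_splitting = parity_haar d k m
  for d k :: nat and m :: "(gword set \<Rightarrow> bit) measure" +
  fixes \<kappa> :: "'k measure" and mz :: "'z measure" and T3 :: "gword set \<Rightarrow> 'z \<Rightarrow> 'z"
    and \<Phi> :: "(gword set \<Rightarrow> bit) \<Rightarrow> (gword set \<Rightarrow> 'k) \<times> 'z" and \<theta> :: "(gword set \<Rightarrow> 'k) \<times> 'z \<Rightarrow> gword set \<Rightarrow> bit"
  assumes \<kappa>: "prob_space \<kappa>" and mz: "prob_space mz"
    and \<Phi>m: "\<Phi> \<in> measurable m (PiM (carrier (Gam d k)) (\<lambda>_. \<kappa>) \<Otimes>\<^sub>M mz)"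
    and \<Phi>d: "distr m (PiM (carrier (Gam d k)) (\<lambda>_. \<kappa>) \<Otimes>\<^sub>M mz) \<Phi> = PiM (carrier (Gam d k)) (\<lambda>_. \<kappa>) \<Otimes>\<^sub>M mz"
    and \<Phi>eq: "\<And>g. g \<in> carrier (Gam d k) \<Longrightarrow> AE x in m. \<Phi> (shift_action (Gam d k) g x) = (shift_action (Gam d k) g (fst (\<Phi> x)), T3 g (snd (\<Phi> x)))"
    and \<theta>m: "\<theta> \<in> measurable (PiM (carrier (Gam d k)) (\<lambda>_. \<kappa>) \<Otimes>\<^sub>M mz) m"
    and \<theta>eq: "\<And>g. g \<in> carrier (Gam d k) \<Longrightarrow> AE y in PiM (carrier (Gam d k)) (\<lambda>_. \<kappa>) \<Otimes>\<^sub>M mz.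
       \<theta> (shift_action (Gam d k) g (fst y), T3 g (snd y)) = shift_action (Gam d k) g (\<theta> y)"
    and \<theta>\<Phi>: "AE x in m. \<theta> (\<Phi> x) = x"
    and \<Phi>\<theta>: "AE y in PiM (carrier (Gam d k)) (\<lambda>_. \<kappa>) \<Otimes>\<^sub>M mz. \<Phi> (\<theta> y) = y"
begin

abbreviation "BB \<equiv> PiM (carrier \<Gamma>) (\<lambda>_. \<kappa>)"
abbreviation "YY \<equiv> BB \<Otimes>\<^sub>M mz"

sublocale \<kappa>: prob_space \<kappa> by (rule \<kappa>)
sublocale mz: prob_space mz by (rule mz)
sublocale BB: prob_space BB by (intro prob_space_PiM \<kappa>)
sublocale YY: pair_prob_space BB mz ..

lemma prob_space_YY: "prob_space YY"
  by (rule YY.prob_space_axioms)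

lemma proj_measurable:
  "fst \<in> measurable m3 m" "(\<lambda>\<omega>. fst (snd \<omega>)) \<in> measurable m3 m" "(\<lambda>\<omega>. snd (snd \<omega>)) \<in> measurable m3 m"
  unfolding m3_def by measurable

lemma proj_preserves:
  "distr m3 m fst = m" "distr m3 m (\<lambda>\<omega>. fst (snd \<omega>)) = m" "distr m3 m (\<lambda>\<omega>. snd (snd \<omega>)) = m"
proof -
  note 1 = distr_pair_fst_snd[OF prob_space_axioms prob_space_axioms]
  note 2 = distr_pair_fst_snd[OF prob_space_axioms mm.prob_space_axioms]
  show "distr m3 m fst = m" unfolding m3_def by (rule 2)
  have "distr m3 m (fst \<circ> snd) = distr (distr m3 (m \<Otimes>\<^sub>M m) snd) m fst"
    unfolding m3_def by (rule distr_distr[symmetric]) measurable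
  then show "distr m3 m (\<lambda>\<omega>. fst (snd \<omega>)) = m" unfolding m3_def 2 1 by (simp add: o_def)
  have "distr m3 m (snd \<circ> snd) = distr (distr m3 (m \<Otimes>\<^sub>M m) snd) m snd"
    unfolding m3_def by (rule distr_distr[symmetric]) measurable
  then show "distr m3 m (\<lambda>\<omega>. snd (snd \<omega>)) = m" unfolding m3_def 2 1 by (simp add: o_def)
qed

lemma AE_proj:
  assumes "AE x in m. P x"
  shows "AE \<omega> in m3. P (fst \<omega>)" "AE \<omega> in m3. P (fst (snd \<omega>))" "AE \<omega> in m3. P (snd (snd \<omega>))"
  by (rule AE_measure_preserving[OF proj_measurable(1) proj_preserves(1) assms],
      rule AE_measure_preserving[OF proj_measurable(2) proj_preserves(2) assms],
      rule AE_measure_preserving[OF proj_measurable(3) proj_preserves(3) assms])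

lemma b_measurable: "(\<lambda>x. fst (\<Phi> x)) \<in> measurable m BB"
  using \<Phi>m by measurable

lemma b_preserves: "distr m BB (\<lambda>x. fst (\<Phi> x)) = BB"
proof -
  have "distr m BB (fst \<circ> \<Phi>) = distr (distr m YY \<Phi>) BB fst"
    by (rule distr_distr[symmetric, OF _ \<Phi>m]) measurable
  then show ?thesis unfolding \<Phi>d distr_pair_fst_snd[OF BB.prob_space_axioms mz] by (simp add: o_def)
qed

definition resample :: "gword set set \<Rightarrow> (gword set \<Rightarrow> bit) \<times> (gword set \<Rightarrow> bit) \<Rightarrow> (gword set \<Rightarrow> 'k) \<times> 'z" where
  "resample S xx = (select (carrier \<Gamma>) S (fst (\<Phi> (fst xx))) (fst (\<Phi> (snd xx))), snd (\<Phi> (snd xx)))"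

text \<open>For a fixed set of sites, splicing two independent Bernoulli parts gives a Bernoulli
  part that is still independent of the complementary part of the second point.\<close>

lemma resample_preserves:
  "resample S \<in> measurable (m \<Otimes>\<^sub>M m) YY" "distr (m \<Otimes>\<^sub>M m) YY (resample S) = YY"
proof -
  \<comment> \<open>Resampling factors through the first Bernoulli part and the full second image,
    whose joint law is a product. After slicing by the first, preimages of rectangles are again
    rectangles.\<close>
  define r where "r = (\<lambda>y. (select (carrier \<Gamma>) S (fst y) (fst (snd y)), snd (snd y)) :: (gword set \<Rightarrow> 'k) \<times> 'z)"
  have pm: "(\<lambda>(x, y). (fst (\<Phi> x), \<Phi> y)) \<in> measurable (m \<Otimes>\<^sub>M m) (BB \<Otimes>\<^sub>M YY)"
    using b_measurable \<Phi>m by measurable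
  have pd: "distr (m \<Otimes>\<^sub>M m) (BB \<Otimes>\<^sub>M YY) (\<lambda>(x, y). (fst (\<Phi> x), \<Phi> y)) = BB \<Otimes>\<^sub>M YY"
    using pair_measure_distr[OF b_measurable \<Phi>m] unfolding b_preserves \<Phi>d
    by (simp add: prob_space_YY prob_space_imp_sigma_finite)
  have sm: "(\<lambda>y. select (carrier \<Gamma>) S (fst y) (fst (snd y))) \<in> measurable (BB \<Otimes>\<^sub>M YY) BB"
    unfolding select_def by measurable
  have rm: "r \<in> measurable (BB \<Otimes>\<^sub>M YY) YY" unfolding r_def using sm by measurable
  have rd: "YY = distr (BB \<Otimes>\<^sub>M YY) YY r"
  proof (rule pair_measure_eqI)
    fix A C assume A: "A \<in> sets BB" and C: "C \<in> sets mz"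
    let ?s = "\<lambda>(b, b'). select (carrier \<Gamma>) S b b'"
    have AC: "A \<times> C \<in> sets YY" using A C by simp
    have pre: "?s -` A \<inter> space (BB \<Otimes>\<^sub>M BB) \<in> sets (BB \<Otimes>\<^sub>M BB)" by (rule measurable_sets[OF select_measurable A])
    have rpre: "r -` (A \<times> C) \<inter> space (BB \<Otimes>\<^sub>M YY) \<in> sets (BB \<Otimes>\<^sub>M YY)" by (rule measurable_sets[OF rm AC])
    have "emeasure (distr (BB \<Otimes>\<^sub>M YY) YY r) (A \<times> C) = emeasure (BB \<Otimes>\<^sub>M YY) (r -` (A \<times> C) \<inter> space (BB \<Otimes>\<^sub>M YY))"
      by (rule emeasure_distr[OF rm AC])
    also have "\<dots> = (\<integral>\<^sup>+ b. emeasure YY (Pair b -` (r -` (A \<times> C) \<inter> space (BB \<Otimes>\<^sub>M YY))) \<partial>BB)"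
      by (rule YY.emeasure_pair_measure_alt[OF rpre])
    also have "\<dots> = (\<integral>\<^sup>+ b. emeasure BB (Pair b -` (?s -` A \<inter> space (BB \<Otimes>\<^sub>M BB))) * emeasure mz C \<partial>BB)"
    proof (rule nn_integral_cong)
      fix b assume b: "b \<in> space BB"
      have "Pair b -` (r -` (A \<times> C) \<inter> space (BB \<Otimes>\<^sub>M YY)) = (Pair b -` (?s -` A \<inter> space (BB \<Otimes>\<^sub>M BB))) \<times> C"
        using b sets.sets_into_space[OF C] by (auto simp: r_def space_pair_measure)
      then show "emeasure YY (Pair b -` (r -` (A \<times> C) \<inter> space (BB \<Otimes>\<^sub>M YY))) = emeasure BB (Pair b -` (?s -` A \<inter> space (BB \<Otimes>\<^sub>M BB))) * emeasure mz C"
        using sets_Pair1[OF pre, of b] C by (simp add: mz.emeasure_pair_measure_Times)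
    qed
    also have "\<dots> = (\<integral>\<^sup>+ b. emeasure BB (Pair b -` (?s -` A \<inter> space (BB \<Otimes>\<^sub>M BB))) \<partial>BB) * emeasure mz C"
      by (rule nn_integral_multc) (rule BB.measurable_emeasure_Pair[OF pre])
    also have "\<dots> = emeasure (BB \<Otimes>\<^sub>M BB) (?s -` A \<inter> space (BB \<Otimes>\<^sub>M BB)) * emeasure mz C"
      by (simp only: BB.emeasure_pair_measure_alt[OF pre])
    also have "\<dots> = emeasure BB A * emeasure mz C"
      by (simp only: emeasure_distr[OF select_measurable A, symmetric] select_preserves_PiM[OF \<kappa>])
    finally show "emeasure BB A * emeasure mz C = emeasure (distr (BB \<Otimes>\<^sub>M YY) YY r) (A \<times> C)" by simp
  qed (simp_all add: BB.prob_space_axioms mz prob_space_imp_sigma_finite)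
  have eq: "resample S = r \<circ> (\<lambda>(x, y). (fst (\<Phi> x), \<Phi> y))"
    by (auto simp: resample_def r_def)
  show "resample S \<in> measurable (m \<Otimes>\<^sub>M m) YY" unfolding eq by (rule measurable_comp[OF pm rm])
  show "distr (m \<Otimes>\<^sub>M m) YY (resample S) = YY"
    unfolding eq distr_distr[OF rm pm, symmetric] pd by (rule rd[symmetric])
qed

text \<open>An equivariant random set of sites; each site is flagged with probability
  \<open>measure m W\<close>.\<close>

definition flags :: "(gword set \<Rightarrow> bit) set \<Rightarrow> (gword set \<Rightarrow> bit) \<Rightarrow> gword set set" where
  "flags W x = {g \<in> carrier \<Gamma>. transl (inv\<^bsub>\<Gamma>\<^esub> g) x \<in> W}"

definition mix :: "(gword set \<Rightarrow> bit) set \<Rightarrow> _ \<Rightarrow> (gword set \<Rightarrow> 'k) \<times> 'z" where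
  "mix W \<omega> = resample (flags W (fst \<omega>)) (snd \<omega>)"

lemma mix_measurable:
  assumes W: "W \<in> sets m"
  shows "mix W \<in> measurable m3 YY"
proof -
  have "(\<lambda>\<omega>. \<lambda>g\<in>carrier \<Gamma>. if g \<in> flags W (fst \<omega>) then fst (\<Phi> (fst (snd \<omega>))) g else fst (\<Phi> (snd (snd \<omega>))) g) \<in> measurable m3 BB"
  proof (rule measurable_restrict)
    fix g assume g: "g \<in> carrier \<Gamma>"
    have c1: "(\<lambda>\<omega>. fst (\<Phi> (fst (snd \<omega>))) g) \<in> measurable m3 \<kappa>"
      by (rule measurable_compose[OF measurable_compose[OF proj_measurable(2) b_measurable] measurable_component_singleton[OF g]])
    have c2: "(\<lambda>\<omega>. fst (\<Phi> (snd (snd \<omega>))) g) \<in> measurable m3 \<kappa>"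
      by (rule measurable_compose[OF measurable_compose[OF proj_measurable(3) b_measurable] measurable_component_singleton[OF g]])
    have "(\<lambda>\<omega>. transl (inv\<^bsub>\<Gamma>\<^esub> g) (fst \<omega>)) -` W \<inter> space m3 \<in> sets m3"
      by (rule measurable_sets[OF measurable_compose[OF proj_measurable(1) transl_measurable[OF Gam.inv_closed[OF g]]] W])
    moreover have "(\<lambda>\<omega>. transl (inv\<^bsub>\<Gamma>\<^esub> g) (fst \<omega>)) -` W \<inter> space m3 = {\<omega>\<in>space m3. g \<in> flags W (fst \<omega>)}"
      using g by (auto simp: flags_def)
    ultimately have "{\<omega>\<in>space m3. g \<in> flags W (fst \<omega>)} \<in> sets m3" by simp
    then show "(\<lambda>\<omega>. if g \<in> flags W (fst \<omega>) then fst (\<Phi> (fst (snd \<omega>))) g else fst (\<Phi> (snd (snd \<omega>))) g) \<in> measurable m3 \<kappa>"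
      by (intro measurable_If c1 c2)
  qed
  moreover have "(\<lambda>\<omega>. snd (\<Phi> (snd (snd \<omega>)))) \<in> measurable m3 mz"
    by (rule measurable_compose[OF measurable_compose[OF proj_measurable(3) \<Phi>m] measurable_snd])
  ultimately show ?thesis
    unfolding mix_def[abs_def] resample_def select_def by (rule measurable_Pair)
qed

text \<open>Conditioned on the first point the set of sites is fixed and independent of the other
  two points, so \<open>resample_preserves\<close> applies fibrewise.\<close>

lemma mix_preserves:
  assumes W: "W \<in> sets m"
  shows "distr m3 YY (mix W) = YY"
proof (rule measure_eqI)
  fix A assume "A \<in> sets (distr m3 YY (mix W))"
  then have A: "A \<in> sets YY" by simp
  have pre: "mix W -` A \<inter> space m3 \<in> sets (m \<Otimes>\<^sub>M (m \<Otimes>\<^sub>M m))"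
    using measurable_sets[OF mix_measurable[OF W] A] by (simp add: m3_def)
  have "emeasure (distr m3 YY (mix W)) A = emeasure (m \<Otimes>\<^sub>M (m \<Otimes>\<^sub>M m)) (mix W -` A \<inter> space m3)"
    using emeasure_distr[OF mix_measurable[OF W] A] by (simp add: m3_def)
  also have "\<dots> = (\<integral>\<^sup>+ x. emeasure (m \<Otimes>\<^sub>M m) (Pair x -` (mix W -` A \<inter> space m3)) \<partial>m)"
    by (rule sigma_finite_measure.emeasure_pair_measure_alt[OF prob_space_imp_sigma_finite[OF mm.prob_space_axioms] pre])
  also have "\<dots> = (\<integral>\<^sup>+ x. emeasure YY A \<partial>m)"
  proof (rule nn_integral_cong)
    fix x assume x: "x \<in> space m"
    have "Pair x -` (mix W -` A \<inter> space m3) = resample (flags W x) -` A \<inter> space (m \<Otimes>\<^sub>M m)"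
      using x by (auto simp: mix_def m3_def space_pair_measure)
    then show "emeasure (m \<Otimes>\<^sub>M m) (Pair x -` (mix W -` A \<inter> space m3)) = emeasure YY A"
      using emeasure_distr[OF resample_preserves(1) A] resample_preserves(2) by simp
  qed
  also have "\<dots> = emeasure YY A" by (simp add: emeasure_space_1)
  finally show "emeasure (distr m3 YY (mix W)) A = emeasure YY A" .
qed simp

lemma AE_mix: "W \<in> sets m \<Longrightarrow> AE y in YY. P y \<Longrightarrow> AE \<omega> in m3. P (mix W \<omega>)"
  by (rule AE_measure_preserving[OF mix_measurable mix_preserves])

lemma flags_transl:
  assumes "g \<in> carrier \<Gamma>" "h \<in> carrier \<Gamma>"
  shows "h \<in> flags W (transl g x) \<longleftrightarrow> inv\<^bsub>\<Gamma>\<^esub> g \<otimes>\<^bsub>\<Gamma>\<^esub> h \<in> flags W x"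
proof -
  have "transl (inv\<^bsub>\<Gamma>\<^esub> h) (transl g x) = transl (inv\<^bsub>\<Gamma>\<^esub> (inv\<^bsub>\<Gamma>\<^esub> g \<otimes>\<^bsub>\<Gamma>\<^esub> h)) x"
    using assms transl_mult[of "inv\<^bsub>\<Gamma>\<^esub> h" g x] by (simp add: Gam.inv_mult_group)
  then show ?thesis using assms by (simp add: flags_def)
qed

text \<open>The flagged sites and both Bernoulli parts are moved along together, so the
  coordinatewise choice commutes with the shift.\<close>

lemma mix_equivariant:
  assumes W: "W \<in> sets m" and g: "g \<in> carrier \<Gamma>"
  shows "AE \<omega> in m3. mix W (transl3 g \<omega>) = (shift_action \<Gamma> g (fst (mix W \<omega>)), T3 g (snd (mix W \<omega>)))"
  using AE_proj(2)[OF \<Phi>eq[OF g]] AE_proj(3)[OF \<Phi>eq[OF g]]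
proof eventually_elim
  case (elim \<omega>)
  have "select (carrier \<Gamma>) (flags W (transl g (fst \<omega>))) (shift_action \<Gamma> g b) (shift_action \<Gamma> g b')
     = shift_action \<Gamma> g (select (carrier \<Gamma>) (flags W (fst \<omega>)) b b')" for b b' :: "gword set \<Rightarrow> 'k"
    unfolding select_def shift_action_def using flags_transl[OF g, of _ W "fst \<omega>"] g
    by (intro restrict_ext) auto
  then show ?case using elim by (simp add: mix_def resample_def transl3_def transl_def)
qed

end

section \<open>The difference between a Haar point and its resampled version\<close>

context bernoulli_splitting
begin

text \<open>The event that this difference is 1 at the identity; its translates describe the other
  sites, as \<open>moved_transl\<close> shows.\<close>

definition moved :: "(gword set \<Rightarrow> bit) set \<Rightarrow> _ set" where
  "moved W = {\<omega> \<in> space m3. snd (snd \<omega>) \<one>\<^bsub>\<Gamma>\<^esub> \<noteq> \<theta> (mix W \<omega>) \<one>\<^bsub>\<Gamma>\<^esub>}"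

lemma resampled_measurable: "W \<in> sets m \<Longrightarrow> (\<lambda>\<omega>. \<theta> (mix W \<omega>)) \<in> measurable m3 m"
  by (rule measurable_compose[OF mix_measurable \<theta>m])

lemma moved_sets:
  assumes W: "W \<in> sets m"
  shows "moved W \<in> sets m3"
proof -
  have "(\<lambda>\<omega>. snd (snd \<omega>) \<one>\<^bsub>\<Gamma>\<^esub>) \<in> measurable m3 (count_space UNIV)"
    by (rule measurable_compose[OF proj_measurable(3) coordinate_measurable]) simp
  moreover have "(\<lambda>\<omega>. \<theta> (mix W \<omega>) \<one>\<^bsub>\<Gamma>\<^esub>) \<in> measurable m3 (count_space UNIV)"
    by (rule measurable_compose[OF resampled_measurable[OF W] coordinate_measurable]) simp
  ultimately have "{\<omega> \<in> space m3. snd (snd \<omega>) \<one>\<^bsub>\<Gamma>\<^esub> = b \<and> \<theta> (mix W \<omega>) \<one>\<^bsub>\<Gamma>\<^esub> = b'} \<in> sets m3" for b b'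
    by measurable
  then have "{\<omega> \<in> space m3. snd (snd \<omega>) \<one>\<^bsub>\<Gamma>\<^esub> = 0 \<and> \<theta> (mix W \<omega>) \<one>\<^bsub>\<Gamma>\<^esub> = 1} \<union>
     {\<omega> \<in> space m3. snd (snd \<omega>) \<one>\<^bsub>\<Gamma>\<^esub> = 1 \<and> \<theta> (mix W \<omega>) \<one>\<^bsub>\<Gamma>\<^esub> = 0} \<in> sets m3" by blast
  moreover have "a \<noteq> b \<longleftrightarrow> a = 0 \<and> b = 1 \<or> a = 1 \<and> b = 0" for a b :: bit by (cases a; cases b) auto
  then have "moved W = {\<omega> \<in> space m3. snd (snd \<omega>) \<one>\<^bsub>\<Gamma>\<^esub> = 0 \<and> \<theta> (mix W \<omega>) \<one>\<^bsub>\<Gamma>\<^esub> = 1} \<union>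
     {\<omega> \<in> space m3. snd (snd \<omega>) \<one>\<^bsub>\<Gamma>\<^esub> = 1 \<and> \<theta> (mix W \<omega>) \<one>\<^bsub>\<Gamma>\<^esub> = 0}"
    unfolding moved_def by blast
  ultimately show ?thesis by simp
qed

lemma moved_transl:
  assumes W: "W \<in> sets m" and g: "g \<in> carrier \<Gamma>"
  shows "AE \<omega> in m3. transl3 (inv\<^bsub>\<Gamma>\<^esub> g) \<omega> \<in> moved W \<longleftrightarrow> snd (snd \<omega>) g \<noteq> \<theta> (mix W \<omega>) g"
proof -
  have gi: "inv\<^bsub>\<Gamma>\<^esub> g \<in> carrier \<Gamma>" using g by simp
  show ?thesis
    using mix_equivariant[OF W gi] AE_mix[OF W \<theta>eq[OF gi]] AE_space
  proof eventually_elim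
    case (elim \<omega>)
    have "\<theta> (mix W (transl3 (inv\<^bsub>\<Gamma>\<^esub> g) \<omega>)) = transl (inv\<^bsub>\<Gamma>\<^esub> g) (\<theta> (mix W \<omega>))"
      using elim by (simp add: transl_def)
    then show ?case
      using transl3_space[OF gi elim(3)] g by (simp add: moved_def transl3_def transl_apply)
  qed
qed

text \<open>The difference of two points of X satisfies every check, and a sum of indicators modulo
  2 is the parity of their number.\<close>

lemma moved_defect:
  assumes W: "W \<in> sets m" and i: "i < d"
  shows "AE \<omega> in m3. \<omega> \<notin> defect i (moved W)"
proof -
  have "AE \<omega> in m3. \<forall>j\<in>{..<k}. transl3 (inv\<^bsub>\<Gamma>\<^esub> gpow i j) \<omega> \<in> moved W \<longleftrightarrow> snd (snd \<omega>) (gpow i j) \<noteq> \<theta> (mix W \<omega>) (gpow i j)"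
    using moved_transl[OF W gen_pow_closed[OF i]] by (subst AE_ball_countable) auto
  then show ?thesis
    using AE_space
  proof eventually_elim
    case (elim \<omega>)
    have x: "snd (snd \<omega>) \<in> X" using elim(2) by (auto simp: space_m3)
    have y: "\<theta> (mix W \<omega>) \<in> X" using measurable_space[OF resampled_measurable[OF W] elim(2)] by (simp add: space_m)
    have s: "(\<Sum>j<k. a (gpow i j)) = 0" if a: "a \<in> X" for a
    proof -
      have "(\<Sum>j<k. a (gpow i j)) = (\<Sum>j<k. a (\<one>\<^bsub>\<Gamma>\<^esub> \<otimes>\<^bsub>\<Gamma>\<^esub> gpow i j))"
        using gen_pow_closed[OF i] by simp
      also have "\<dots> = 0" using a i by (simp add: parity_set_def del: Gam.l_one)
      finally show ?thesis .
    qed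
    have "of_bool (odd (card {j\<in>{..<k}. transl3 (inv\<^bsub>\<Gamma>\<^esub> gpow i j) \<omega> \<in> moved W}))
      = (\<Sum>j<k. of_bool (transl3 (inv\<^bsub>\<Gamma>\<^esub> gpow i j) \<omega> \<in> moved W) :: bit)"
      by (rule sum_bit_of_bool[symmetric]) simp
    also have "\<dots> = (\<Sum>j<k. snd (snd \<omega>) (gpow i j) + \<theta> (mix W \<omega>) (gpow i j))"
    proof (rule sum.cong)
      fix j assume "j \<in> {..<k}"
      moreover have "of_bool (a \<noteq> b) = a + b" for a b :: bit by (cases a; cases b) auto
      ultimately show "of_bool (transl3 (inv\<^bsub>\<Gamma>\<^esub> gpow i j) \<omega> \<in> moved W) = snd (snd \<omega>) (gpow i j) + \<theta> (mix W \<omega>) (gpow i j)"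
        using elim(1) by simp
    qed simp
    also have "\<dots> = 0" by (simp only: sum.distrib s[OF x] s[OF y] add_0)
    finally show ?case by (simp add: defect_def)
  qed
qed

text \<open>Up to a small error, the value of \<open>\<theta>\<close> at the identity depends on
  finitely many Bernoulli coordinates \<open>J\<close> and on the complementary factor. It changes
  only if a site of \<open>J\<close> is flagged or one of the two approximations fails.\<close>

lemma moved_small:
  assumes "\<delta> > 0"
  shows "\<exists>\<epsilon>>0. \<forall>W\<in>sets m. measure m W < \<epsilon> \<longrightarrow> measure m3 (moved W) < \<delta>"
proof -
  interpret M: prob_space m3 by (rule prob_space_m3)
  let ?H = "{y \<in> space YY. \<theta> y \<one>\<^bsub>\<Gamma>\<^esub> = 1}"
  have "(\<lambda>y. \<theta> y \<one>\<^bsub>\<Gamma>\<^esub>) \<in> measurable YY (count_space UNIV)"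
    by (rule measurable_compose[OF \<theta>m coordinate_measurable]) simp
  then have H: "?H \<in> sets YY" by measurable
  from sets_PiM_pair_finite_coordinates[OF mz H \<kappa>, of "\<delta> / 4"] assms
  obtain H J where HJ: "H \<in> sets YY" "finite J" "J \<subseteq> carrier \<Gamma>" "measure YY (sym_diff ?H H) < \<delta> / 4"
    and dep: "\<forall>b\<in>space BB. \<forall>b'\<in>space BB. \<forall>z\<in>space mz. (\<forall>g\<in>J. b g = b' g) \<longrightarrow> ((b, z) \<in> H \<longleftrightarrow> (b', z) \<in> H)"
    by auto
  \<comment> \<open>Flags in \<open>J\<close> then cost at most \<delta>/4, and each of the two
    approximations less than \<delta>/4. The added 1 avoids division by 0 for empty
    \<open>J\<close>.\<close>
  define \<epsilon> where "\<epsilon> = \<delta> / (4 * (card J + 1))"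
  have "measure m3 (moved W) < \<delta>" if W: "W \<in> sets m" "measure m W < \<epsilon>" for W
  proof -
    let ?D = "sym_diff ?H H"
    have D: "?D \<in> sets YY" using H HJ(1) by auto
    let ?\<Phi> = "\<lambda>\<omega>. \<Phi> (snd (snd \<omega>))"
    have \<Phi>3: "?\<Phi> \<in> measurable m3 YY" by (rule measurable_compose[OF proj_measurable(3) \<Phi>m])
    have \<Phi>3d: "distr m3 YY ?\<Phi> = YY"
      using distr_distr[OF \<Phi>m proj_measurable(3)] by (simp add: proj_preserves \<Phi>d o_def)
    let ?A = "?\<Phi> -` ?D \<inter> space m3" and ?B = "mix W -` ?D \<inter> space m3"
    let ?C = "\<lambda>g. (\<lambda>\<omega>. transl (inv\<^bsub>\<Gamma>\<^esub> g) (fst \<omega>)) -` W \<inter> space m3"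
    have A: "?A \<in> sets m3" "measure m3 ?A = measure YY ?D"
      using measurable_sets[OF \<Phi>3 D] measure_distr[OF \<Phi>3 D] by (simp_all add: \<Phi>3d)
    have B: "?B \<in> sets m3" "measure m3 ?B = measure YY ?D"
      using measurable_sets[OF mix_measurable[OF W(1)] D] measure_distr[OF mix_measurable[OF W(1)] D]
      by (simp_all add: mix_preserves[OF W(1)])
    have C: "?C g \<in> sets m3" "measure m3 (?C g) = measure m W" if g: "g \<in> J" for g
    proof -
      have gi: "inv\<^bsub>\<Gamma>\<^esub> g \<in> carrier \<Gamma>" using g HJ(3) by auto
      have t: "(\<lambda>\<omega>. transl (inv\<^bsub>\<Gamma>\<^esub> g) (fst \<omega>)) \<in> measurable m3 m"
        by (rule measurable_compose[OF proj_measurable(1) transl_measurable[OF gi]])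
      have td: "distr m3 m (\<lambda>\<omega>. transl (inv\<^bsub>\<Gamma>\<^esub> g) (fst \<omega>)) = m"
        using distr_distr[OF transl_measurable[OF gi] proj_measurable(1)]
        by (simp add: proj_preserves transl_preserves[OF gi] o_def)
      show "?C g \<in> sets m3" by (rule measurable_sets[OF t W(1)])
      show "measure m3 (?C g) = measure m W" using measure_distr[OF t W(1)] by (simp add: td)
    qed
    \<comment> \<open>Off these sets the approximation is exact for the old and the new point, and
      both have the same coordinates in \<open>J\<close>; hence they agree at the identity.\<close>
    have "measure m3 (moved W) \<le> measure m3 (?A \<union> ?B \<union> (\<Union>g\<in>J. ?C g))"
    proof (rule M.finite_measure_mono_AE)
      show "AE \<omega> in m3. \<omega> \<in> moved W \<longrightarrow> \<omega> \<in> ?A \<union> ?B \<union> (\<Union>g\<in>J. ?C g)"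
        using AE_proj(3)[OF \<theta>\<Phi>] AE_space
      proof eventually_elim
        case (elim \<omega>)
        show ?case
        proof (rule impI, rule ccontr)
          assume mv: "\<omega> \<in> moved W" and n: "\<omega> \<notin> ?A \<union> ?B \<union> (\<Union>g\<in>J. ?C g)"
          have sp: "?\<Phi> \<omega> \<in> space YY" "mix W \<omega> \<in> space YY"
            using measurable_space[OF \<Phi>3 elim(2)] measurable_space[OF mix_measurable[OF W(1)] elim(2)] by auto
          have 1: "?\<Phi> \<omega> \<in> ?H \<longleftrightarrow> ?\<Phi> \<omega> \<in> H" using n elim(2) by blast
          have 2: "mix W \<omega> \<in> ?H \<longleftrightarrow> mix W \<omega> \<in> H" using n elim(2) by blast
          have 3: "g \<notin> flags W (fst \<omega>)" if "g \<in> J" for g using n that elim(2) by (auto simp: flags_def)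
          have "fst (mix W \<omega>) g = fst (?\<Phi> \<omega>) g" if "g \<in> J" for g
            using 3[OF that] HJ(3) that by (auto simp: mix_def resample_def select_def)
          moreover have "snd (mix W \<omega>) = snd (?\<Phi> \<omega>)" by (simp add: mix_def resample_def)
          ultimately have "(fst (mix W \<omega>), snd (mix W \<omega>)) \<in> H \<longleftrightarrow> (fst (?\<Phi> \<omega>), snd (?\<Phi> \<omega>)) \<in> H"
            using dep[rule_format, of "fst (mix W \<omega>)" "fst (?\<Phi> \<omega>)" "snd (?\<Phi> \<omega>)"] sp
            by (simp add: space_pair_measure mem_Times_iff)
          then have "mix W \<omega> \<in> H \<longleftrightarrow> ?\<Phi> \<omega> \<in> H" by simp
          then have "\<theta> (mix W \<omega>) \<one>\<^bsub>\<Gamma>\<^esub> = 1 \<longleftrightarrow> \<theta> (?\<Phi> \<omega>) \<one>\<^bsub>\<Gamma>\<^esub> = 1"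
            using 1 2 sp by simp
          then have "\<theta> (mix W \<omega>) \<one>\<^bsub>\<Gamma>\<^esub> = snd (snd \<omega>) \<one>\<^bsub>\<Gamma>\<^esub>"
            unfolding elim(1) by (cases "\<theta> (mix W \<omega>) \<one>\<^bsub>\<Gamma>\<^esub>"; cases "snd (snd \<omega>) \<one>\<^bsub>\<Gamma>\<^esub>") auto
          then show False using mv by (simp add: moved_def)
        qed
      qed
      show "?A \<union> ?B \<union> (\<Union>g\<in>J. ?C g) \<in> sets m3" using A B C HJ(2) by (intro sets.Un sets.finite_UN) auto
    qed
    also have "\<dots> \<le> measure m3 (?A \<union> ?B) + measure m3 (\<Union>g\<in>J. ?C g)"
      using A B C HJ(2) by (intro measure_Un_le sets.Un sets.finite_UN) auto
    also have "measure m3 (?A \<union> ?B) \<le> measure m3 ?A + measure m3 ?B"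
      by (rule measure_Un_le[OF A(1) B(1)])
    also have "measure m3 (\<Union>g\<in>J. ?C g) \<le> (\<Sum>g\<in>J. measure m3 (?C g))"
      using C HJ(2) by (intro M.finite_measure_subadditive_finite) auto
    also have "\<dots> = card J * measure m W" using C by simp
    also have "\<dots> \<le> card J * \<epsilon>" using W(2) by (intro mult_left_mono) auto
    also have "\<dots> \<le> \<delta> / 4" using assms by (simp add: \<epsilon>_def field_simps)
    finally show ?thesis using A(2) B(2) HJ(4) assms by linarith
  qed
  moreover have "\<epsilon> > 0" using assms by (simp add: \<epsilon>_def)
  ultimately show ?thesis by blast
qed

text \<open>If nothing moved, applying \<open>\<Phi>\<close> would show that new and old Bernoulli
  values coincide at flagged sites. But they are independent of each other and of the flag, and with
  positive probability one lies in \<open>B\<close> and the other does not.\<close>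

lemma moved_positive:
  assumes W: "W \<in> sets m" "measure m W > 0" and B: "B \<in> sets \<kappa>" "0 < measure \<kappa> B" "measure \<kappa> B < 1"
  shows "measure m3 (moved W) > 0"
proof (rule ccontr)
  interpret M: prob_space m3 by (rule prob_space_m3)
  assume "\<not> ?thesis"
  then have 0: "measure m3 (moved W) = 0" using measure_nonneg[of m3 "moved W"] by linarith
  have "AE \<omega> in m3. snd (snd \<omega>) g = \<theta> (mix W \<omega>) g" if g: "g \<in> carrier \<Gamma>" for g
  proof -
    have gi: "inv\<^bsub>\<Gamma>\<^esub> g \<in> carrier \<Gamma>" using g by simp
    let ?E = "transl3 (inv\<^bsub>\<Gamma>\<^esub> g) -` moved W \<inter> space m3"
    have E: "?E \<in> sets m3" by (rule measurable_sets[OF transl3_measurable[OF gi] moved_sets[OF W(1)]])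
    have "measure m3 ?E = 0" unfolding measure_transl3_vimage[OF gi moved_sets[OF W(1)]] by (rule 0)
    then have "AE \<omega> in m3. \<omega> \<notin> ?E" using M.prob_eq_0[OF E] by simp
    then show ?thesis using moved_transl[OF W(1) g] AE_space by eventually_elim blast
  qed
  then have "AE \<omega> in m3. \<forall>g\<in>carrier \<Gamma>. snd (snd \<omega>) g = \<theta> (mix W \<omega>) g"
    by (subst AE_ball_countable[OF countable_carrier_Gam]) (rule ballI)
  then have "AE \<omega> in m3. snd (snd \<omega>) = \<theta> (mix W \<omega>)"
    using AE_space
  proof eventually_elim
    case (elim \<omega>)
    have "snd (snd \<omega>) \<in> PiE (carrier \<Gamma>) (\<lambda>_. UNIV)" "\<theta> (mix W \<omega>) \<in> PiE (carrier \<Gamma>) (\<lambda>_. UNIV)"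
      using elim(2) measurable_space[OF resampled_measurable[OF W(1)] elim(2)]
      by (auto simp: space_m3 space_m parity_set_def)
    then show ?case using elim(1) by (intro PiE_ext) auto
  qed
  then have "AE \<omega> in m3. \<Phi> (snd (snd \<omega>)) = mix W \<omega>"
    using AE_mix[OF W(1) \<Phi>\<theta>] by eventually_elim simp
  then have ae: "AE \<omega> in m3. \<not> (fst \<omega> \<in> W \<and> fst (\<Phi> (fst (snd \<omega>))) \<one>\<^bsub>\<Gamma>\<^esub> \<in> B \<and> fst (\<Phi> (snd (snd \<omega>))) \<one>\<^bsub>\<Gamma>\<^esub> \<notin> B)"
    using AE_space
  proof eventually_elim
    case (elim \<omega>)
    show ?case
    proof
      assume a: "fst \<omega> \<in> W \<and> fst (\<Phi> (fst (snd \<omega>))) \<one>\<^bsub>\<Gamma>\<^esub> \<in> B \<and> fst (\<Phi> (snd (snd \<omega>))) \<one>\<^bsub>\<Gamma>\<^esub> \<notin> B"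
      have "fst \<omega> \<in> X" using elim(2) by (auto simp: space_m3)
      then have "\<one>\<^bsub>\<Gamma>\<^esub> \<in> flags W (fst \<omega>)" using a by (simp add: flags_def transl_one)
      then have "fst (mix W \<omega>) \<one>\<^bsub>\<Gamma>\<^esub> = fst (\<Phi> (fst (snd \<omega>))) \<one>\<^bsub>\<Gamma>\<^esub>"
        by (simp add: mix_def resample_def select_def)
      then show False using a unfolding elim(1)[symmetric] by simp
    qed
  qed
  let ?b = "\<lambda>x. fst (\<Phi> x) \<one>\<^bsub>\<Gamma>\<^esub>"
  have bm: "?b \<in> measurable m \<kappa>"
    by (rule measurable_compose[OF b_measurable measurable_component_singleton]) simp
  have bd: "distr m \<kappa> ?b = \<kappa>"
  proof -
    have cm: "(\<lambda>b. b \<one>\<^bsub>\<Gamma>\<^esub>) \<in> measurable BB \<kappa>" by (rule measurable_component_singleton) simp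
    show ?thesis
      using distr_distr[OF cm b_measurable] distr_PiM_component[of "carrier \<Gamma>" "\<lambda>_. \<kappa>" "\<one>\<^bsub>\<Gamma>\<^esub>"] \<kappa>
      by (simp add: b_preserves o_def)
  qed
  let ?P = "?b -` B \<inter> space m" and ?N = "?b -` (space \<kappa> - B) \<inter> space m"
  have P: "?P \<in> sets m" "measure m ?P = measure \<kappa> B"
    using measurable_sets[OF bm B(1)] measure_distr[OF bm B(1)] by (simp_all add: bd)
  have Bc: "space \<kappa> - B \<in> sets \<kappa>" using B(1) by auto
  have N: "?N \<in> sets m" "measure m ?N = 1 - measure \<kappa> B"
    using measurable_sets[OF bm Bc] measure_distr[OF bm Bc] \<kappa>.prob_compl[OF B(1)] by (simp_all add: bd)
  \<comment> \<open>The flag at the identity, the new value and the old value are read from the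
    first, second and third point, so the probability is a product.\<close>
  have sets: "W \<times> ?P \<times> ?N \<in> sets m3" unfolding m3_def using W(1) P(1) N(1) by simp
  have "emeasure m3 (W \<times> ?P \<times> ?N) = emeasure m W * (emeasure m ?P * emeasure m ?N)"
    unfolding m3_def
    by (simp add: emeasure_pair_measure_Times W(1) P(1) N(1)
        sigma_finite_measure.emeasure_pair_measure_Times[OF prob_space_imp_sigma_finite[OF mm.prob_space_axioms]])
  then have "measure m3 (W \<times> ?P \<times> ?N) = measure m W * (measure m ?P * measure m ?N)"
    by (simp add: measure_def enn2real_mult)
  then have pos: "measure m3 (W \<times> ?P \<times> ?N) > 0" using W(2) B P(2) N(2) by simp
  have "AE \<omega> in m3. \<omega> \<notin> W \<times> ?P \<times> ?N" using ae by eventually_elim auto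
  then show False using pos M.prob_eq_0[OF sets] by simp
qed

text \<open>\<open>W\<close> prescribes membership in \<open>B\<close> at r distinct sites, which an
  infinite group provides for every r; its measure is \<open>measure \<kappa> B ^ r\<close>.\<close>

lemma small_positive_set:
  assumes B: "B \<in> sets \<kappa>" "0 < measure \<kappa> B" "measure \<kappa> B < 1" and d: "d > 1" and \<epsilon>: "\<epsilon> > 0"
  shows "\<exists>W\<in>sets m. 0 < measure m W \<and> measure m W < \<epsilon>"
proof -
  obtain r where r: "measure \<kappa> B ^ r < \<epsilon>" using real_arch_pow_inv[OF \<epsilon> B(3)] by blast
  obtain J where J: "finite J" "J \<subseteq> carrier \<Gamma>" "card J = r"
    using infinite_arbitrarily_large[OF infinite_Gam[OF d k_gt_1]] by blast
  let ?E = "prod_emb (carrier \<Gamma>) (\<lambda>_. \<kappa>) J (PiE J (\<lambda>_. B))"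
  have E: "?E \<in> sets BB" using J B(1) by (intro sets_PiM_I) auto
  have "emeasure BB ?E = (\<Prod>g\<in>J. emeasure \<kappa> B)" using J B(1) \<kappa> by (intro emeasure_PiM_emb) auto
  then have mE: "measure BB ?E = measure \<kappa> B ^ r" by (simp add: measure_def[of BB] \<kappa>.emeasure_eq_measure ennreal_power J(3))
  let ?W = "(\<lambda>x. fst (\<Phi> x)) -` ?E \<inter> space m"
  have W: "?W \<in> sets m" "measure m ?W = measure BB ?E"
    using measurable_sets[OF b_measurable E] measure_distr[OF b_measurable E] by (simp_all add: b_preserves)
  show ?thesis
  proof (rule bexI[OF _ W(1)], intro conjI)
    show "0 < measure m ?W" unfolding W(2) mE using B(2) by simp
    show "measure m ?W < \<epsilon>" unfolding W(2) mE by (rule r)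
  qed
qed

theorem no_nontrivial_splitting:
  assumes d: "d \<ge> 3" and dk: "d < k" and B: "B \<in> sets \<kappa>" "0 < measure \<kappa> B" "measure \<kappa> B < 1"
  shows False
proof -
  obtain \<delta> :: real where \<delta>: "\<delta> > 0"
    "\<forall>E\<in>sets m3. (\<forall>i<d. AE \<omega> in m3. \<omega> \<notin> defect i E) \<longrightarrow> measure m3 E < \<delta> \<longrightarrow> measure m3 E = 0"
    using no_sparse_codeword_factor[OF d dk] by blast
  obtain \<epsilon> where \<epsilon>: "\<epsilon> > 0" "\<forall>W\<in>sets m. measure m W < \<epsilon> \<longrightarrow> measure m3 (moved W) < \<delta>"
    using moved_small[OF \<delta>(1)] by blast
  obtain W where W: "W \<in> sets m" "0 < measure m W" "measure m W < \<epsilon>"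
    using small_positive_set[OF B _ \<epsilon>(1)] d by auto
  have "measure m3 (moved W) < \<delta>" using \<epsilon>(2) W by blast
  then have "measure m3 (moved W) = 0" using \<delta>(2) moved_sets[OF W(1)] moved_defect[OF W(1)] by blast
  then show False using moved_positive[OF W(1,2) B] by simp
qed

end

section \<open>From a direct Bernoulli factor to a splitting\<close>

lemma shift_action_preserves_PiM:
  assumes "prob_space \<kappa>" and g: "g \<in> carrier (Gam d k)"
  shows "shift_action (Gam d k) g \<in> measurable (PiM (carrier (Gam d k)) (\<lambda>_. \<kappa>)) (PiM (carrier (Gam d k)) (\<lambda>_. \<kappa>))"
    and "distr (PiM (carrier (Gam d k)) (\<lambda>_. \<kappa>)) (PiM (carrier (Gam d k)) (\<lambda>_. \<kappa>)) (shift_action (Gam d k) g)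
      = PiM (carrier (Gam d k)) (\<lambda>_. \<kappa>)"
proof -
  interpret Gam: group "Gam d k" by (rule group_Gam)
  have into: "inv\<^bsub>Gam d k\<^esub> g \<otimes>\<^bsub>Gam d k\<^esub> h \<in> carrier (Gam d k)" if "h \<in> carrier (Gam d k)" for h
    using g that by simp
  show "shift_action (Gam d k) g \<in> measurable (PiM (carrier (Gam d k)) (\<lambda>_. \<kappa>)) (PiM (carrier (Gam d k)) (\<lambda>_. \<kappa>))"
    unfolding shift_action_def[abs_def]
    by (intro measurable_restrict measurable_component_singleton into)
  have "inj_on (\<lambda>h. inv\<^bsub>Gam d k\<^esub> g \<otimes>\<^bsub>Gam d k\<^esub> h) (carrier (Gam d k))"
    using g by (auto simp: inj_on_def)
  then show "distr (PiM (carrier (Gam d k)) (\<lambda>_. \<kappa>)) (PiM (carrier (Gam d k)) (\<lambda>_. \<kappa>)) (shift_action (Gam d k) g)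
      = PiM (carrier (Gam d k)) (\<lambda>_. \<kappa>)"
    unfolding shift_action_def[abs_def] using assms(1) into
    by (intro distr_PiM_reindex) auto
qed

theorem theorem2:
  fixes d k :: nat
    and m :: "(gword set \<Rightarrow> bit) measure"
  assumes "k > d" and "d \<ge> 3"
    and "haar_prob_measure (parity_group d k) (parity_topology d k) m"
  shows "\<not> (\<exists>\<kappa> :: 'k measure.
           direct_bernoulli_factor TYPE('z) (Gam d k) m (shift_action (Gam d k)) \<kappa> \<and>
           \<not> trivial_base \<kappa>)"
proof
  assume "\<exists>\<kappa> :: 'k measure. direct_bernoulli_factor TYPE('z) (Gam d k) m (shift_action (Gam d k)) \<kappa> \<and> \<not> trivial_base \<kappa>"
  then obtain \<kappa> :: "'k measure" and \<pi> where std: "standard_prob_space \<kappa>" and nt: "\<not> trivial_base \<kappa>"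
    and direct: "direct_factor_map TYPE('z) (Gam d k) m (shift_action (Gam d k)) (bernoulli_measure (Gam d k) \<kappa>) (shift_action (Gam d k)) \<pi>"
    unfolding direct_bernoulli_factor_def by blast
  let ?G = "Gam d k" and ?S = "shift_action (Gam d k)"
  let ?B = "PiM (carrier ?G) (\<lambda>_. \<kappa>)"
  from direct obtain mz :: "'z measure" and T3 \<xi> where pmp: "pmp_system ?G mz T3"
    and conj: "measure_conjugacy ?G m ?S (?B \<Otimes>\<^sub>M mz) (\<lambda>g (y, z). (?S g y, T3 g z)) (\<lambda>x. (\<pi> x, \<xi> x))"
    unfolding direct_factor_map_def bernoulli_measure_def by blast
  let ?Y = "?B \<Otimes>\<^sub>M mz" and ?T = "\<lambda>g (y, z). (?S g y, T3 g z)"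
  interpret parity_haar d k m using assms by unfold_locales auto
  interpret \<kappa>: prob_space \<kappa> using std by (simp add: standard_prob_space_def)
  interpret mz: prob_space mz using pmp by (simp add: pmp_system_def)
  interpret BB: prob_space ?B by (intro prob_space_PiM \<kappa>.prob_space_axioms)
  interpret YY: pair_prob_space ?B mz ..
  obtain \<theta>0 where f\<Phi>: "factor_map ?G m ?S ?Y ?T (\<lambda>x. (\<pi> x, \<xi> x))" and f\<theta>: "factor_map ?G ?Y ?T m ?S \<theta>0"
    and inv1: "AE x in m. \<theta>0 (\<pi> x, \<xi> x) = x" and inv2: "AE y in ?Y. (\<pi> (\<theta>0 y), \<xi> (\<theta>0 y)) = y"
    using conj unfolding measure_conjugacy_def by blast
  from factor_map_measurable_version[OF f\<Phi> prob_space_axioms YY.prob_space_axioms]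
  obtain \<Phi> where \<Phi>: "\<Phi> \<in> measurable m ?Y" "distr m ?Y \<Phi> = ?Y" "AE x in m. \<Phi> x = (\<pi> x, \<xi> x)" by blast
  from factor_map_measurable_version[OF f\<theta> YY.prob_space_axioms prob_space_axioms]
  obtain \<theta> where \<theta>: "\<theta> \<in> measurable ?Y m" "distr ?Y m \<theta> = m" "AE y in ?Y. \<theta> y = \<theta>0 y" by blast
  \<comment> \<open>Invariance of the product measure allows the almost everywhere equality of
    \<open>\<theta>\<close> and \<open>\<theta>0\<close> to be evaluated at shifted points
    too.\<close>
  have Tm: "?T g \<in> measurable ?Y ?Y" "distr ?Y ?Y (?T g) = ?Y" if g: "g \<in> carrier ?G" for g
  proof -
    note S = shift_action_preserves_PiM[OF \<kappa>.prob_space_axioms g]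
    have T3: "T3 g \<in> measurable mz mz" "distr mz mz (T3 g) = mz" using pmp g by (auto simp: pmp_system_def)
    show "?T g \<in> measurable ?Y ?Y" using S(1) T3(1) by measurable
    show "distr ?Y ?Y (?T g) = ?Y"
      using pair_measure_distr[OF S(1) T3(1)] unfolding S(2) T3(2)
      by (simp add: mz.prob_space_axioms prob_space_imp_sigma_finite)
  qed
  interpret bernoulli_splitting d k m \<kappa> mz T3 \<Phi> \<theta>
  proof
    fix g assume g: "g \<in> carrier ?G"
    have "AE x in m. (\<pi> (?S g x), \<xi> (?S g x)) = ?T g (\<pi> x, \<xi> x)"
      using f\<Phi> g unfolding factor_map_def by blast
    moreover have "AE x in m. \<Phi> (?S g x) = (\<pi> (?S g x), \<xi> (?S g x))"
      using AE_measure_preserving[OF transl_measurable[OF g] transl_preserves[OF g] \<Phi>(3)] by (simp add: transl_def)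
    ultimately show "AE x in m. \<Phi> (?S g x) = (?S g (fst (\<Phi> x)), T3 g (snd (\<Phi> x)))"
      using \<Phi>(3) by eventually_elim simp
    have "AE y in ?Y. \<theta>0 (?T g y) = ?S g (\<theta>0 y)" using f\<theta> g unfolding factor_map_def by blast
    moreover have "AE y in ?Y. \<theta> (?T g y) = \<theta>0 (?T g y)"
      by (rule AE_measure_preserving[OF Tm[OF g] \<theta>(3)])
    ultimately show "AE y in ?Y. \<theta> (?S g (fst y), T3 g (snd y)) = ?S g (\<theta> y)"
      using \<theta>(3) by eventually_elim (simp add: split_def)
  next
    show "AE x in m. \<theta> (\<Phi> x) = x"
      using inv1 \<Phi>(3) AE_measure_preserving[OF \<Phi>(1,2) \<theta>(3)] by eventually_elim simp
    show "AE y in ?Y. \<Phi> (\<theta> y) = y"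
      using inv2 \<theta>(3) AE_measure_preserving[OF \<theta>(1,2) \<Phi>(3)] by eventually_elim simp
  qed (fact \<kappa>.prob_space_axioms mz.prob_space_axioms \<Phi>(1,2) \<theta>(1))+
  obtain B where "B \<in> sets \<kappa>" "0 < measure \<kappa> B" "measure \<kappa> B < 1"
    using nontrivial_base_set[OF std nt] by blast
  then show False by (rule no_nontrivial_splitting[OF assms(2,1)])
qed

end
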